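(* Let $k$ be an algebraically closed field and $n \geq 4$. Let $\mathcal{U}_n$ be the variety of twisted $n$-gons over $k$ with its action of $\mathrm{PGL}_3$. The geometric quotient $\mathcal{T}_n = \mathcal{U}_n / \mathrm{PGL}_3$ exists, and there is an isomorphism of varieties $$\mathcal{T}_n \xrightarrow{\sim} (\mathbb{P}^1 \smallsetminus \{0,1,\infty\})^{2n}, \qquad v \mapsto (x_1(v), \dots, x_n(v), y_1(v), \dots, y_n(v)),$$ where $x_i(v), y_i(v)$ are the left and right corner invariants of $v$.
   Context: A twisted $n$-gon ($n \ge 4$) over $k$ is a sequence $(v_i)_{i \in \mathbb{Z}}$ in $\mathbb{P}^2(k)$ such that (i) there is $M \in \mathrm{PGL}_3(k)$ (the monodromy, necessarily unique) with $M v_i = v_{i+n}$ for all $i$, and (ii) for every $i$, among $v_i, v_{i+1}, v_{i+2}, v_{i+3}, v_{i+4}$ no three points are collinear, except possibly $v_i, v_{i+2}, v_{i+4}$. The set $\mathcal{U}_n$ of twisted $n$-gons is viewed as an open subvariety of $(\mathbb{P}^2)^n \times \mathrm{PGL}_3$ via $(v_i) \mapsto (v_1, \dots, v_n, M)$, and $\mathrm{PGL}_3$ acts by $A \cdot (v_1,\dots,v_n,M) = (Av_1,\dots,Av_n,AMA^{-1})$. For a group $G$ acting algebraically on a variety $V$, a categorical quotient is a $G$-invariant morphism $\chi \colon V \to V'$ of varieties through which every $G$-invariant morphism from $V$ to a variety factors uniquely. It is a geometric quotient, written $V/G$, if in addition any two points of $V$ with the same image in $V'$ lie in the same $G$-orbit.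 The cross-ratio of $p_1,p_2,p_3,p_4$ on a projective line, with $p_1\ne p_3$, $p_2\neq p_4$, is $[p_1,p_2,p_3,p_4] = \frac{(p_1-p_2)(p_3-p_4)}{(p_1-p_3)(p_2-p_4)}$ computed in any affine coordinate in which none of the four points is $0$ or $\infty$ (the result is independent of this choice). The corner invariants of a twisted $n$-gon $v = (v_i)$ are $$x_i = [v_{i-2},\, v_{i-1},\, \overline{v_iv_{i+1}} \cap \overline{v_{i-2}v_{i-1}},\, \overline{v_{i+1}v_{i+2}} \cap \overline{v_{i-2}v_{i-1}}],$$ $$y_i = [\overline{v_{i+1}v_{i+2}} \cap \overline{v_{i-2}v_{i-1}},\, \overline{v_{i-1}v_i} \cap \overline{v_{i+1}v_{i+2}},\, v_{i+1},\, v_{i+2}].$$ They are $\mathrm{PGL}_3$-invariant functions on $\mathcal{U}_n$. *)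

theory Defs
  imports "HOL-Analysis.Analysis" "HOL-Computational_Algebra.Polynomial"
begin

section \<open>Varieties as spaces with functions\<close>

text \<open>
  A variety over an algebraically closed field is treated in the classical way: a topological
  space carrying a sheaf of field-valued functions that is locally an affine variety, and that is
  separated. Sections over an open set are total functions whose values outside
  that set are irrelevant. The values of \<open>regular_on\<close> at sets that are not open have no meaning.
\<close>

record ('p, 'k) fspace =
  zariski :: "'p topology"
  regular_on :: "'p set \<Rightarrow> ('p \<Rightarrow> 'k) set"

definition points :: "('p, 'k) fspace \<Rightarrow> 'p set" where
  "points X = topspace (zariski X)"

definition function_sheaf :: "('p, 'k::field) fspace \<Rightarrow> bool" where
  "function_sheaf X \<longleftrightarrow> (\<forall>U. openin (zariski X) U \<longrightarrow>
     (\<forall>c. (\<lambda>_. c) \<in> regular_on X U) \<and>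
     (\<forall>f\<in>regular_on X U. \<forall>g\<in>regular_on X U.
        (\<lambda>x. f x + g x) \<in> regular_on X U \<and> (\<lambda>x. f x * g x) \<in> regular_on X U) \<and>
     (\<forall>f\<in>regular_on X U. \<forall>g. (\<forall>x\<in>U. g x = f x) \<longrightarrow> g \<in> regular_on X U) \<and>
     (\<forall>f\<in>regular_on X U. \<forall>V. openin (zariski X) V \<and> V \<subseteq> U \<longrightarrow> f \<in> regular_on X V) \<and>
     (\<forall>f. (\<forall>x\<in>U. \<exists>V. openin (zariski X) V \<and> x \<in> V \<and> V \<subseteq> U \<and> f \<in> regular_on X V)
        \<longrightarrow> f \<in> regular_on X U))"

definition morphism :: "('p, 'k) fspace \<Rightarrow> ('q, 'k) fspace \<Rightarrow> ('p \<Rightarrow> 'q) \<Rightarrow> bool" where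
  "morphism X Y \<phi> \<longleftrightarrow> continuous_map (zariski X) (zariski Y) \<phi> \<and>
     (\<forall>V. openin (zariski Y) V \<longrightarrow>
        (\<forall>f\<in>regular_on Y V. f \<circ> \<phi> \<in> regular_on X {x \<in> points X. \<phi> x \<in> V}))"

definition isomorphism :: "('p, 'k) fspace \<Rightarrow> ('q, 'k) fspace \<Rightarrow> ('p \<Rightarrow> 'q) \<Rightarrow> bool" where
  "isomorphism X Y \<phi> \<longleftrightarrow> morphism X Y \<phi> \<and>
     (\<exists>\<psi>. morphism Y X \<psi> \<and> (\<forall>x\<in>points X. \<psi> (\<phi> x) = x) \<and> (\<forall>y\<in>points Y. \<phi> (\<psi> y) = y))"

definition open_sub :: "('p, 'k) fspace \<Rightarrow> 'p set \<Rightarrow> ('p, 'k) fspace" where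
  "open_sub X U = \<lparr> zariski = subtopology (zariski X) U, regular_on = regular_on X \<rparr>"

text \<open>
  The coarsest structure on \<open>P\<close> for which, for every \<open>(U, f) \<in> G\<close>, the set \<open>U\<close> is open and \<open>f\<close> is
  regular on \<open>U\<close>: \<open>gen_fun P G\<close> consists of the polynomial expressions in the given functions
  (each on the intersection of the domains involved), the sets where such an expression does not
  vanish form a base of the topology, and a function is regular if it is locally a quotient of two
  such expressions.
\<close>

inductive_set gen_fun :: "'p set \<Rightarrow> ('p set \<times> ('p \<Rightarrow> 'k::field)) set \<Rightarrow> ('p set \<times> ('p \<Rightarrow> 'k)) set"
  for P G where
  base: "(U, f) \<in> G \<Longrightarrow> (U, f) \<in> gen_fun P G"
| const: "(P, \<lambda>_. c) \<in> gen_fun P G"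
| add: "\<lbrakk>(U, f) \<in> gen_fun P G; (V, g) \<in> gen_fun P G\<rbrakk> \<Longrightarrow> (U \<inter> V, \<lambda>x. f x + g x) \<in> gen_fun P G"
| mult: "\<lbrakk>(U, f) \<in> gen_fun P G; (V, g) \<in> gen_fun P G\<rbrakk> \<Longrightarrow> (U \<inter> V, \<lambda>x. f x * g x) \<in> gen_fun P G"

definition generated :: "'p set \<Rightarrow> ('p set \<times> ('p \<Rightarrow> 'k::field)) set \<Rightarrow> ('p, 'k) fspace" where
  "generated P G =
    \<lparr> zariski = topology_generated_by {{x \<in> U. f x \<noteq> 0} | U f. (U, f) \<in> gen_fun P G},
      regular_on = (\<lambda>W. {f. \<forall>x\<in>W. \<exists>U g h. (U, g) \<in> gen_fun P G \<and> (U, h) \<in> gen_fun P G \<and>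
         x \<in> U \<and> h x \<noteq> 0 \<and> (\<forall>y\<in>U \<inter> W. h y \<noteq> 0 \<longrightarrow> f y = g y / h y)}) \<rparr>"

text \<open>
  A subset of affine \<open>m\<close>-space, whose points are the extensional functions on \<open>{..<m}\<close>, with
  the structure given by the coordinate functions.
\<close>

definition affine_points :: "nat \<Rightarrow> (nat \<Rightarrow> 'k) set" where
  "affine_points m = {..<m} \<rightarrow>\<^sub>E UNIV"

definition affine_sub :: "nat \<Rightarrow> (nat \<Rightarrow> 'k::field) set \<Rightarrow> (nat \<Rightarrow> 'k, 'k) fspace" where
  "affine_sub m Z = generated Z {(Z, \<lambda>x. x i) | i. i < m}"

definition prod_fspace ::
    "('p, 'k::field) fspace \<Rightarrow> ('q, 'k) fspace \<Rightarrow> ('p \<times> 'q, 'k) fspace" where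
  "prod_fspace X Y = generated (points X \<times> points Y)
     ({(U \<times> points Y, f \<circ> fst) | U f. openin (zariski X) U \<and> f \<in> regular_on X U} \<union>
      {(points X \<times> V, g \<circ> snd) | V g. openin (zariski Y) V \<and> g \<in> regular_on Y V})"

definition power_fspace :: "'i set \<Rightarrow> ('p, 'k::field) fspace \<Rightarrow> ('i \<Rightarrow> 'p, 'k) fspace" where
  "power_fspace I X = generated (I \<rightarrow>\<^sub>E points X)
     {({p \<in> I \<rightarrow>\<^sub>E points X. p i \<in> U}, \<lambda>p. f (p i)) | i U f.
        i \<in> I \<and> openin (zariski X) U \<and> f \<in> regular_on X U}"

definition prevariety :: "('p, 'k::field) fspace \<Rightarrow> bool" where
  "prevariety X \<longleftrightarrow> function_sheaf X \<and>
     (\<exists>\<U>. finite \<U> \<and> \<Union>\<U> = points X \<and>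
        (\<forall>U\<in>\<U>. openin (zariski X) U \<and>
           (\<exists>m Z \<phi>. closedin (zariski (affine_sub m (affine_points m))) Z \<and>
              isomorphism (open_sub X U) (affine_sub m Z) \<phi>)))"

definition separated :: "('p, 'k::field) fspace \<Rightarrow> bool" where
  "separated X \<longleftrightarrow> closedin (zariski (prod_fspace X X)) {(x, x) | x. x \<in> points X}"

text \<open>As usual in the classical language, varieties are reduced; they need not be irreducible.\<close>

definition variety :: "('p, 'k::alg_closed_field) fspace \<Rightarrow> bool" where
  "variety X \<longleftrightarrow> prevariety X \<and> separated X"

subsection \<open>Every variety is isomorphic to one with points of type \<open>nat \<Rightarrow> 'k\<close>\<close>

lemma points_open_sub: "points (open_sub X U) = points X \<inter> U"
  by (simp add: points_def open_sub_def)

lemma function_sheafD: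
  assumes "function_sheaf X" "openin (zariski X) U"
  shows "(\<lambda>_. c) \<in> regular_on X U"
    and "f \<in> regular_on X U \<Longrightarrow> g \<in> regular_on X U \<Longrightarrow> (\<lambda>x. f x + g x) \<in> regular_on X U"
    and "f \<in> regular_on X U \<Longrightarrow> g \<in> regular_on X U \<Longrightarrow> (\<lambda>x. f x * g x) \<in> regular_on X U"
    and "f \<in> regular_on X U \<Longrightarrow> (\<And>x. x \<in> U \<Longrightarrow> g x = f x) \<Longrightarrow> g \<in> regular_on X U"
    and "f \<in> regular_on X U \<Longrightarrow> openin (zariski X) V \<Longrightarrow> V \<subseteq> U \<Longrightarrow> f \<in> regular_on X V"
    and "(\<And>x. x \<in> U \<Longrightarrow> \<exists>V. openin (zariski X) V \<and> x \<in> V \<and> V \<subseteq> U \<and> f \<in> regular_on X V)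
          \<Longrightarrow> f \<in> regular_on X U"
proof -
  note S = assms(1)[unfolded function_sheaf_def, THEN spec, THEN mp, OF assms(2)]
  note S2 = S[THEN conjunct2] note S3 = S2[THEN conjunct2] note S4 = S3[THEN conjunct2]
  show "(\<lambda>_. c) \<in> regular_on X U"
    by (rule S[THEN conjunct1, THEN spec])
  show "f \<in> regular_on X U \<Longrightarrow> g \<in> regular_on X U \<Longrightarrow> (\<lambda>x. f x + g x) \<in> regular_on X U"
    by (rule S2[THEN conjunct1, THEN bspec, THEN bspec, THEN conjunct1])
  show "f \<in> regular_on X U \<Longrightarrow> g \<in> regular_on X U \<Longrightarrow> (\<lambda>x. f x * g x) \<in> regular_on X U"
    by (rule S2[THEN conjunct1, THEN bspec, THEN bspec, THEN conjunct2])
  show "f \<in> regular_on X U \<Longrightarrow> (\<And>x. x \<in> U \<Longrightarrow> g x = f x) \<Longrightarrow> g \<in> regular_on X U"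
    by (rule S3[THEN conjunct1, rule_format])
  show "f \<in> regular_on X U \<Longrightarrow> openin (zariski X) V \<Longrightarrow> V \<subseteq> U \<Longrightarrow> f \<in> regular_on X V"
    by (rule S4[THEN conjunct1, THEN bspec, THEN spec, THEN mp, OF _ conjI])
  show "(\<And>x. x \<in> U \<Longrightarrow> \<exists>V. openin (zariski X) V \<and> x \<in> V \<and> V \<subseteq> U \<and> f \<in> regular_on X V)
      \<Longrightarrow> f \<in> regular_on X U"
    by (rule S4[THEN conjunct2, THEN spec, THEN mp, OF ballI])
qed

lemma function_sheafI:
  assumes "\<And>U c. openin (zariski X) U \<Longrightarrow> (\<lambda>_. c) \<in> regular_on X U"
    and "\<And>U f g. openin (zariski X) U \<Longrightarrow> f \<in> regular_on X U \<Longrightarrow> g \<in> regular_on X U \<Longrightarrow>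
           (\<lambda>x. f x + g x) \<in> regular_on X U"
    and "\<And>U f g. openin (zariski X) U \<Longrightarrow> f \<in> regular_on X U \<Longrightarrow> g \<in> regular_on X U \<Longrightarrow>
           (\<lambda>x. f x * g x) \<in> regular_on X U"
    and "\<And>U f g. openin (zariski X) U \<Longrightarrow> f \<in> regular_on X U \<Longrightarrow> (\<And>x. x \<in> U \<Longrightarrow> g x = f x) \<Longrightarrow>
           g \<in> regular_on X U"
    and "\<And>U V f. openin (zariski X) U \<Longrightarrow> f \<in> regular_on X U \<Longrightarrow> openin (zariski X) V \<Longrightarrow>
           V \<subseteq> U \<Longrightarrow> f \<in> regular_on X V"
    and "\<And>U f. openin (zariski X) U \<Longrightarrow>
           (\<And>x. x \<in> U \<Longrightarrow> \<exists>V. openin (zariski X) V \<and> x \<in> V \<and> V \<subseteq> U \<and> f \<in> regular_on X V) \<Longrightarrow>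
           f \<in> regular_on X U"
  shows "function_sheaf X"
  unfolding function_sheaf_def
proof (intro allI impI conjI ballI, goal_cases)
  case (1 U c) then show ?case by (rule assms(1))
next
  case (2 U f g) then show ?case by (rule assms(2))
next
  case (3 U f g) then show ?case by (rule assms(3))
next
  case (4 U f g)
  from 4(3) have "\<And>x. x \<in> U \<Longrightarrow> g x = f x" by (rule bspec)
  with 4(1,2) show ?case by (rule assms(4))
next
  case (5 U f V)
  from 5(3) have V: "openin (zariski X) V" "V \<subseteq> U" by simp_all
  show ?case by (rule assms(5)[OF 5(1,2) V])
next
  case (6 U f) show ?case by (rule assms(6)[OF 6(1) bspec[OF 6(2)]])
qed

lemma morphism_comp:
  assumes "morphism X Y \<phi>" "morphism Y Z \<psi>"
  shows "morphism X Z (\<psi> \<circ> \<phi>)"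
proof -
  have c: "continuous_map (zariski X) (zariski Y) \<phi>" "continuous_map (zariski Y) (zariski Z) \<psi>"
    using assms by (auto simp: morphism_def)
  have "f \<circ> (\<psi> \<circ> \<phi>) \<in> regular_on X {x \<in> points X. (\<psi> \<circ> \<phi>) x \<in> V}"
    if V: "openin (zariski Z) V" and f: "f \<in> regular_on Z V" for V f
  proof -
    let ?V = "{y \<in> points Y. \<psi> y \<in> V}"
    have "f \<circ> \<psi> \<in> regular_on Y ?V" using assms(2) V f by (auto simp: morphism_def)
    moreover have "openin (zariski Y) ?V"
      using openin_continuous_map_preimage[OF c(2) V] by (simp add: points_def)
    ultimately have "f \<circ> \<psi> \<circ> \<phi> \<in> regular_on X {x \<in> points X. \<phi> x \<in> ?V}"
      using assms(1) unfolding morphism_def by blast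
    moreover have "{x \<in> points X. \<phi> x \<in> ?V} = {x \<in> points X. (\<psi> \<circ> \<phi>) x \<in> V}"
      using c(1) by (auto simp: points_def continuous_map_def)
    ultimately show ?thesis by (simp add: o_assoc)
  qed
  then show ?thesis using continuous_map_compose[OF c] by (auto simp: morphism_def)
qed

lemma isomorphism_comp:
  assumes "isomorphism X Y \<phi>" "isomorphism Y Z \<psi>"
  shows "isomorphism X Z (\<psi> \<circ> \<phi>)"
proof -
  obtain \<phi>' \<psi>' where
    i: "morphism Y X \<phi>'" "\<forall>x\<in>points X. \<phi>' (\<phi> x) = x" "\<forall>y\<in>points Y. \<phi> (\<phi>' y) = y"
    "morphism Z Y \<psi>'" "\<forall>x\<in>points Y. \<psi>' (\<psi> x) = x" "\<forall>y\<in>points Z. \<psi> (\<psi>' y) = y"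
    using assms unfolding isomorphism_def by blast
  have m: "morphism X Y \<phi>" "morphism Y Z \<psi>" using assms by (auto simp: isomorphism_def)
  have "\<forall>x\<in>points X. \<phi> x \<in> points Y" "\<forall>z\<in>points Z. \<psi>' z \<in> points Y"
    using m(1) i(4) by (auto simp: morphism_def points_def continuous_map_def)
  then show ?thesis
    using morphism_comp[OF m] morphism_comp[OF i(4,1)] i unfolding isomorphism_def
    by (intro conjI exI[of _ "\<phi>' \<circ> \<psi>'"]) auto
qed

lemma morphism_open_sub:
  assumes "morphism X Y \<phi>" "function_sheaf X" "openin (zariski X) U" "openin (zariski Y) V"
    and "\<phi> ` U \<subseteq> V"
  shows "morphism (open_sub X U) (open_sub Y V) \<phi>"
proof -
  have c: "continuous_map (zariski X) (zariski Y) \<phi>"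
    and r: "\<And>V f. openin (zariski Y) V \<Longrightarrow> f \<in> regular_on Y V \<Longrightarrow>
        f \<circ> \<phi> \<in> regular_on X {x \<in> points X. \<phi> x \<in> V}"
    using assms(1) by (auto simp: morphism_def)
  have "continuous_map (subtopology (zariski X) U) (subtopology (zariski Y) V) \<phi>"
    using c assms(5) by (auto simp: continuous_map_in_subtopology intro: continuous_map_from_subtopology)
  moreover have "f \<circ> \<phi> \<in> regular_on X {x \<in> points (open_sub X U). \<phi> x \<in> W}"
    if "openin (zariski (open_sub Y V)) W" "f \<in> regular_on Y W" for W f
  proof -
    have W: "openin (zariski Y) W"
      using that(1) assms(4) by (auto simp: open_sub_def openin_open_subtopology)
    let ?A = "{x \<in> points X. \<phi> x \<in> W}"
    have "openin (zariski X) ?A"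
      using openin_continuous_map_preimage[OF c W] by (simp add: points_def)
    moreover from this have "openin (zariski X) (?A \<inter> U)" using assms(3) by (rule openin_Int)
    ultimately have "f \<circ> \<phi> \<in> regular_on X (?A \<inter> U)"
      using function_sheafD(5)[OF assms(2) _ r[OF W that(2)]] by blast
    moreover have "?A \<inter> U = {x \<in> points (open_sub X U). \<phi> x \<in> W}"
      by (auto simp: points_open_sub)
    ultimately show ?thesis by simp
  qed
  ultimately show ?thesis by (simp add: morphism_def open_sub_def)
qed

lemma gen_fun_subset:
  assumes "(U, f) \<in> gen_fun P G" "\<And>U f. (U, f) \<in> G \<Longrightarrow> U \<subseteq> P"
  shows "U \<subseteq> P"
  using assms(1) by (induction rule: gen_fun.induct) (auto dest: assms(2))

lemma topspace_generated:
  assumes "\<And>U f. (U, f) \<in> G \<Longrightarrow> U \<subseteq> P"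
  shows "topspace (zariski (generated P G)) = P"
proof
  show "topspace (zariski (generated P G)) \<subseteq> P"
    using gen_fun_subset[OF _ assms] by (fastforce simp: generated_def topology_generated_by_topspace)
  have "(P, \<lambda>_. 1) \<in> gen_fun P G" by (rule gen_fun.const)
  moreover have "P = {x \<in> P. (\<lambda>_. 1::'b) x \<noteq> 0}" by simp
  ultimately show "P \<subseteq> topspace (zariski (generated P G))"
    unfolding generated_def fspace.simps topology_generated_by_topspace by blast
qed

lemma gen_fun_pullback:
  assumes "(U, f) \<in> gen_fun P G" "m ` Q \<subseteq> P"
    and G: "\<And>U f. (U, f) \<in> G \<Longrightarrow> ({q \<in> Q. m q \<in> U}, f \<circ> m) \<in> gen_fun Q H"
  shows "({q \<in> Q. m q \<in> U}, f \<circ> m) \<in> gen_fun Q H"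
  using assms(1)
proof (induction rule: gen_fun.induct)
  case (base U f)
  then show ?case by (rule G)
next
  case (const c)
  have "{q \<in> Q. m q \<in> P} = Q" using assms(2) by auto
  then show ?case using gen_fun.const[of Q c H] by (simp add: o_def)
next
  case (add U f V g)
  have "{q \<in> Q. m q \<in> U \<inter> V} = {q \<in> Q. m q \<in> U} \<inter> {q \<in> Q. m q \<in> V}" by auto
  then show ?case using gen_fun.add[OF add.IH] by (simp add: o_def)
next
  case (mult U f V g)
  have "{q \<in> Q. m q \<in> U \<inter> V} = {q \<in> Q. m q \<in> U} \<inter> {q \<in> Q. m q \<in> V}" by auto
  then show ?case using gen_fun.mult[OF mult.IH] by (simp add: o_def)
qed

lemma separated_transfer:
  fixes X :: "('p, 'k::field) fspace" and Y :: "('q, 'k) fspace"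
  assumes "separated X" "morphism Y X d" "inj_on d (points Y)"
  shows "separated Y"
proof -
  have c: "continuous_map (zariski Y) (zariski X) d"
    and r: "\<And>V f. openin (zariski X) V \<Longrightarrow> f \<in> regular_on X V \<Longrightarrow>
        f \<circ> d \<in> regular_on Y {x \<in> points Y. d x \<in> V}"
    using assms(2) by (auto simp: morphism_def)
  have d: "\<And>y. y \<in> points Y \<Longrightarrow> d y \<in> points X" using c by (auto simp: points_def continuous_map_def)
  define GX where "GX = ({(U \<times> points X, f \<circ> fst) | U f. openin (zariski X) U \<and> f \<in> regular_on X U} \<union>
      {(points X \<times> V, g \<circ> snd) | V g. openin (zariski X) V \<and> g \<in> regular_on X V})"
  define GY where "GY = ({(U \<times> points Y, f \<circ> fst) | U f. openin (zariski Y) U \<and> f \<in> regular_on Y U} \<union>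
      {(points Y \<times> V, g \<circ> snd) | V g. openin (zariski Y) V \<and> g \<in> regular_on Y V})"
  let ?PX = "points X \<times> points X" and ?PY = "points Y \<times> points Y"
  let ?m = "map_prod d d"
  have X: "prod_fspace X X = generated ?PX GX" by (simp add: prod_fspace_def GX_def)
  have Y: "prod_fspace Y Y = generated ?PY GY" by (simp add: prod_fspace_def GY_def)
  have topX: "topspace (zariski (prod_fspace X X)) = ?PX"
    unfolding X by (rule topspace_generated) (auto simp: GX_def points_def dest: openin_subset)
  have topY: "topspace (zariski (prod_fspace Y Y)) = ?PY"
    unfolding Y by (rule topspace_generated) (auto simp: GY_def points_def dest: openin_subset)
  have base: "({q \<in> ?PY. ?m q \<in> U}, f \<circ> ?m) \<in> gen_fun ?PY GY" if "(U, f) \<in> GX" for U f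
  proof -
    have op: "openin (zariski Y) {x \<in> points Y. d x \<in> V}" if "openin (zariski X) V" for V
      using openin_continuous_map_preimage[OF c that] by (simp add: points_def)
    consider V g where "U = V \<times> points X" "f = g \<circ> fst" "openin (zariski X) V" "g \<in> regular_on X V"
      | V g where "U = points X \<times> V" "f = g \<circ> snd" "openin (zariski X) V" "g \<in> regular_on X V"
      using \<open>(U, f) \<in> GX\<close> unfolding GX_def by blast
    then show ?thesis
    proof cases
      case 1
      have "{q \<in> ?PY. ?m q \<in> U} = {x \<in> points Y. d x \<in> V} \<times> points Y" using 1 d by auto
      moreover have "f \<circ> ?m = (g \<circ> d) \<circ> fst" using 1 by auto
      ultimately show ?thesis
        using op[OF 1(3)] r[OF 1(3,4)] by (intro gen_fun.base) (auto simp: GY_def)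
    next
      case 2
      have "{q \<in> ?PY. ?m q \<in> U} = points Y \<times> {x \<in> points Y. d x \<in> V}" using 2 d by auto
      moreover have "f \<circ> ?m = (g \<circ> d) \<circ> snd" using 2 by auto
      ultimately show ?thesis
        using op[OF 2(3)] r[OF 2(3,4)] by (intro gen_fun.base) (auto simp: GY_def)
    qed
  qed
  have "continuous_map (zariski (prod_fspace Y Y)) (zariski (prod_fspace X X)) ?m"
    unfolding X generated_def fspace.simps
  proof (rule continuous_on_generated_topo)
    fix W assume "W \<in> {{x \<in> U. f x \<noteq> 0} | U f. (U, f) \<in> gen_fun ?PX GX}"
    then obtain U f where W: "W = {x \<in> U. f x \<noteq> 0}" and Uf: "(U, f) \<in> gen_fun ?PX GX" by blast
    have "({q \<in> ?PY. ?m q \<in> U}, f \<circ> ?m) \<in> gen_fun ?PY GY"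
      by (rule gen_fun_pullback[OF Uf _ base]) (use d in auto)
    then have "{x \<in> {q \<in> ?PY. ?m q \<in> U}. (f \<circ> ?m) x \<noteq> 0} \<in>
        {{x \<in> U. f x \<noteq> 0} | U f. (U, f) \<in> gen_fun ?PY GY}" by blast
    then have "openin (zariski (prod_fspace Y Y)) {x \<in> {q \<in> ?PY. ?m q \<in> U}. (f \<circ> ?m) x \<noteq> 0}"
      unfolding Y generated_def fspace.simps by (rule topology_generated_by_Basis)
    moreover have "{x \<in> {q \<in> ?PY. ?m q \<in> U}. (f \<circ> ?m) x \<noteq> 0} =
        ?m -` W \<inter> topspace (zariski (prod_fspace Y Y))"
      unfolding topY W by auto
    ultimately show "openin (zariski (prod_fspace Y Y))
        (?m -` W \<inter> topspace (zariski (prod_fspace Y Y)))" by simp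
  next
    have "\<Union>{{x \<in> U. f x \<noteq> 0} | U f. (U, f) \<in> gen_fun ?PX GX} = ?PX"
      using topX unfolding X generated_def fspace.simps topology_generated_by_topspace .
    then show "?m ` topspace (zariski (prod_fspace Y Y)) \<subseteq>
        \<Union>{{x \<in> U. f x \<noteq> 0} | U f. (U, f) \<in> gen_fun ?PX GX}"
      unfolding topY using d by auto
  qed
  from closedin_continuous_map_preimage[OF this assms(1)[unfolded separated_def]]
  have "closedin (zariski (prod_fspace Y Y)) {y \<in> ?PY. ?m y \<in> {(x, x) | x. x \<in> points X}}"
    by (simp add: topY)
  moreover have "{y \<in> ?PY. ?m y \<in> {(x, x) | x. x \<in> points X}} = {(y, y) | y. y \<in> points Y}"
    using assms(3) d by (auto simp: inj_on_def)
  ultimately show ?thesis unfolding separated_def by simp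
qed

lemma variety_charts:
  assumes "variety X"
  shows "\<exists>\<U>. finite \<U> \<and> \<Union>\<U> = points X \<and>
    (\<forall>U\<in>\<U>. openin (zariski X) U \<and> (\<exists>m Z \<phi>.
        closedin (zariski (affine_sub m (affine_points m))) Z \<and>
              isomorphism (open_sub X U) (affine_sub m Z) \<phi>))"
  using assms unfolding variety_def prevariety_def by (elim conjE)

lemma variety_isomorphic:
  assumes "variety X" "isomorphism X Y e" "function_sheaf Y"
  shows "variety Y"
proof -
  obtain d where e: "morphism X Y e" and d: "morphism Y X d" "\<forall>x\<in>points X. d (e x) = x"
      "\<forall>y\<in>points Y. e (d y) = y"
    using assms(2) unfolding isomorphism_def by blast
  have c: "continuous_map (zariski X) (zariski Y) e" "continuous_map (zariski Y) (zariski X) d"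
    using e d(1) by (auto simp: morphism_def)
  have pts: "\<And>x. x \<in> points X \<Longrightarrow> e x \<in> points Y" "\<And>y. y \<in> points Y \<Longrightarrow> d y \<in> points X"
    using c by (auto simp: points_def continuous_map_def)
  have fX: "function_sheaf X" using assms(1) by (simp add: variety_def prevariety_def)
  have "inj_on d (points Y)" using d(3) by (metis inj_onI)
  then have "separated Y"
    using separated_transfer[OF _ d(1)] assms(1) by (simp add: variety_def)
  moreover obtain \<U> where \<U>0: "finite \<U> \<and> \<Union>\<U> = points X \<and>
    (\<forall>U\<in>\<U>. openin (zariski X) U \<and> (\<exists>m Z \<phi>.
        closedin (zariski (affine_sub m (affine_points m))) Z \<and>
              isomorphism (open_sub X U) (affine_sub m Z) \<phi>))"
    using variety_charts[OF assms(1)] ..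
  note \<U> = \<U>0[THEN conjunct1] \<U>0[THEN conjunct2, THEN conjunct1]
    \<U>0[THEN conjunct2, THEN conjunct2, rule_format]
  define t where "t U = {y \<in> points Y. d y \<in> U}" for U
  have "finite (t ` \<U>)" using \<U>(1) by simp
  moreover have "\<Union>(t ` \<U>) = points Y" using \<U>(2) pts by (auto simp: t_def)
  moreover have "openin (zariski Y) W \<and> (\<exists>m Z \<phi>.
        closedin (zariski (affine_sub m (affine_points m))) Z \<and>
              isomorphism (open_sub Y W) (affine_sub m Z) \<phi>)" if W: "W \<in> t ` \<U>" for W
  proof -
    obtain U where U: "U \<in> \<U>" "W = t U" using W by blast
    obtain m Z \<phi> where o: "openin (zariski X) U"
      and Z: "closedin (zariski (affine_sub m (affine_points m))) Z"
      and \<phi>: "isomorphism (open_sub X U) (affine_sub m Z) \<phi>" using \<U>(3)[OF U(1)] by blast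
    have oW: "openin (zariski Y) W"
      unfolding U t_def points_def by (rule openin_continuous_map_preimage[OF c(2) o])
    have sub: "U \<subseteq> points X" using o by (simp add: points_def openin_subset)
    have "morphism (open_sub Y W) (open_sub X U) d"
      by (rule morphism_open_sub[OF d(1) assms(3) oW o]) (auto simp: U t_def)
    moreover have "morphism (open_sub X U) (open_sub Y W) e"
      by (rule morphism_open_sub[OF e fX o oW]) (use sub pts(1) d(2) in \<open>auto simp: U t_def subset_iff\<close>)
    ultimately have "isomorphism (open_sub Y W) (open_sub X U) d"
      unfolding isomorphism_def points_open_sub using d(2,3) by blast
    from isomorphism_comp[OF this \<phi>] show ?thesis using oW Z by blast
  qed
  ultimately show ?thesis
    unfolding variety_def prevariety_def by (intro conjI exI[of _ "t ` \<U>"] ballI assms(3)) blast+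
qed

lemma transport_of_structure:
  fixes X :: "('p, 'k::field) fspace" and e :: "'p \<Rightarrow> 'q"
  assumes X: "function_sheaf X" and inj: "inj_on e (points X)"
  obtains Y :: "('q, 'k) fspace" where "isomorphism X Y e" "function_sheaf Y"
proof -
  define d where "d = inv_into (points X) e"
  define pre where "pre V = {x \<in> points X. e x \<in> V}" for V
  define Y :: "('q, 'k) fspace" where
    "Y = \<lparr> zariski = pullback_topology (e ` points X) d (zariski X),
           regular_on = (\<lambda>V. {f. f \<circ> e \<in> regular_on X (pre V)}) \<rparr>"
  have de: "\<And>x. x \<in> points X \<Longrightarrow> d (e x) = x" using inj by (simp add: d_def)
  have pY: "points Y = e ` points X"
    using de by (auto simp: Y_def points_def topspace_pullback_topology)
  have oY: "openin (zariski Y) V \<longleftrightarrow> V \<subseteq> e ` points X \<and> openin (zariski X) (pre V)" for V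
  proof
    assume "openin (zariski Y) V"
    then obtain U where U: "openin (zariski X) U" "V = d -` U \<inter> e ` points X"
      by (auto simp: Y_def openin_pullback_topology)
    have "x \<in> pre V \<longleftrightarrow> x \<in> U" for x
      using openin_subset[OF U(1)] de[of x] by (auto simp: pre_def points_def U(2))
    then have "pre V = U" by blast
    then show "V \<subseteq> e ` points X \<and> openin (zariski X) (pre V)" using U by auto
  next
    assume V: "V \<subseteq> e ` points X \<and> openin (zariski X) (pre V)"
    then have "V = d -` pre V \<inter> e ` points X" using de by (auto simp: pre_def)
    then show "openin (zariski Y) V" using V by (auto simp: Y_def openin_pullback_topology)
  qed
  have rY: "f \<in> regular_on Y V \<longleftrightarrow> f \<circ> e \<in> regular_on X (pre V)" for f V by (simp add: Y_def)
  have "continuous_map (zariski X) (zariski Y) e"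
    unfolding continuous_map_def
    using oY pY by (auto simp: points_def pre_def)
  then have e: "morphism X Y e" by (auto simp: morphism_def rY pre_def)
  have dV: "{y \<in> points Y. d y \<in> U} = e ` U" "pre (e ` U) = U" if "openin (zariski X) U" for U
  proof -
    have U: "U \<subseteq> points X" using openin_subset[OF that] by (simp add: points_def)
    show "{y \<in> points Y. d y \<in> U} = e ` U" using U de unfolding pY by (auto simp: subset_iff)
    have "x \<in> U" if "x \<in> points X" "z \<in> U" "e x = e z" for x z
      using inj_onD[OF inj that(3,1)] that(2) U by blast
    then show "pre (e ` U) = U" using U by (auto simp: pre_def)
  qed
  have "morphism Y X d"
    unfolding morphism_def
  proof (intro conjI allI impI ballI)
    show "continuous_map (zariski Y) (zariski X) d"
      unfolding continuous_map_def
    proof (intro conjI allI impI)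
      show "d \<in> topspace (zariski Y) \<rightarrow> topspace (zariski X)"
        using pY de by (auto simp: points_def)
      fix U assume U: "openin (zariski X) U"
      have "{y \<in> topspace (zariski Y). d y \<in> U} = e ` U" using dV(1)[OF U] by (simp add: points_def)
      then show "openin (zariski Y) {y \<in> topspace (zariski Y). d y \<in> U}"
        using U dV(2)[OF U] openin_subset[OF U] by (auto simp: oY points_def)
    qed
  next
    fix V f assume V: "openin (zariski X) V" and f: "f \<in> regular_on X V"
    have "f \<circ> d \<circ> e \<in> regular_on X V"
      by (rule function_sheafD(4)[OF X V f]) (use openin_subset[OF V] de in \<open>auto simp: points_def\<close>)
    then show "f \<circ> d \<in> regular_on Y {x \<in> points Y. d x \<in> V}"
      by (simp add: rY dV[OF V])
  qed
  then have "isomorphism X Y e"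
    using e de pY unfolding isomorphism_def by (intro conjI exI[of _ d]) auto
  moreover have "function_sheaf Y"
  proof (rule function_sheafI)
    fix U c assume "openin (zariski Y) U"
    then show "(\<lambda>_. c) \<in> regular_on Y U"
      using function_sheafD(1)[OF X, of "pre U" c] oY by (simp add: rY o_def)
  next
    fix U f g assume "openin (zariski Y) U" "f \<in> regular_on Y U" "g \<in> regular_on Y U"
    then show "(\<lambda>x. f x + g x) \<in> regular_on Y U" "(\<lambda>x. f x * g x) \<in> regular_on Y U"
      using function_sheafD(2,3)[OF X, of "pre U" "f \<circ> e" "g \<circ> e"] oY by (simp_all add: rY o_def)
  next
    fix U f g assume "openin (zariski Y) U" "f \<in> regular_on Y U" "\<And>x. x \<in> U \<Longrightarrow> g x = f x"
    then show "g \<in> regular_on Y U"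
      using function_sheafD(4)[OF X, of "pre U" "f \<circ> e" "g \<circ> e"] oY by (simp add: rY pre_def)
  next
    fix U V f assume "openin (zariski Y) U" "f \<in> regular_on Y U" "openin (zariski Y) V" "V \<subseteq> U"
    moreover from this have "pre V \<subseteq> pre U" by (auto simp: pre_def)
    ultimately show "f \<in> regular_on Y V"
      using function_sheafD(5)[OF X, of "pre U" "f \<circ> e" "pre V"] oY by (simp add: rY)
  next
    fix U f assume U: "openin (zariski Y) U"
      and f: "\<And>x. x \<in> U \<Longrightarrow> \<exists>V. openin (zariski Y) V \<and> x \<in> V \<and> V \<subseteq> U \<and> f \<in> regular_on Y V"
    have o: "openin (zariski X) (pre U)" using U oY by blast
    have "f \<circ> e \<in> regular_on X (pre U)"
    proof (rule function_sheafD(6)[OF X o])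
      fix x assume x: "x \<in> pre U"
      then obtain V where V: "openin (zariski Y) V" "e x \<in> V" "V \<subseteq> U" "f \<in> regular_on Y V"
        using f[of "e x"] unfolding pre_def by blast
      have "openin (zariski X) (pre V)" "f \<circ> e \<in> regular_on X (pre V)" using V(1,4) oY rY by simp_all
      moreover have "x \<in> pre V" "pre V \<subseteq> pre U" using V(2,3) x by (auto simp: pre_def)
      ultimately show "\<exists>V. openin (zariski X) V \<and> x \<in> V \<and> V \<subseteq> pre U \<and> f \<circ> e \<in> regular_on X V"
        by blast
    qed
    then show "f \<in> regular_on Y U" by (simp add: rY)
  qed
  ultimately show thesis by (rule that)
qed

lemma variety_iso_standard:
  fixes X :: "('p, 'k::alg_closed_field) fspace"
  assumes "variety X"
  obtains Y :: "(nat \<Rightarrow> 'k, 'k) fspace" and e where "variety Y" "isomorphism X Y e"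
proof -
  obtain \<U> where \<U>0: "finite \<U> \<and> \<Union>\<U> = points X \<and>
    (\<forall>U\<in>\<U>. openin (zariski X) U \<and> (\<exists>m Z \<phi>.
        closedin (zariski (affine_sub m (affine_points m))) Z \<and>
              isomorphism (open_sub X U) (affine_sub m Z) \<phi>))"
    using variety_charts[OF assms] ..
  note \<U> = \<U>0[THEN conjunct1] \<U>0[THEN conjunct2, THEN conjunct1]
    \<U>0[THEN conjunct2, THEN conjunct2, rule_format]
  have "\<exists>\<phi> :: 'p \<Rightarrow> nat \<Rightarrow> 'k. inj_on \<phi> U" if U: "U \<in> \<U>" for U
  proof -
    obtain m Z \<phi> where "isomorphism (open_sub X U) (affine_sub m Z) \<phi>" using \<U>(3)[OF U] by blast
    then obtain \<psi> where "\<forall>x\<in>points (open_sub X U). \<psi> (\<phi> x) = x"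
      unfolding isomorphism_def by blast
    moreover have "points (open_sub X U) = U" using \<U>(2) U by (auto simp: points_open_sub)
    ultimately have "inj_on \<phi> U" by (metis inj_onI)
    then show ?thesis by blast
  qed
  then have "\<forall>U\<in>\<U>. \<exists>\<phi> :: 'p \<Rightarrow> nat \<Rightarrow> 'k. inj_on \<phi> U" by blast
  from bchoice[OF this] obtain \<phi> :: "'p set \<Rightarrow> 'p \<Rightarrow> nat \<Rightarrow> 'k"
    where \<phi>: "\<And>U. U \<in> \<U> \<Longrightarrow> inj_on (\<phi> U) U" by blast
  obtain N :: "'p set \<Rightarrow> nat" where N: "inj_on N \<U>"
    using finite_imp_inj_to_nat_seg[OF \<U>(1)] by blast
  define ch where "ch x = (SOME U. U \<in> \<U> \<and> x \<in> U)" for x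
  have ch: "ch x \<in> \<U>" "x \<in> ch x" if "x \<in> points X" for x
    using someI_ex[of "\<lambda>U. U \<in> \<U> \<and> x \<in> U"] that \<U>(2) by (auto simp: ch_def)
  define e :: "'p \<Rightarrow> nat \<Rightarrow> 'k" where
    "e x j = (if j < N (ch x) then 1 else if j = N (ch x) then 0
              else \<phi> (ch x) x (j - Suc (N (ch x))))" for x j
  have inj: "inj_on e (points X)"
  proof (rule inj_onI)
    fix x y assume x: "x \<in> points X" and y: "y \<in> points X" and eq: "e x = e y"
    have e1: "e z j = 1" if "j < N (ch z)" for z j using that by (simp add: e_def)
    have e0: "e z (N (ch z)) = 0" for z by (simp add: e_def)
    have "\<not> N (ch x) < N (ch y)" "\<not> N (ch y) < N (ch x)"
      using e1[of "N (ch x)" y] e1[of "N (ch y)" x] e0[of x] e0[of y] unfolding eq by auto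
    then have n: "N (ch x) = N (ch y)" by simp
    have c: "ch x = ch y" by (rule inj_onD[OF N n ch(1)[OF x] ch(1)[OF y]])
    have "\<phi> (ch x) x j = \<phi> (ch y) y j" for j
      using fun_cong[OF eq, of "j + Suc (N (ch x))"] n by (simp add: e_def)
    then have "\<phi> (ch x) x = \<phi> (ch x) y" using c by auto
    moreover have "y \<in> ch x" using ch(2)[OF y] c by simp
    ultimately show "x = y" using inj_onD[OF \<phi>[OF ch(1)[OF x]] _ ch(2)[OF x]] by blast
  qed
  have "function_sheaf X" using assms by (simp add: variety_def prevariety_def)
  then obtain Y :: "(nat \<Rightarrow> 'k, 'k) fspace" where Y: "isomorphism X Y e" "function_sheaf Y"
    by (rule transport_of_structure[OF _ inj])
  show thesis by (rule that[OF variety_isomorphic[OF assms Y] Y(1)])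
qed

section \<open>Quotients\<close>

definition invariant :: "'g set \<Rightarrow> ('g \<Rightarrow> 'p \<Rightarrow> 'p) \<Rightarrow> ('p, 'k) fspace \<Rightarrow> ('p \<Rightarrow> 'q) \<Rightarrow> bool" where
  "invariant G act V f \<longleftrightarrow> (\<forall>g\<in>G. \<forall>x\<in>points V. f (act g x) = f x)"

text \<open>
  The varieties tested in the universal property have points of type \<open>nat \<Rightarrow> 'k\<close>. Every variety is
  isomorphic to one of these, so this is no restriction: see \<open>variety_iso_standard\<close> and
  \<open>categorical_quotient_universal\<close>.
\<close>

definition categorical_quotient ::
    "'g set \<Rightarrow> ('g \<Rightarrow> 'p \<Rightarrow> 'p) \<Rightarrow> ('p, 'k::alg_closed_field) fspace \<Rightarrow>
     ('q, 'k) fspace \<Rightarrow> ('p \<Rightarrow> 'q) \<Rightarrow> bool" where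
  "categorical_quotient G act V V' \<pi> \<longleftrightarrow>
     variety V' \<and> morphism V V' \<pi> \<and> invariant G act V \<pi> \<and>
     (\<forall>(W :: (nat \<Rightarrow> 'k, 'k) fspace) f. variety W \<and> morphism V W f \<and> invariant G act V f \<longrightarrow>
        (\<exists>h. morphism V' W h \<and> (\<forall>x\<in>points V. h (\<pi> x) = f x) \<and>
           (\<forall>h'. morphism V' W h' \<and> (\<forall>x\<in>points V. h' (\<pi> x) = f x) \<longrightarrow>
              (\<forall>y\<in>points V'. h' y = h y))))"

lemma categorical_quotient_universal:
  fixes W :: "('w, 'k::alg_closed_field) fspace"
  assumes "categorical_quotient G act V V' \<pi>" "variety W" "morphism V W f" "invariant G act V f"
  shows "\<exists>h. morphism V' W h \<and> (\<forall>x\<in>points V. h (\<pi> x) = f x) \<and>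
           (\<forall>h'. morphism V' W h' \<and> (\<forall>x\<in>points V. h' (\<pi> x) = f x) \<longrightarrow>
              (\<forall>y\<in>points V'. h' y = h y))"
proof -
  obtain S :: "(nat \<Rightarrow> 'k, 'k) fspace" and e where S: "variety S" "isomorphism W S e"
    by (rule variety_iso_standard[OF assms(2)])
  obtain d where e: "morphism W S e" and d: "morphism S W d" "\<forall>x\<in>points W. d (e x) = x"
    using S(2) unfolding isomorphism_def by blast
  have fW: "\<And>x. x \<in> points V \<Longrightarrow> f x \<in> points W"
    using assms(3) by (auto simp: morphism_def points_def continuous_map_def)
  have ef: "morphism V S (e \<circ> f)" by (rule morphism_comp[OF assms(3) e])
  have inv: "invariant G act V (e \<circ> f)" using assms(4) by (simp add: invariant_def)
  note U = assms(1)[unfolded categorical_quotient_def, THEN conjunct2, THEN conjunct2,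
      THEN conjunct2, THEN spec, THEN spec, THEN mp, OF conjI[OF S(1) conjI[OF ef inv]]]
  from U obtain h where h0: "morphism V' S h \<and> (\<forall>x\<in>points V. h (\<pi> x) = (e \<circ> f) x) \<and>
      (\<forall>h'. morphism V' S h' \<and> (\<forall>x\<in>points V. h' (\<pi> x) = (e \<circ> f) x) \<longrightarrow>
         (\<forall>y\<in>points V'. h' y = h y))" ..
  note h = h0[THEN conjunct1] h0[THEN conjunct2, THEN conjunct1]
    h0[THEN conjunct2, THEN conjunct2, THEN spec, THEN mp]
  have "h' y = (d \<circ> h) y"
    if h': "morphism V' W h'" "\<forall>x\<in>points V. h' (\<pi> x) = f x" and y: "y \<in> points V'" for h' y
  proof -
    have "(e \<circ> h') y = h y"
      by (rule bspec[OF h(3)[OF conjI[OF morphism_comp[OF h'(1) e]]] y]) (simp add: h'(2))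
    moreover have "h' y \<in> points W"
      using h'(1) y by (auto simp: morphism_def points_def continuous_map_def)
    ultimately show ?thesis using d(2) by (metis comp_apply)
  qed
  moreover have "\<forall>x\<in>points V. (d \<circ> h) (\<pi> x) = f x" using h(2) d(2) fW by simp
  ultimately show ?thesis using morphism_comp[OF h(1) d(1)] by blast
qed

definition geometric_quotient ::
    "'g set \<Rightarrow> ('g \<Rightarrow> 'p \<Rightarrow> 'p) \<Rightarrow> ('p, 'k::alg_closed_field) fspace \<Rightarrow>
     ('q, 'k) fspace \<Rightarrow> ('p \<Rightarrow> 'q) \<Rightarrow> bool" where
  "geometric_quotient G act V V' \<pi> \<longleftrightarrow> categorical_quotient G act V V' \<pi> \<and>
     (\<forall>x\<in>points V. \<forall>y\<in>points V. \<pi> x = \<pi> y \<longrightarrow> (\<exists>g\<in>G. y = act g x))"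

section \<open>Projective spaces\<close>

text \<open>
  The projective space of a finite-dimensional space of vectors or matrices with
  coordinates \<open>co i\<close>. A point is the set of nonzero vectors of a line through the origin. The
  structure is given by the functions \<open>x\<^sub>i / x\<^sub>j\<close> on the open sets \<open>x\<^sub>j \<noteq> 0\<close>.
\<close>

definition proj_class :: "('i \<Rightarrow> 'v \<Rightarrow> 'k::field) \<Rightarrow> 'v \<Rightarrow> 'v set" where
  "proj_class co x = {y. \<exists>c. c \<noteq> 0 \<and> (\<forall>i. co i y = c * co i x)}"

definition proj_points :: "('i \<Rightarrow> 'v \<Rightarrow> 'k::field) \<Rightarrow> 'v set set" where
  "proj_points co = {proj_class co x | x. \<exists>i. co i x \<noteq> 0}"

definition coord_ratio :: "('i \<Rightarrow> 'v \<Rightarrow> 'k::field) \<Rightarrow> 'i \<Rightarrow> 'i \<Rightarrow> 'v set \<Rightarrow> 'k" where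
  "coord_ratio co i j p = (let x = (SOME x. x \<in> p) in co i x / co j x)"

definition proj_fspace :: "('i \<Rightarrow> 'v \<Rightarrow> 'k::field) \<Rightarrow> ('v set, 'k) fspace" where
  "proj_fspace co = generated (proj_points co)
     {({p \<in> proj_points co. \<forall>x\<in>p. co j x \<noteq> 0}, coord_ratio co i j) | i j. True}"

definition vec_coord :: "'n \<Rightarrow> 'k^'n \<Rightarrow> 'k" where
  "vec_coord i x = x $ i"

definition mat_coord :: "'m \<times> 'n \<Rightarrow> 'k^'n^'m \<Rightarrow> 'k" where
  "mat_coord ij A = A $ fst ij $ snd ij"

type_synonym 'k plane_point = "('k^3) set"
type_synonym 'k pgl3 = "('k^3^3) set"

abbreviation P2 :: "('k::field) plane_point set" where
  "P2 \<equiv> proj_points vec_coord"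

definition PGL3 :: "('k::field) pgl3 set" where
  "PGL3 = {proj_class mat_coord A | A. invertible A}"

definition pgl_mult :: "('k::field) pgl3 \<Rightarrow> 'k pgl3 \<Rightarrow> 'k pgl3" where
  "pgl_mult M N = {A ** B | A B. A \<in> M \<and> B \<in> N}"

definition pgl_inv :: "('k::field) pgl3 \<Rightarrow> 'k pgl3" where
  "pgl_inv M = matrix_inv ` M"

definition pgl_apply :: "('k::field) pgl3 \<Rightarrow> 'k plane_point \<Rightarrow> 'k plane_point" where
  "pgl_apply M p = {A *v x | A x. A \<in> M \<and> x \<in> p}"

section \<open>Lines and cross-ratios\<close>

definition plane_line :: "('k::field)^3 \<Rightarrow> 'k plane_point set" where
  "plane_line a = {p \<in> P2. \<forall>x\<in>p. (\<Sum>i\<in>UNIV. a $ i * x $ i) = 0}"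

definition plane_lines :: "('k::field) plane_point set set" where
  "plane_lines = {plane_line a | a. a \<noteq> 0}"

definition collinear_points :: "('k::field) plane_point set \<Rightarrow> bool" where
  "collinear_points S \<longleftrightarrow> (\<exists>L\<in>plane_lines. S \<subseteq> L)"

definition line_through :: "('k::field) plane_point \<Rightarrow> 'k plane_point \<Rightarrow> 'k plane_point set" where
  "line_through p q = (THE L. L \<in> plane_lines \<and> p \<in> L \<and> q \<in> L)"

definition meet_point :: "('k::field) plane_point set \<Rightarrow> 'k plane_point set \<Rightarrow> 'k plane_point" where
  "meet_point L L' = (THE p. p \<in> L \<and> p \<in> L')"

text \<open>
  Two distinct points \<open>[e]\<close> and \<open>[f]\<close> of a line determine on it the affine coordinate
  \<open>[t e + f] \<mapsto> t\<close>, which is infinite at \<open>[e]\<close>, and all affine coordinates arise in this way.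
\<close>

definition cross_ratio ::
    "('k::field) plane_point \<Rightarrow> 'k plane_point \<Rightarrow> 'k plane_point \<Rightarrow> 'k plane_point \<Rightarrow> 'k" where
  "cross_ratio p1 p2 p3 p4 = (THE c. \<exists>e f t1 t2 t3 t4.
     e \<noteq> 0 \<and> f \<noteq> 0 \<and> proj_class vec_coord e \<noteq> proj_class vec_coord f \<and>
     t1 \<noteq> 0 \<and> t2 \<noteq> 0 \<and> t3 \<noteq> 0 \<and> t4 \<noteq> 0 \<and>
     p1 = proj_class vec_coord (t1 *s e + f) \<and> p2 = proj_class vec_coord (t2 *s e + f) \<and>
     p3 = proj_class vec_coord (t3 *s e + f) \<and> p4 = proj_class vec_coord (t4 *s e + f) \<and>
     c = ((t1 - t2) * (t3 - t4)) / ((t1 - t3) * (t2 - t4)))"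

section \<open>Twisted polygons\<close>

definition is_monodromy :: "nat \<Rightarrow> (int \<Rightarrow> ('k::field) plane_point) \<Rightarrow> 'k pgl3 \<Rightarrow> bool" where
  "is_monodromy n v M \<longleftrightarrow> M \<in> PGL3 \<and> (\<forall>i. pgl_apply M (v i) = v (i + int n))"

definition twisted_polygon :: "nat \<Rightarrow> (int \<Rightarrow> ('k::field) plane_point) \<Rightarrow> bool" where
  "twisted_polygon n v \<longleftrightarrow> (\<forall>i. v i \<in> P2) \<and> (\<exists>M. is_monodromy n v M) \<and>
     (\<forall>i a b c. i \<le> a \<and> a < b \<and> b < c \<and> c \<le> i + 4 \<and> (a, b, c) \<noteq> (i, i + 2, i + 4) \<longrightarrow>
        \<not> collinear_points {v a, v b, v c})"

definition monodromy :: "nat \<Rightarrow> (int \<Rightarrow> ('k::field) plane_point) \<Rightarrow> 'k pgl3" where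
  "monodromy n v = (THE M. is_monodromy n v M)"

definition polygon_point ::
    "nat \<Rightarrow> (int \<Rightarrow> ('k::field) plane_point) \<Rightarrow> (nat \<Rightarrow> 'k plane_point) \<times> 'k pgl3" where
  "polygon_point n v = (\<lambda>i\<in>{1..n}. v (int i), monodromy n v)"

text \<open>\<open>PGL3\<close> carries the structure of an open subset of the projective space of matrices.\<close>

definition polygon_variety ::
    "nat \<Rightarrow> ((nat \<Rightarrow> ('k::field) plane_point) \<times> 'k pgl3, 'k) fspace" where
  "polygon_variety n =
     open_sub (prod_fspace (power_fspace {1..n} (proj_fspace vec_coord))
                           (open_sub (proj_fspace mat_coord) PGL3))
       (polygon_point n ` {v. twisted_polygon n v})"

definition pgl_action ::
    "nat \<Rightarrow> ('k::field) pgl3 \<Rightarrow> (nat \<Rightarrow> 'k plane_point) \<times> 'k pgl3 \<Rightarrow>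
     (nat \<Rightarrow> 'k plane_point) \<times> 'k pgl3" where
  "pgl_action n A vM =
     (\<lambda>i\<in>{1..n}. pgl_apply A (fst vM i), pgl_mult (pgl_mult A (snd vM)) (pgl_inv A))"

definition left_corner :: "(int \<Rightarrow> ('k::field) plane_point) \<Rightarrow> int \<Rightarrow> 'k" where
  "left_corner v i =
     cross_ratio (v (i - 2)) (v (i - 1))
       (meet_point (line_through (v i) (v (i + 1))) (line_through (v (i - 2)) (v (i - 1))))
       (meet_point (line_through (v (i + 1)) (v (i + 2))) (line_through (v (i - 2)) (v (i - 1))))"

definition right_corner :: "(int \<Rightarrow> ('k::field) plane_point) \<Rightarrow> int \<Rightarrow> 'k" where
  "right_corner v i =
     cross_ratio
       (meet_point (line_through (v (i + 1)) (v (i + 2))) (line_through (v (i - 2)) (v (i - 1))))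
       (meet_point (line_through (v (i - 1)) (v i)) (line_through (v (i + 1)) (v (i + 2))))
       (v (i + 1)) (v (i + 2))"

definition P1_point :: "'k \<Rightarrow> 'k \<Rightarrow> (('k::field)^2) set" where
  "P1_point a b = proj_class vec_coord (vector [a, b])"

text \<open>
  \<open>(P\<^sup>1 - {0, 1, \<infinity>})\<^sup>2\<^sup>n\<close>, with \<open>c\<close> in the field identified with \<open>[c : 1]\<close> and \<open>\<infinity>\<close> with
  \<open>[1 : 0]\<close>. The first \<open>n\<close> of the indices \<open>1, \<dots>, 2n\<close> belong to the left corner invariants.
\<close>

definition corner_space :: "nat \<Rightarrow> (nat \<Rightarrow> (('k::field)^2) set, 'k) fspace" where
  "corner_space n = power_fspace {1..2 * n}
     (open_sub (proj_fspace vec_coord)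
        (proj_points vec_coord - {P1_point 0 1, P1_point 1 1, P1_point 1 0}))"

definition corner_invariants ::
    "nat \<Rightarrow> (int \<Rightarrow> ('k::field) plane_point) \<Rightarrow> nat \<Rightarrow> ('k^2) set" where
  "corner_invariants n v = (\<lambda>j\<in>{1..2 * n}.
     P1_point (if j \<le> n then left_corner v (int j) else right_corner v (int (j - n))) 1)"

end

theory Submission
  imports Defs
begin

text \<open>
  Lift the vertices \<open>v\<^sub>i\<close> of a twisted polygon to vectors \<open>V\<^sub>i\<close>. The lifts can be rescaled, uniquely
  up to a common factor, so that \<open>V\<^sub>i\<^sub>+\<^sub>3 - V\<^sub>i\<^sub>+\<^sub>2\<close> lies in the span of \<open>V\<^sub>i\<close> and \<open>V\<^sub>i\<^sub>+\<^sub>1\<close>, and then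
  \<open>V\<^sub>i\<^sub>+\<^sub>3 = V\<^sub>i\<^sub>+\<^sub>2 - y\<^sub>i\<^sub>+\<^sub>1 V\<^sub>i\<^sub>+\<^sub>1 + x\<^sub>i\<^sub>+\<^sub>1 y\<^sub>i\<^sub>+\<^sub>1 y\<^sub>i V\<^sub>i\<close>. Conversely, for periodic sequences \<open>x\<close> and \<open>y\<close> avoiding \<open>0\<close>
  and \<open>1\<close>, solving this recurrence from a basis \<open>V\<^sub>1, V\<^sub>2, V\<^sub>3\<close> gives a twisted polygon with corner
  invariants \<open>x\<close> and \<open>y\<close>, and two solutions differ by a linear map. Hence the fibres of the corner
  invariants are exactly the orbits, and taking the standard basis for \<open>V\<^sub>1, V\<^sub>2, V\<^sub>3\<close> yields a
  section \<open>s\<close> with polynomial coordinates. The universal property is then immediate: an invariant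
  morphism \<open>f\<close> factors through \<open>f \<circ> s\<close>.
\<close>

section \<open>Spaces with functions\<close>

text \<open>For five consecutive vectors related by the recurrence, each of the nine triples that
  must be independent has as determinant the first one times a factor. These factors are monomials
  in the corner invariants, except that one is \<open>1 - y\<close> and another contains
  \<open>1 - x\<close>. General position is therefore exactly the condition that no corner invariant
  is \<open>0\<close> or \<open>1\<close>, whence the punctured line. The two directions are
  unequal. Lifts of the vertices with regular coordinates are constructed only locally on the
  polygon variety, so regularity of the quotient map is checked near each point, with the corners
  written as quotients of determinants. The section has a global lift, since it only runs the
  recurrence forwards. A point of the polygon variety is finite data, a polygon an infinite
  sequence; the corners near the ends reach beyond the given vertices, so the sequence has to be
  reconstructed with the monodromy. The quotient is first realised as a closed subset of affine
  space, where being a variety is easy to verify, and then identified with the corner space.\<close>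

text \<open>A sheaf of functions does not yet know that regular functions can be inverted where they do not
  vanish; all generated structures have this property.\<close>

definition locally_ringed :: "('p, 'k::field) fspace \<Rightarrow> bool" where
  "locally_ringed X \<longleftrightarrow> function_sheaf X \<and>
     (\<forall>U f. openin (zariski X) U \<longrightarrow> f \<in> regular_on X U \<longrightarrow>
        openin (zariski X) {x \<in> U. f x \<noteq> 0} \<and>
        (\<lambda>x. inverse (f x)) \<in> regular_on X {x \<in> U. f x \<noteq> 0})"

lemma locally_ringedD:
  assumes "locally_ringed X"
  shows "function_sheaf X"
    and "openin (zariski X) U \<Longrightarrow> f \<in> regular_on X U \<Longrightarrow> openin (zariski X) {x \<in> U. f x \<noteq> 0}"
    and "openin (zariski X) U \<Longrightarrow> f \<in> regular_on X U \<Longrightarrow>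
      (\<lambda>x. inverse (f x)) \<in> regular_on X {x \<in> U. f x \<noteq> 0}"
  using assms by (auto simp: locally_ringed_def)

lemma regular_on_inverse:
  assumes "locally_ringed X" "openin (zariski X) U" "f \<in> regular_on X U" "\<And>x. x \<in> U \<Longrightarrow> f x \<noteq> 0"
  shows "(\<lambda>x. inverse (f x)) \<in> regular_on X U"
proof -
  have "{x \<in> U. f x \<noteq> 0} = U" using assms(4) by auto
  then show ?thesis using locally_ringedD(3)[OF assms(1-3)] by simp
qed

lemma regular_on_divide:
  assumes "locally_ringed X" "openin (zariski X) U" "f \<in> regular_on X U" "g \<in> regular_on X U"
    "\<And>x. x \<in> U \<Longrightarrow> g x \<noteq> 0"
  shows "(\<lambda>x. f x / g x) \<in> regular_on X U"
  using function_sheafD(3)[OF locally_ringedD(1)[OF assms(1)] assms(2,3)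
      regular_on_inverse[OF assms(1,2,4,5)]]
  by (simp add: divide_inverse)

lemma regular_on_minus:
  assumes "function_sheaf X" "openin (zariski X) U" "f \<in> regular_on X U"
  shows "(\<lambda>x. - f x) \<in> regular_on X U"
  using function_sheafD(3)[OF assms(1,2) function_sheafD(1)[OF assms(1,2), of "-1"] assms(3)] by simp

lemma regular_on_diff:
  assumes "function_sheaf X" "openin (zariski X) U" "f \<in> regular_on X U" "g \<in> regular_on X U"
  shows "(\<lambda>x. f x - g x) \<in> regular_on X U"
  using function_sheafD(2)[OF assms(1-3) regular_on_minus[OF assms(1,2,4)]] by simp

section \<open>Generated structures, restricted to subsets\<close>

lemma points_open_sub_generated:
  assumes "\<And>U f. (U, f) \<in> G \<Longrightarrow> U \<subseteq> P"
  shows "points (open_sub (generated P G) S) = P \<inter> S"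
  using topspace_generated[of G P, OF assms] by (simp add: points_def open_sub_def)

text \<open>The results on generated structures are proved for \<open>open_sub\<close>, as the
  punctured line, \<open>PGL3\<close> and the polygon variety are of that form. This equation
  specialises them to whole spaces.\<close>

lemma open_sub_points: "open_sub X (points X) = X"
  by (simp add: open_sub_def points_def)

lemma regular_on_open_sub [simp]: "regular_on (open_sub X S) = regular_on X"
  by (simp add: open_sub_def)

lemma regular_on_generated:
  "f \<in> regular_on (generated P G) W \<longleftrightarrow> (\<forall>x\<in>W. \<exists>U g h. (U, g) \<in> gen_fun P G \<and> (U, h) \<in> gen_fun P G \<and>
     x \<in> U \<and> h x \<noteq> 0 \<and> (\<forall>y\<in>U \<inter> W. h y \<noteq> 0 \<longrightarrow> f y = g y / h y))"
  by (simp add: generated_def)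

lemma regular_on_generatedE:
  assumes "f \<in> regular_on (generated P G) W" "x \<in> W"
  obtains U g h where "(U, g) \<in> gen_fun P G" "(U, h) \<in> gen_fun P G" "x \<in> U" "h x \<noteq> 0"
    "\<forall>y\<in>U. y \<in> W \<longrightarrow> h y \<noteq> 0 \<longrightarrow> f y = g y / h y"
proof -
  obtain U g h where U: "(U, g) \<in> gen_fun P G" "(U, h) \<in> gen_fun P G" "x \<in> U" "h x \<noteq> 0"
    "\<forall>y\<in>U \<inter> W. h y \<noteq> 0 \<longrightarrow> f y = g y / h y"
    using bspec[OF iffD1[OF regular_on_generated assms(1)] assms(2)] by (elim exE conjE)
  from U(5) have "\<forall>y\<in>U. y \<in> W \<longrightarrow> h y \<noteq> 0 \<longrightarrow> f y = g y / h y" by simp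
  with U(1-4) show thesis by (rule that)
qed

lemma regular_on_generatedI:
  assumes "\<And>x. x \<in> W \<Longrightarrow> \<exists>U g h. (U, g) \<in> gen_fun P G \<and> (U, h) \<in> gen_fun P G \<and>
     x \<in> U \<and> h x \<noteq> 0 \<and> (\<forall>y. y \<in> U \<longrightarrow> y \<in> W \<longrightarrow> h y \<noteq> 0 \<longrightarrow> f y = g y / h y)"
  shows "f \<in> regular_on (generated P G) W"
  unfolding regular_on_generated Ball_def Int_iff
  using assms by (simp only: imp_conjL) simp

lemma openin_gen_fun:
  assumes "(U, f) \<in> gen_fun P G"
  shows "openin (zariski (open_sub (generated P G) S)) {x \<in> U \<inter> S. f x \<noteq> 0}"
proof -
  have "openin (zariski (generated P G)) {x \<in> U. f x \<noteq> 0}"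
    unfolding generated_def fspace.simps using assms by (intro topology_generated_by_Basis) blast
  moreover have "{x \<in> U \<inter> S. f x \<noteq> 0} = S \<inter> {x \<in> U. f x \<noteq> 0}" by auto
  ultimately show ?thesis by (simp add: open_sub_def openin_subtopology_Int2)
qed

text \<open>The nonvanishing sets are declared only as a subbase of the topology. They form a base
  because two of them meet in the nonvanishing set of a product.\<close>

lemma gen_fun_base:
  assumes "openin (zariski (open_sub (generated P G) S)) W" "x \<in> W"
  obtains U f where "(U, f) \<in> gen_fun P G" "x \<in> U" "f x \<noteq> 0" "{x \<in> U \<inter> S. f x \<noteq> 0} \<subseteq> W"
proof -
  obtain W' where W': "openin (zariski (generated P G)) W'" "W = W' \<inter> S"
    using assms(1) by (auto simp: open_sub_def openin_subtopology)
  have "generate_topology_on {{x \<in> U. f x \<noteq> 0} | U f. (U, f) \<in> gen_fun P G} W'"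
    using W'(1) by (simp add: generated_def openin_topology_generated_by_iff)
  then have base: "\<forall>x\<in>W'. \<exists>U f. (U, f) \<in> gen_fun P G \<and> x \<in> U \<and> f x \<noteq> 0 \<and> {x \<in> U. f x \<noteq> 0} \<subseteq> W'"
  proof induction
    case (Int a b)
    show ?case
    proof
      fix x assume "x \<in> a \<inter> b"
      then have x: "x \<in> a" "x \<in> b" by auto
      obtain U f where U: "(U, f) \<in> gen_fun P G" "x \<in> U" "f x \<noteq> 0" "{x \<in> U. f x \<noteq> 0} \<subseteq> a"
        using bspec[OF Int.IH(1) x(1)] by (elim exE conjE)
      obtain V g where V: "(V, g) \<in> gen_fun P G" "x \<in> V" "g x \<noteq> 0" "{x \<in> V. g x \<noteq> 0} \<subseteq> b"
        using bspec[OF Int.IH(2) x(2)] by (elim exE conjE)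
      from U V gen_fun.mult[OF U(1) V(1)]
      show "\<exists>U f. (U, f) \<in> gen_fun P G \<and> x \<in> U \<and> f x \<noteq> 0 \<and> {x \<in> U. f x \<noteq> 0} \<subseteq> a \<inter> b"
        by (intro exI[of _ "U \<inter> V"] exI[of _ "\<lambda>x. f x * g x"]) auto
    qed
  next
    case (UN K)
    show ?case
    proof
      fix x assume "x \<in> \<Union>K"
      then obtain k where k: "k \<in> K" "x \<in> k" by blast
      obtain U f where "(U, f) \<in> gen_fun P G" "x \<in> U" "f x \<noteq> 0" "{x \<in> U. f x \<noteq> 0} \<subseteq> k"
        using bspec[OF UN.IH[OF k(1)] k(2)] by (elim exE conjE)
      with k(1) show "\<exists>U f. (U, f) \<in> gen_fun P G \<and> x \<in> U \<and> f x \<noteq> 0 \<and> {x \<in> U. f x \<noteq> 0} \<subseteq> \<Union>K"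
        by (intro exI[of _ U] exI[of _ f]) blast
    qed
  next
    case (Basis s)
    then show ?case by auto
  qed auto
  have "x \<in> W'" using W'(2) assms(2) by blast
  from bspec[OF base this] obtain U f where U: "(U, f) \<in> gen_fun P G" "x \<in> U" "f x \<noteq> 0" "{x \<in> U. f x \<noteq> 0} \<subseteq> W'"
    by (elim exE conjE)
  from U(4) have "{x \<in> U \<inter> S. f x \<noteq> 0} \<subseteq> W" unfolding W'(2) by blast
  with U(1-3) show thesis by (rule that)
qed

text \<open>Sections are local fractions. The recurring device is to expand a fraction by a further
  function: its value stays the same, and the set where the denominator is nonzero shrinks to where
  the representation is valid.\<close>

lemma locally_ringed_open_sub_generated:
  fixes G :: "('p set \<times> ('p \<Rightarrow> 'k::field)) set"
  assumes "\<And>U f. (U, f) \<in> G \<Longrightarrow> U \<subseteq> P"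
  shows "locally_ringed (open_sub (generated P G) S)"
proof -
  let ?X = "open_sub (generated P G) S"
  have PS: "U \<subseteq> P \<inter> S" if "openin (zariski ?X) U" for U
    using openin_subset[OF that] points_open_sub_generated[of G P S] assms by (auto simp: points_def)
  have sheaf: "function_sheaf ?X"
  proof (rule function_sheafI, unfold regular_on_open_sub)
    fix U and c :: 'k
    assume "openin (zariski ?X) U"
    then have "\<And>x. x \<in> U \<Longrightarrow> x \<in> P" using PS by blast
    then show "(\<lambda>_. c) \<in> regular_on (generated P G) U"
      by (intro regular_on_generatedI exI[of _ P] exI[of _ "\<lambda>_. c"] exI[of _ "\<lambda>_. 1"])
        (simp add: gen_fun.const)
  next
    fix U and f g :: "'p \<Rightarrow> 'k"
    assume f: "f \<in> regular_on (generated P G) U" and g: "g \<in> regular_on (generated P G) U"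
    show "(\<lambda>x. f x + g x) \<in> regular_on (generated P G) U"
    proof (rule regular_on_generatedI)
      fix x assume x: "x \<in> U"
      obtain A a b where A: "(A, a) \<in> gen_fun P G" "(A, b) \<in> gen_fun P G" "x \<in> A" "b x \<noteq> 0"
        "\<forall>y\<in>A. y \<in> U \<longrightarrow> b y \<noteq> 0 \<longrightarrow> f y = a y / b y" by (rule regular_on_generatedE[OF f x])
      obtain C c d where C: "(C, c) \<in> gen_fun P G" "(C, d) \<in> gen_fun P G" "x \<in> C" "d x \<noteq> 0"
        "\<forall>y\<in>C. y \<in> U \<longrightarrow> d y \<noteq> 0 \<longrightarrow> g y = c y / d y" by (rule regular_on_generatedE[OF g x])
      have "(A \<inter> C, \<lambda>x. a x * d x + b x * c x) \<in> gen_fun P G"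
        using gen_fun.add[OF gen_fun.mult[OF A(1) C(2)] gen_fun.mult[OF A(2) C(1)]] by simp
      moreover have "(A \<inter> C, \<lambda>x. b x * d x) \<in> gen_fun P G" by (rule gen_fun.mult[OF A(2) C(2)])
      moreover have "\<forall>y. y \<in> A \<inter> C \<longrightarrow> y \<in> U \<longrightarrow> b y * d y \<noteq> 0 \<longrightarrow> f y + g y = (a y * d y + b y * c y) / (b y * d y)"
        using A(5) C(5) by (auto simp: field_simps)
      ultimately show "\<exists>B g' h. (B, g') \<in> gen_fun P G \<and> (B, h) \<in> gen_fun P G \<and>
          x \<in> B \<and> h x \<noteq> 0 \<and> (\<forall>y. y \<in> B \<longrightarrow> y \<in> U \<longrightarrow> h y \<noteq> 0 \<longrightarrow> f y + g y = g' y / h y)"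
        using A(3,4) C(3,4)
        by (intro exI[of _ "A \<inter> C"] exI[of _ "\<lambda>x. a x * d x + b x * c x"] exI[of _ "\<lambda>x. b x * d x"]) auto
    qed
  next
    fix U and f g :: "'p \<Rightarrow> 'k"
    assume f: "f \<in> regular_on (generated P G) U" and g: "g \<in> regular_on (generated P G) U"
    show "(\<lambda>x. f x * g x) \<in> regular_on (generated P G) U"
    proof (rule regular_on_generatedI)
      fix x assume x: "x \<in> U"
      obtain A a b where A: "(A, a) \<in> gen_fun P G" "(A, b) \<in> gen_fun P G" "x \<in> A" "b x \<noteq> 0"
        "\<forall>y\<in>A. y \<in> U \<longrightarrow> b y \<noteq> 0 \<longrightarrow> f y = a y / b y" by (rule regular_on_generatedE[OF f x])
      obtain C c d where C: "(C, c) \<in> gen_fun P G" "(C, d) \<in> gen_fun P G" "x \<in> C" "d x \<noteq> 0"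
        "\<forall>y\<in>C. y \<in> U \<longrightarrow> d y \<noteq> 0 \<longrightarrow> g y = c y / d y" by (rule regular_on_generatedE[OF g x])
      show "\<exists>B g' h. (B, g') \<in> gen_fun P G \<and> (B, h) \<in> gen_fun P G \<and>
          x \<in> B \<and> h x \<noteq> 0 \<and> (\<forall>y. y \<in> B \<longrightarrow> y \<in> U \<longrightarrow> h y \<noteq> 0 \<longrightarrow> f y * g y = g' y / h y)"
        using A(3,4,5) C(3,4,5) gen_fun.mult[OF A(1) C(1)] gen_fun.mult[OF A(2) C(2)]
        by (intro exI[of _ "A \<inter> C"] exI[of _ "\<lambda>x. a x * c x"] exI[of _ "\<lambda>x. b x * d x"]) auto
    qed
  next
    fix U and f g :: "'p \<Rightarrow> 'k"
    assume "f \<in> regular_on (generated P G) U" "\<And>x. x \<in> U \<Longrightarrow> g x = f x"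
    then show "g \<in> regular_on (generated P G) U"
      unfolding regular_on_generated by simp
  next
    fix U V and f :: "'p \<Rightarrow> 'k"
    assume f: "f \<in> regular_on (generated P G) U" and VU: "V \<subseteq> U"
    show "f \<in> regular_on (generated P G) V"
    proof (rule regular_on_generatedI)
      fix x assume "x \<in> V"
      then have x: "x \<in> U" using VU by blast
      obtain A a b where A: "(A, a) \<in> gen_fun P G" "(A, b) \<in> gen_fun P G" "x \<in> A" "b x \<noteq> 0"
        "\<forall>y\<in>A. y \<in> U \<longrightarrow> b y \<noteq> 0 \<longrightarrow> f y = a y / b y" by (rule regular_on_generatedE[OF f x])
      have "\<forall>y. y \<in> A \<longrightarrow> y \<in> V \<longrightarrow> b y \<noteq> 0 \<longrightarrow> f y = a y / b y" using A(5) VU by blast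
      with A(1-4) show "\<exists>B g h. (B, g) \<in> gen_fun P G \<and> (B, h) \<in> gen_fun P G \<and>
          x \<in> B \<and> h x \<noteq> 0 \<and> (\<forall>y. y \<in> B \<longrightarrow> y \<in> V \<longrightarrow> h y \<noteq> 0 \<longrightarrow> f y = g y / h y)"
        by (intro exI[of _ A] exI[of _ a] exI[of _ b] conjI)
    qed
  next
    fix U and f :: "'p \<Rightarrow> 'k"
    assume U: "openin (zariski ?X) U" and
      f: "\<And>x. x \<in> U \<Longrightarrow> \<exists>V. openin (zariski ?X) V \<and> x \<in> V \<and> V \<subseteq> U \<and>
        f \<in> regular_on (generated P G) V"
    show "f \<in> regular_on (generated P G) U"
    proof (rule regular_on_generatedI)
      fix x assume "x \<in> U"
      with f obtain V where V: "openin (zariski ?X) V" "x \<in> V" "f \<in> regular_on (generated P G) V" by blast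
      obtain A a b where A: "(A, a) \<in> gen_fun P G" "(A, b) \<in> gen_fun P G" "x \<in> A" "b x \<noteq> 0"
        "\<forall>y\<in>A. y \<in> V \<longrightarrow> b y \<noteq> 0 \<longrightarrow> f y = a y / b y" by (rule regular_on_generatedE[OF V(3,2)])
      obtain B h where B: "(B, h) \<in> gen_fun P G" "x \<in> B" "h x \<noteq> 0" "{x \<in> B \<inter> S. h x \<noteq> 0} \<subseteq> V"
        by (rule gen_fun_base[OF V(1,2)])
      \<comment> \<open>The factor \<open>h\<close> forces \<open>y\<close> into \<open>V\<close>,
        where the fraction \<open>a / b\<close> is known to represent \<open>f\<close>.\<close>
      have "\<forall>y. y \<in> A \<inter> B \<longrightarrow> y \<in> U \<longrightarrow> b y * h y \<noteq> 0 \<longrightarrow> f y = a y * h y / (b y * h y)"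
        using A(5) B(4) PS[OF U] by auto
      then show "\<exists>B g h. (B, g) \<in> gen_fun P G \<and> (B, h) \<in> gen_fun P G \<and>
          x \<in> B \<and> h x \<noteq> 0 \<and> (\<forall>y. y \<in> B \<longrightarrow> y \<in> U \<longrightarrow> h y \<noteq> 0 \<longrightarrow> f y = g y / h y)"
        using A(3,4) B(2,3) gen_fun.mult[OF A(1) B(1)] gen_fun.mult[OF A(2) B(1)]
        by (intro exI[of _ "A \<inter> B"] exI[of _ "\<lambda>x. a x * h x"] exI[of _ "\<lambda>x. b x * h x"]) auto
    qed
  qed
  moreover have "openin (zariski ?X) {x \<in> U. f x \<noteq> 0} \<and>
      (\<lambda>x. inverse (f x)) \<in> regular_on ?X {x \<in> U. f x \<noteq> 0}"
    if U: "openin (zariski ?X) U" and f: "f \<in> regular_on ?X U" for U and f :: "'p \<Rightarrow> 'k"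
  proof
    show "openin (zariski ?X) {x \<in> U. f x \<noteq> 0}"
      unfolding openin_subopen[of _ "{x \<in> U. f x \<noteq> 0}"]
    proof
      fix x assume "x \<in> {x \<in> U. f x \<noteq> 0}"
      then have x: "x \<in> U" "f x \<noteq> 0" by auto
      obtain A a b where A: "(A, a) \<in> gen_fun P G" "(A, b) \<in> gen_fun P G" "x \<in> A" "b x \<noteq> 0"
        "\<forall>y\<in>A. y \<in> U \<longrightarrow> b y \<noteq> 0 \<longrightarrow> f y = a y / b y" by (rule regular_on_generatedE[OF f[unfolded regular_on_open_sub] x(1)])
      \<comment> \<open>The product rather than \<open>a\<close> alone: where \<open>b\<close>
        vanishes the fraction says nothing about \<open>f\<close>.\<close>
      have "(A, \<lambda>x. a x * b x) \<in> gen_fun P G" using gen_fun.mult[OF A(1,2)] by simp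
      then have "openin (zariski ?X) (U \<inter> {x \<in> A \<inter> S. a x * b x \<noteq> 0})"
        by (intro openin_Int U openin_gen_fun)
      moreover have "U \<inter> {x \<in> A \<inter> S. a x * b x \<noteq> 0} \<subseteq> {x \<in> U. f x \<noteq> 0}" using A(5) by auto
      moreover have "x \<in> U \<inter> {x \<in> A \<inter> S. a x * b x \<noteq> 0}" using x A PS[OF U] by auto
      ultimately show "\<exists>T. openin (zariski ?X) T \<and> x \<in> T \<and> T \<subseteq> {x \<in> U. f x \<noteq> 0}" by blast
    qed
    show "(\<lambda>x. inverse (f x)) \<in> regular_on ?X {x \<in> U. f x \<noteq> 0}"
      unfolding regular_on_open_sub
    proof (rule regular_on_generatedI)
      fix x assume "x \<in> {x \<in> U. f x \<noteq> 0}"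
      then have x: "x \<in> U" "f x \<noteq> 0" by auto
      obtain A a b where A: "(A, a) \<in> gen_fun P G" "(A, b) \<in> gen_fun P G" "x \<in> A" "b x \<noteq> 0"
        "\<forall>y\<in>A. y \<in> U \<longrightarrow> b y \<noteq> 0 \<longrightarrow> f y = a y / b y" by (rule regular_on_generatedE[OF f[unfolded regular_on_open_sub] x(1)])
      \<comment> \<open>The inverse \<open>b / a\<close> is expanded by \<open>b\<close>, so that
        points with \<open>b = 0\<close> impose no condition.\<close>
      have "(A, \<lambda>x. b x * b x) \<in> gen_fun P G" "(A, \<lambda>x. a x * b x) \<in> gen_fun P G"
        using gen_fun.mult[OF A(2,2)] gen_fun.mult[OF A(1,2)] by simp_all
      moreover have "a x \<noteq> 0" using A(3,5) x A(4) by auto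
      ultimately show "\<exists>B g h. (B, g) \<in> gen_fun P G \<and> (B, h) \<in> gen_fun P G \<and> x \<in> B \<and> h x \<noteq> 0 \<and>
          (\<forall>y. y \<in> B \<longrightarrow> y \<in> {x \<in> U. f x \<noteq> 0} \<longrightarrow> h y \<noteq> 0 \<longrightarrow> inverse (f y) = g y / h y)"
        using A(3,4,5)
        by (intro exI[of _ A] exI[of _ "\<lambda>x. b x * b x"] exI[of _ "\<lambda>x. a x * b x"]) auto
    qed
  qed
  ultimately show ?thesis unfolding locally_ringed_def by blast
qed

lemma generator_regular:
  assumes "(U, f) \<in> G" "\<And>U f. (U, f) \<in> G \<Longrightarrow> U \<subseteq> P"
  shows "openin (zariski (open_sub (generated P G) S)) (U \<inter> S)"
    and "f \<in> regular_on (open_sub (generated P G) S) (U \<inter> S)"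
proof -
  have U: "(U, f) \<in> gen_fun P G" "U \<subseteq> P" using assms by (auto intro: gen_fun.base)
  \<comment> \<open>Constants come with the full domain \<open>P\<close>; adding
    \<open>0 * f\<close> cuts the domain down to \<open>U\<close>.\<close>
  have "(U, \<lambda>x. 0 * f x) \<in> gen_fun P G"
    using gen_fun.mult[OF gen_fun.const U(1), of 0] U(2) by (simp add: inf.absorb2)
  then have one: "(U, \<lambda>_. 1) \<in> gen_fun P G"
    using gen_fun.add[OF gen_fun.const, of U "\<lambda>x. 0 * f x" P G 1] U(2) by (simp add: inf.absorb2)
  have "{x \<in> U \<inter> S. (\<lambda>_. 1::'b) x \<noteq> 0} = U \<inter> S" by auto
  then show "openin (zariski (open_sub (generated P G) S)) (U \<inter> S)" using openin_gen_fun[OF one, of S] by simp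
  show "f \<in> regular_on (open_sub (generated P G) S) (U \<inter> S)"
    unfolding regular_on_open_sub
    by (rule regular_on_generatedI, intro exI[of _ U] exI[of _ f] exI[of _ "\<lambda>_. 1"]) (auto simp: U one)
qed

text \<open>Pulling back commutes with polynomial expressions, and on a locally ringed source the
  quotients of such expressions are regular as well, so generators suffice. The criteria for
  products, powers, affine and projective spaces are instances.\<close>

lemma morphism_into_generated:
  fixes X :: "('q, 'k::field) fspace"
  assumes X: "locally_ringed X" and GP: "\<And>U f. (U, f) \<in> G \<Longrightarrow> U \<subseteq> P"
    and pts: "\<And>x. x \<in> points X \<Longrightarrow> \<phi> x \<in> P \<inter> S"
    and G: "\<And>U f. (U, f) \<in> G \<Longrightarrow> openin (zariski X) {x \<in> points X. \<phi> x \<in> U} \<and>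
        (\<lambda>x. f (\<phi> x)) \<in> regular_on X {x \<in> points X. \<phi> x \<in> U}"
  shows "morphism X (open_sub (generated P G) S) \<phi>"
proof -
  let ?Y = "open_sub (generated P G) S"
  note sh = locally_ringedD(1)[OF X]
  define pre where "pre U = {x \<in> points X. \<phi> x \<in> U}" for U
  have preInt: "pre (U \<inter> V) = pre U \<inter> pre V" for U V by (auto simp: pre_def)
  have res: "f \<in> regular_on X (U \<inter> V)" "f \<in> regular_on X (V \<inter> U)" "openin (zariski X) (U \<inter> V)"
    if "openin (zariski X) U" "openin (zariski X) V" "f \<in> regular_on X U" for f U V
    using function_sheafD(5)[OF sh that(1,3)] openin_Int[OF that(1,2)] openin_Int[OF that(2,1)] by auto
  have all: "openin (zariski X) (pre U) \<and> (\<lambda>x. f (\<phi> x)) \<in> regular_on X (pre U)"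
    if "(U, f) \<in> gen_fun P G" for U f
    using that
  proof induction
    case (base U f)
    then show ?case using G by (simp add: pre_def)
  next
    case (const c)
    have "pre P = points X" using pts by (auto simp: pre_def)
    moreover have "openin (zariski X) (points X)" by (simp add: points_def)
    ultimately show ?case using function_sheafD(1)[OF sh] by simp
  next
    case (add U f V g)
    then show ?case unfolding preInt
      using res[of "pre U" "pre V" "\<lambda>x. f (\<phi> x)"] res[of "pre V" "pre U" "\<lambda>x. g (\<phi> x)"]
        function_sheafD(2)[OF sh, of "pre U \<inter> pre V" "\<lambda>x. f (\<phi> x)" "\<lambda>x. g (\<phi> x)"] by simp
  next
    case (mult U f V g)
    then show ?case unfolding preInt
      using res[of "pre U" "pre V" "\<lambda>x. f (\<phi> x)"] res[of "pre V" "pre U" "\<lambda>x. g (\<phi> x)"]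
        function_sheafD(3)[OF sh, of "pre U \<inter> pre V" "\<lambda>x. f (\<phi> x)" "\<lambda>x. g (\<phi> x)"] by simp
  qed
  have cont: "continuous_map (zariski X) (zariski ?Y) \<phi>"
    unfolding continuous_map_def
  proof (intro conjI allI impI)
    show "\<phi> \<in> topspace (zariski X) \<rightarrow> topspace (zariski ?Y)"
      using pts points_open_sub_generated[of G P S, OF GP] by (auto simp: points_def)
    fix W assume W: "openin (zariski ?Y) W"
    show "openin (zariski X) {x \<in> topspace (zariski X). \<phi> x \<in> W}"
      unfolding openin_subopen[of _ "{x \<in> topspace (zariski X). \<phi> x \<in> W}"]
    proof
      fix x assume "x \<in> {x \<in> topspace (zariski X). \<phi> x \<in> W}"
      then have x: "x \<in> points X" "\<phi> x \<in> W" by (auto simp: points_def)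
      obtain U f where U: "(U, f) \<in> gen_fun P G" "\<phi> x \<in> U" "f (\<phi> x) \<noteq> 0"
          "{x \<in> U \<inter> S. f x \<noteq> 0} \<subseteq> W" by (rule gen_fun_base[OF W x(2)])
      have "openin (zariski X) {x \<in> pre U. f (\<phi> x) \<noteq> 0}"
        using locally_ringedD(2)[OF X] all[OF U(1)] by blast
      then show "\<exists>T. openin (zariski X) T \<and> x \<in> T \<and> T \<subseteq> {x \<in> topspace (zariski X). \<phi> x \<in> W}"
        using U x pts by (intro exI[of _ "{x \<in> pre U. f (\<phi> x) \<noteq> 0}"]) (auto simp: pre_def points_def)
    qed
  qed
  have "f \<circ> \<phi> \<in> regular_on X {x \<in> points X. \<phi> x \<in> W}"
    if W: "openin (zariski ?Y) W" and f: "f \<in> regular_on ?Y W" for W f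
  proof (rule function_sheafD(6)[OF sh])
    show o: "openin (zariski X) {x \<in> points X. \<phi> x \<in> W}"
      unfolding points_def by (rule openin_continuous_map_preimage[OF cont W])
    fix x assume x: "x \<in> {x \<in> points X. \<phi> x \<in> W}"
    then have "\<phi> x \<in> W" by simp
    from regular_on_generatedE[OF f[unfolded regular_on_open_sub] this]
    obtain U g h where U: "(U, g) \<in> gen_fun P G" "(U, h) \<in> gen_fun P G" "\<phi> x \<in> U" "h (\<phi> x) \<noteq> 0"
        "\<forall>y\<in>U. y \<in> W \<longrightarrow> h y \<noteq> 0 \<longrightarrow> f y = g y / h y" by blast
    let ?D = "{x \<in> pre U. h (\<phi> x) \<noteq> 0}"
    let ?V = "?D \<inter> {x \<in> points X. \<phi> x \<in> W}"
    have D: "openin (zariski X) ?D" using locally_ringedD(2)[OF X] all[OF U(2)] by blast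
    then have V: "openin (zariski X) ?V" by (rule openin_Int[OF _ o])
    have "?V \<subseteq> pre U" by auto
    with all[OF U(1)] all[OF U(2)] V
    have "(\<lambda>x. g (\<phi> x)) \<in> regular_on X ?V" "(\<lambda>x. h (\<phi> x)) \<in> regular_on X ?V"
      using function_sheafD(5)[OF sh, of "pre U" _ ?V] by blast+
    then have "(\<lambda>x. g (\<phi> x) / h (\<phi> x)) \<in> regular_on X ?V"
      by (rule regular_on_divide[OF X V]) auto
    then have "f \<circ> \<phi> \<in> regular_on X ?V"
      by (rule function_sheafD(4)[OF sh V]) (use U(5) in \<open>auto simp: pre_def\<close>)
    then show "\<exists>V. openin (zariski X) V \<and> x \<in> V \<and> V \<subseteq> {x \<in> points X. \<phi> x \<in> W} \<and> f \<circ> \<phi> \<in> regular_on X V"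
      using V U(3,4) x by (intro exI[of _ ?V]) (auto simp: pre_def)
  qed
  with cont show ?thesis by (simp add: morphism_def)
qed

subsection \<open>Products, powers, projective and affine spaces\<close>

lemma prod_generator_subset:
  assumes "(W, h) \<in> {(U \<times> points Y, f \<circ> fst) | U f. openin (zariski X) U \<and> f \<in> regular_on X U} \<union>
      {(points X \<times> V, g \<circ> snd) | V g. openin (zariski Y) V \<and> g \<in> regular_on Y V}"
  shows "W \<subseteq> points X \<times> points Y"
  using assms by (auto simp: points_def dest: openin_subset)

lemma power_generator_subset:
  assumes "(W, h) \<in> {({p \<in> I \<rightarrow>\<^sub>E points X. p i \<in> U}, \<lambda>p. f (p i)) | i U f.
        i \<in> I \<and> openin (zariski X) U \<and> f \<in> regular_on X U}"
  shows "W \<subseteq> I \<rightarrow>\<^sub>E points X"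
  using assms by auto

lemma proj_generator_subset:
  assumes "(W, h) \<in> {({p \<in> proj_points co. \<forall>x\<in>p. co j x \<noteq> 0}, coord_ratio co i j) | i j. True}"
  shows "W \<subseteq> proj_points co"
  using assms by auto

lemma affine_generator_subset:
  assumes "(W, h) \<in> {(Z, \<lambda>x. x i) | i. i < m}"
  shows "W \<subseteq> Z"
  using assms by auto

lemma points_prod_fspace: "points (prod_fspace X Y) = points X \<times> points Y"
  unfolding prod_fspace_def points_def[of "generated _ _"]
  by (rule topspace_generated) (rule prod_generator_subset)

lemma points_power_fspace: "points (power_fspace I X) = I \<rightarrow>\<^sub>E points X"
  unfolding power_fspace_def points_def[of "generated _ _"]
  by (rule topspace_generated) (rule power_generator_subset)

lemma points_proj_fspace: "points (proj_fspace co) = proj_points co"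
  unfolding proj_fspace_def points_def[of "generated _ _"]
  by (rule topspace_generated) (rule proj_generator_subset)

lemma points_affine_sub: "points (affine_sub m Z) = Z"
  unfolding affine_sub_def points_def[of "generated _ _"]
  by (rule topspace_generated) (rule affine_generator_subset)

lemma locally_ringed_open_sub_prod: "locally_ringed (open_sub (prod_fspace X Y) S)"
  unfolding prod_fspace_def by (rule locally_ringed_open_sub_generated) (rule prod_generator_subset)

lemma locally_ringed_power: "locally_ringed (power_fspace I X)"
proof -
  have "locally_ringed (open_sub (power_fspace I X) S)" for S
    unfolding power_fspace_def by (rule locally_ringed_open_sub_generated) (rule power_generator_subset)
  from this[of "points (power_fspace I X)"] show ?thesis unfolding open_sub_points .
qed

lemma locally_ringed_affine: "locally_ringed (affine_sub m Z)"
proof -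
  have "locally_ringed (open_sub (affine_sub m Z) S)" for S
    unfolding affine_sub_def by (rule locally_ringed_open_sub_generated) (rule affine_generator_subset)
  from this[of "points (affine_sub m Z)"] show ?thesis unfolding open_sub_points .
qed

lemma morphism_regular_on:
  assumes "morphism X Y \<phi>" "openin (zariski Y) V" "f \<in> regular_on Y V"
  shows "openin (zariski X) {x \<in> points X. \<phi> x \<in> V}"
    and "(\<lambda>x. f (\<phi> x)) \<in> regular_on X {x \<in> points X. \<phi> x \<in> V}"
  using assms openin_continuous_map_preimage[of "zariski X" "zariski Y" \<phi> V]
  by (auto simp: morphism_def points_def o_def)

lemma morphism_points:
  assumes "morphism X Y \<phi>" "x \<in> points X"
  shows "\<phi> x \<in> points Y"
  using assms by (auto simp: morphism_def points_def continuous_map_def)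

lemma morphism_into_prod:
  assumes Z: "locally_ringed Z" and f: "morphism Z X f" and g: "morphism Z Y g"
    and S: "\<And>z. z \<in> points Z \<Longrightarrow> (f z, g z) \<in> S"
  shows "morphism Z (open_sub (prod_fspace X Y) S) (\<lambda>z. (f z, g z))"
  unfolding prod_fspace_def
proof (rule morphism_into_generated[OF Z])
  show "(f z, g z) \<in> points X \<times> points Y \<inter> S" if "z \<in> points Z" for z
    using S that morphism_points[OF f] morphism_points[OF g] by auto
  fix W h assume "(W, h) \<in> {(U \<times> points Y, f \<circ> fst) | U f. openin (zariski X) U \<and> f \<in> regular_on X U} \<union>
      {(points X \<times> V, g \<circ> snd) | V g. openin (zariski Y) V \<and> g \<in> regular_on Y V}"
  then consider U a where "W = U \<times> points Y" "h = a \<circ> fst" "openin (zariski X) U" "a \<in> regular_on X U"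
    | V a where "W = points X \<times> V" "h = a \<circ> snd" "openin (zariski Y) V" "a \<in> regular_on Y V"
    by blast
  then show "openin (zariski Z) {z \<in> points Z. (f z, g z) \<in> W} \<and>
      (\<lambda>z. h (f z, g z)) \<in> regular_on Z {z \<in> points Z. (f z, g z) \<in> W}"
  proof cases
    case 1
    have "{z \<in> points Z. (f z, g z) \<in> W} = {z \<in> points Z. f z \<in> U}"
      using 1(1) morphism_points[OF g] by auto
    then show ?thesis using morphism_regular_on[OF f 1(3,4)] 1(2) by simp
  next
    case 2
    have "{z \<in> points Z. (f z, g z) \<in> W} = {z \<in> points Z. g z \<in> V}"
      using 2(1) morphism_points[OF f] by auto
    then show ?thesis using morphism_regular_on[OF g 2(3,4)] 2(2) by simp
  qed
qed (rule prod_generator_subset)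

lemma morphism_into_power:
  assumes Z: "locally_ringed Z" and f: "\<And>i. i \<in> I \<Longrightarrow> morphism Z X (f i)"
  shows "morphism Z (power_fspace I X) (\<lambda>z. \<lambda>i\<in>I. f i z)"
proof -
  have "morphism Z (open_sub (power_fspace I X) (points (power_fspace I X))) (\<lambda>z. \<lambda>i\<in>I. f i z)"
    unfolding points_power_fspace unfolding power_fspace_def
  proof (rule morphism_into_generated[OF Z])
    show pts: "(\<lambda>i\<in>I. f i z) \<in> (I \<rightarrow>\<^sub>E points X) \<inter> (I \<rightarrow>\<^sub>E points X)" if "z \<in> points Z" for z
      using that morphism_points[OF f] by auto
    fix W h assume "(W, h) \<in> {({p \<in> I \<rightarrow>\<^sub>E points X. p i \<in> U}, \<lambda>p. f (p i)) | i U f.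
        i \<in> I \<and> openin (zariski X) U \<and> f \<in> regular_on X U}"
    then obtain i U a where W: "W = {p \<in> I \<rightarrow>\<^sub>E points X. p i \<in> U}" "h = (\<lambda>p. a (p i))" "i \<in> I"
      "openin (zariski X) U" "a \<in> regular_on X U" by blast
    have "{z \<in> points Z. (\<lambda>i\<in>I. f i z) \<in> W} = {z \<in> points Z. f i z \<in> U}"
      using W(1,3) pts by auto
    then show "openin (zariski Z) {z \<in> points Z. (\<lambda>i\<in>I. f i z) \<in> W} \<and>
        (\<lambda>z. h (\<lambda>i\<in>I. f i z)) \<in> regular_on Z {z \<in> points Z. (\<lambda>i\<in>I. f i z) \<in> W}"
      using morphism_regular_on[OF f[OF W(3)] W(4,5)] W(2,3) by simp
  qed (rule power_generator_subset)
  then show ?thesis unfolding open_sub_points .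
qed

lemma morphism_into_affine:
  assumes Z: "locally_ringed Z" and f: "\<And>i. i < m \<Longrightarrow> (\<lambda>z. f z i) \<in> regular_on Z (points Z)"
    and A: "\<And>z. z \<in> points Z \<Longrightarrow> f z \<in> A"
  shows "morphism Z (affine_sub m A) f"
proof -
  have "morphism Z (open_sub (affine_sub m A) (points (affine_sub m A))) f"
    unfolding points_affine_sub unfolding affine_sub_def
  proof (rule morphism_into_generated[OF Z])
    show "f z \<in> A \<inter> A" if "z \<in> points Z" for z using A that by auto
    fix W h assume "(W, h) \<in> {(A, \<lambda>x. x i :: 'b) | i. i < m}"
    then obtain i where W: "W = A" "h = (\<lambda>x. x i)" "i < m" by blast
    have "{z \<in> points Z. f z \<in> W} = points Z" using A W(1) by auto
    then show "openin (zariski Z) {z \<in> points Z. f z \<in> W} \<and>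
        (\<lambda>z. h (f z)) \<in> regular_on Z {z \<in> points Z. f z \<in> W}"
      using f[OF W(3)] W(2) by (simp add: points_def)
  qed (rule affine_generator_subset)
  then show ?thesis unfolding open_sub_points .
qed

lemma proj_class_self: "x \<in> proj_class co x"
  by (auto simp: proj_class_def intro: exI[of _ 1])

text \<open>Representatives of a point differ by a scalar that cancels in the ratio, so the one
  picked by \<open>SOME\<close> does not matter.\<close>

lemma coord_ratio_eq:
  assumes "x \<in> p" "p \<in> proj_points co"
  shows "coord_ratio co i j p = co i x / co j x"
proof -
  obtain z where z: "p = proj_class co z" using assms(2) by (auto simp: proj_points_def)
  have "(SOME x. x \<in> p) \<in> p" using assms(1) by (rule someI)
  then show ?thesis using assms(1) unfolding coord_ratio_def Let_def z proj_class_def by auto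
qed

lemma proj_class_eqI:
  assumes "c \<noteq> 0" "\<And>i. co i y = c * co i x"
  shows "proj_class co y = proj_class co x"
proof (intro set_eqI iffI)
  fix z assume "z \<in> proj_class co y"
  then obtain d where "d \<noteq> 0" "\<And>i. co i z = d * co i y" by (auto simp: proj_class_def)
  then show "z \<in> proj_class co x"
    unfolding proj_class_def using assms by (intro CollectI exI[of _ "d * c"]) auto
next
  fix z assume "z \<in> proj_class co x"
  then obtain d where "d \<noteq> 0" "\<And>i. co i z = d * co i x" by (auto simp: proj_class_def)
  then show "z \<in> proj_class co y"
    unfolding proj_class_def using assms by (intro CollectI exI[of _ "d / c"]) auto
qed

text \<open>One lift with regular coordinates on all of \<open>Z\<close> is what the applications
  provide: the embedding of the punctured line and the section of the quotient both have global
  lifts.\<close>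

lemma morphism_into_proj:
  assumes Z: "locally_ringed Z" and f: "\<And>i. (\<lambda>z. co i (f z)) \<in> regular_on Z (points Z)"
    and nz: "\<And>z. z \<in> points Z \<Longrightarrow> \<exists>i. co i (f z) \<noteq> 0"
    and S: "\<And>z. z \<in> points Z \<Longrightarrow> proj_class co (f z) \<in> S"
  shows "morphism Z (open_sub (proj_fspace co) S) (\<lambda>z. proj_class co (f z))"
  unfolding proj_fspace_def
proof (rule morphism_into_generated[OF Z])
  have pp: "proj_class co (f z) \<in> proj_points co" if "z \<in> points Z" for z
    using nz[OF that] by (auto simp: proj_points_def)
  then show "proj_class co (f z) \<in> proj_points co \<inter> S" if "z \<in> points Z" for z
    using S that by auto
  fix W h assume "(W, h) \<in> {({p \<in> proj_points co. \<forall>x\<in>p. co j x \<noteq> 0}, coord_ratio co i j) | i j. True}"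
  then obtain i j where W: "W = {p \<in> proj_points co. \<forall>x\<in>p. co j x \<noteq> 0}" "h = coord_ratio co i j"
    by blast
  have o: "openin (zariski Z) (points Z)" by (simp add: points_def)
  have eq: "{z \<in> points Z. proj_class co (f z) \<in> W} = {z \<in> points Z. co j (f z) \<noteq> 0}"
    using pp proj_class_self[of _ co] by (auto simp: W proj_class_def)
  let ?D = "{z \<in> points Z. co j (f z) \<noteq> 0}"
  note sh = locally_ringedD(1)[OF Z]
  have D: "openin (zariski Z) ?D" by (rule locally_ringedD(2)[OF Z o f])
  have "(\<lambda>z. co i (f z) / co j (f z)) \<in> regular_on Z ?D"
    by (rule regular_on_divide[OF Z D]) (use function_sheafD(5)[OF sh o f D] in auto)
  then have "(\<lambda>z. h (proj_class co (f z))) \<in> regular_on Z ?D"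
    by (rule function_sheafD(4)[OF sh D])
      (use coord_ratio_eq[OF proj_class_self pp] in \<open>simp add: W(2)\<close>)
  then show "openin (zariski Z) {z \<in> points Z. proj_class co (f z) \<in> W} \<and>
      (\<lambda>z. h (proj_class co (f z))) \<in> regular_on Z {z \<in> points Z. proj_class co (f z) \<in> W}"
    using D unfolding eq by simp
qed (rule proj_generator_subset)

section \<open>Coordinate functions as regular functions\<close>

lemma regular_on_prod:
  fixes X :: "('p, 'k::field) fspace" and Y :: "('q, 'k) fspace"
  shows "openin (zariski X) U \<Longrightarrow> f \<in> regular_on X U \<Longrightarrow>
      openin (zariski (open_sub (prod_fspace X Y) S)) (U \<times> points Y \<inter> S) \<and>
      (\<lambda>z. f (fst z)) \<in> regular_on (open_sub (prod_fspace X Y) S) (U \<times> points Y \<inter> S)"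
    and "openin (zariski Y) V \<Longrightarrow> g \<in> regular_on Y V \<Longrightarrow>
      openin (zariski (open_sub (prod_fspace X Y) S)) (points X \<times> V \<inter> S) \<and>
      (\<lambda>z. g (snd z)) \<in> regular_on (open_sub (prod_fspace X Y) S) (points X \<times> V \<inter> S)"
proof -
  let ?G = "{(U \<times> points Y, f \<circ> fst) | U f. openin (zariski X) U \<and> f \<in> regular_on X U} \<union>
      {(points X \<times> V, g \<circ> snd) | V g. openin (zariski Y) V \<and> g \<in> regular_on Y V}"
  note gr = generator_regular[of _ _ ?G "points X \<times> points Y", OF _ prod_generator_subset,
      folded prod_fspace_def]
  show "openin (zariski (open_sub (prod_fspace X Y) S)) (U \<times> points Y \<inter> S) \<and>
      (\<lambda>z. f (fst z)) \<in> regular_on (open_sub (prod_fspace X Y) S) (U \<times> points Y \<inter> S)"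
    if "openin (zariski X) U" "f \<in> regular_on X U"
  proof -
    have "(U \<times> points Y, f \<circ> fst) \<in> ?G" using that by blast
    from gr[OF this] show ?thesis by (simp add: o_def)
  qed
  show "openin (zariski (open_sub (prod_fspace X Y) S)) (points X \<times> V \<inter> S) \<and>
      (\<lambda>z. g (snd z)) \<in> regular_on (open_sub (prod_fspace X Y) S) (points X \<times> V \<inter> S)"
    if "openin (zariski Y) V" "g \<in> regular_on Y V"
  proof -
    have "(points X \<times> V, g \<circ> snd) \<in> ?G" using that by blast
    from gr[OF this] show ?thesis by (simp add: o_def)
  qed
qed

lemma regular_on_power:
  assumes "i \<in> I" "openin (zariski X) U" "f \<in> regular_on X U"
  shows "openin (zariski (power_fspace I X)) {p \<in> I \<rightarrow>\<^sub>E points X. p i \<in> U} \<and>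
      (\<lambda>p. f (p i)) \<in> regular_on (power_fspace I X) {p \<in> I \<rightarrow>\<^sub>E points X. p i \<in> U}"
proof -
  let ?G = "{({p \<in> I \<rightarrow>\<^sub>E points X. p i \<in> U}, \<lambda>p. f (p i)) | i U f.
        i \<in> I \<and> openin (zariski X) U \<and> f \<in> regular_on X U}"
  let ?U = "{p \<in> I \<rightarrow>\<^sub>E points X. p i \<in> U}"
  let ?X = "power_fspace I X"
  have G: "(?U, \<lambda>p. f (p i)) \<in> ?G" using assms by blast
  note gr = generator_regular[of _ _ ?G "I \<rightarrow>\<^sub>E points X" "points ?X",
      OF G power_generator_subset, folded power_fspace_def, unfolded open_sub_points]
  have U: "?U \<inter> points ?X = ?U" unfolding points_power_fspace by auto
  show ?thesis using gr unfolding U by (rule conjI)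
qed

lemma regular_on_proj:
  "openin (zariski (open_sub (proj_fspace co) S)) ({p \<in> proj_points co. \<forall>x\<in>p. co j x \<noteq> 0} \<inter> S)"
  "coord_ratio co i j \<in> regular_on (open_sub (proj_fspace co) S)
     ({p \<in> proj_points co. \<forall>x\<in>p. co j x \<noteq> 0} \<inter> S)"
proof -
  let ?G = "{({p \<in> proj_points co. \<forall>x\<in>p. co j x \<noteq> 0}, coord_ratio co i j) | i j. True}"
  have "({p \<in> proj_points co. \<forall>x\<in>p. co j x \<noteq> 0}, coord_ratio co i j) \<in> ?G" by blast
  note gr = generator_regular[of _ _ ?G "proj_points co" S, OF this proj_generator_subset, folded proj_fspace_def]
  show "openin (zariski (open_sub (proj_fspace co) S)) ({p \<in> proj_points co. \<forall>x\<in>p. co j x \<noteq> 0} \<inter> S)"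
    "coord_ratio co i j \<in> regular_on (open_sub (proj_fspace co) S)
     ({p \<in> proj_points co. \<forall>x\<in>p. co j x \<noteq> 0} \<inter> S)" by (rule gr(1), assumption) (rule gr(2), assumption)
qed

lemma regular_on_affine:
  assumes "i < m"
  shows "(\<lambda>x. x i) \<in> regular_on (affine_sub m Z) Z"
proof -
  let ?G = "{(Z, \<lambda>x. x i :: 'a) | i. i < m}"
  have G: "(Z, \<lambda>x. x i) \<in> ?G" using assms by blast
  have "(\<lambda>x. x i) \<in> regular_on (open_sub (generated Z ?G) (points (generated Z ?G))) (Z \<inter> points (generated Z ?G))"
    by (rule generator_regular(2)[OF G affine_generator_subset])
  then show ?thesis unfolding affine_sub_def[symmetric] open_sub_points points_affine_sub by simp
qed

lemma openin_affine: "openin (zariski (affine_sub m Z)) Z"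
  using points_affine_sub[of m Z] openin_topspace[of "zariski (affine_sub m Z)"] by (simp add: points_def)

text \<open>The diagonal is the common zero set of the functions \<open>x\<^sub>i - y\<^sub>i\<close>.\<close>

lemma separated_affine:
  assumes "Z \<subseteq> affine_points m"
  shows "separated (affine_sub m Z)"
proof -
  let ?A = "affine_sub m Z"
  let ?P = "prod_fspace ?A ?A"
  have pts: "points ?P = Z \<times> Z" by (simp add: points_prod_fspace points_affine_sub)
  have P: "open_sub ?P (Z \<times> Z) = ?P" using open_sub_points[of ?P] pts by simp
  have L: "locally_ringed ?P" using locally_ringed_open_sub_prod[of ?A ?A "Z \<times> Z"] P by simp
  have o: "openin (zariski ?P) (Z \<times> Z)" using pts openin_topspace[of "zariski ?P"] by (simp add: points_def)
  have "openin (zariski ?P) {z \<in> Z \<times> Z. fst z i - snd z i \<noteq> 0}" if "i < m" for i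
  proof (rule locally_ringedD(2)[OF L o])
    have "(\<lambda>z. fst z i) \<in> regular_on ?P (Z \<times> Z)" "(\<lambda>z. snd z i) \<in> regular_on ?P (Z \<times> Z)"
      using regular_on_prod(1)[of ?A Z, OF openin_affine regular_on_affine[OF that], where S = "Z \<times> Z" and Y = ?A]
        regular_on_prod(2)[of ?A Z, OF openin_affine regular_on_affine[OF that], where S = "Z \<times> Z" and X = ?A]
      by (simp_all add: points_affine_sub)
    then show "(\<lambda>z. fst z i - snd z i) \<in> regular_on ?P (Z \<times> Z)"
      by (rule regular_on_diff[OF locally_ringedD(1)[OF L] o])
  qed
  then have "openin (zariski ?P) (\<Union>i\<in>{..<m}. {z \<in> Z \<times> Z. fst z i - snd z i \<noteq> 0})" by blast
  moreover have "(\<Union>i\<in>{..<m}. {z \<in> Z \<times> Z. fst z i - snd z i \<noteq> 0}) = Z \<times> Z - {(x, x) | x. x \<in> Z}"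
  proof -
    have "x = y" if "x \<in> Z" "y \<in> Z" "\<And>i. i < m \<Longrightarrow> x i = y i" for x y
      using that assms by (intro PiE_ext[of x "{..<m}" "\<lambda>_. UNIV" y]) (auto simp: affine_points_def)
    then show ?thesis by fastforce
  qed
  ultimately show ?thesis
    unfolding separated_def closedin_def points_affine_sub using pts by (auto simp: points_def)
qed

lemma variety_affine:
  fixes Z :: "(nat \<Rightarrow> 'k::alg_closed_field) set"
  assumes "closedin (zariski (affine_sub m (affine_points m))) Z"
  shows "variety (affine_sub m Z)"
proof -
  let ?A = "affine_sub m Z"
  have Z: "Z \<subseteq> affine_points m"
    using closedin_subset[OF assms] points_affine_sub[of m "affine_points m :: (nat \<Rightarrow> 'k) set"] by (simp add: points_def)
  have sub: "{x. x \<in> points ?A \<and> x \<in> V} = V" if "openin (zariski ?A) V" for V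
    using openin_subset[OF that] by (auto simp: points_def)
  have "morphism ?A ?A id"
    unfolding morphism_def by (auto simp: sub)
  then have "isomorphism (open_sub ?A Z) ?A id"
    using open_sub_points[of ?A] unfolding isomorphism_def points_affine_sub
    by (intro conjI exI[of _ id]) simp_all
  with assms openin_affine
  have "openin (zariski ?A) Z \<and> (\<exists>m Y \<phi>. closedin (zariski (affine_sub m (affine_points m))) Y \<and>
      isomorphism (open_sub ?A Z) (affine_sub m Y) \<phi>)"
    by (intro conjI exI[of _ m] exI[of _ Z] exI[of _ id])
  then have "prevariety ?A"
    unfolding prevariety_def using locally_ringedD(1)[OF locally_ringed_affine]
    by (intro conjI exI[of _ "{Z}"]) (simp_all add: points_affine_sub)
  then show ?thesis using separated_affine[OF Z] by (simp add: variety_def)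
qed

section \<open>Determinants, lines and cross-ratios\<close>

abbreviation pt :: "('k::field)^'n \<Rightarrow> ('k^'n) set" where
  "pt \<equiv> proj_class vec_coord"

text \<open>Written out as a polynomial, so that determinant identities are settled by ring
  normalisation.\<close>

definition det3 :: "('k::comm_ring_1)^3 \<Rightarrow> 'k^3 \<Rightarrow> 'k^3 \<Rightarrow> 'k" where
  "det3 a b c = a$1 * b$2 * c$3 - a$1 * b$3 * c$2 - a$2 * b$1 * c$3 + a$2 * b$3 * c$1
     + a$3 * b$1 * c$2 - a$3 * b$2 * c$1"

text \<open>The cross product: the coefficients of the line through two points.\<close>

definition cross :: "('k::comm_ring_1)^3 \<Rightarrow> 'k^3 \<Rightarrow> 'k^3" where
  "cross a b = vector [a$2 * b$3 - a$3 * b$2, a$3 * b$1 - a$1 * b$3, a$1 * b$2 - a$2 * b$1]"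

lemmas vec3_simps = vec_eq_iff forall_3 sum_3 vector_3 det3_def cross_def

lemma pt_iff: "y \<in> pt x \<longleftrightarrow> (\<exists>c. c \<noteq> 0 \<and> y = c *s x)"
  by (auto simp: proj_class_def vec_coord_def vec_eq_iff)

lemma pt_eq_iff: "pt x = pt y \<longleftrightarrow> (\<exists>c. c \<noteq> 0 \<and> x = c *s y)"
proof
  assume "pt x = pt y"
  then show "\<exists>c. c \<noteq> 0 \<and> x = c *s y" using proj_class_self[of x vec_coord] pt_iff[of x y] by simp
next
  assume "\<exists>c. c \<noteq> 0 \<and> x = c *s y"
  then obtain c where "c \<noteq> 0" "x = c *s y" by blast
  then show "pt x = pt y" by (intro proj_class_eqI[of c]) (auto simp: vec_coord_def)
qed

lemma pt_smult: "c \<noteq> 0 \<Longrightarrow> pt (c *s x) = pt x"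
  by (auto simp: pt_eq_iff)

lemma proj_points_vec: "p \<in> proj_points vec_coord \<longleftrightarrow> (\<exists>x. x \<noteq> 0 \<and> p = pt x)"
  by (auto simp: proj_points_def vec_coord_def vec_eq_iff)

lemma det3_smult: "det3 (r *s a) (s *s b) (t *s c) = r * s * t * det3 a b c"
  by (simp add: det3_def algebra_simps)

lemma det3_nonzero_vectors:
  assumes "det3 a b c \<noteq> 0"
  shows "a \<noteq> 0" "b \<noteq> 0" "c \<noteq> 0"
  using assms by (auto simp: det3_def)

lemma cramer: "det3 a b c *s u = det3 u b c *s a + det3 a u c *s b + det3 a b u *s c"
  by (simp add: vec3_simps algebra_simps)

lemma cramer_div:
  fixes a b c u :: "('k::field)^3"
  assumes "det3 a b c \<noteq> 0"
  shows "u = (det3 u b c / det3 a b c) *s a + (det3 a u c / det3 a b c) *s b + (det3 a b u / det3 a b c) *s c"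
proof -
  have "u = inverse (det3 a b c) *s (det3 a b c *s u)" using assms by (simp add: vector_smult_assoc)
  then show ?thesis unfolding cramer[of a b c u] using assms
    by (simp add: vector_add_ldistrib vector_smult_assoc divide_inverse mult.commute)
qed

text \<open>Up to the determinant, the three cross products are the basis dual to \<open>a\<close>,
  \<open>b\<close>, \<open>c\<close>, so a linear form \<open>n\<close> is recovered from its values
  on these vectors.\<close>

lemma cramer_dual:
  "det3 a b c *s n = (\<Sum>i\<in>UNIV. n$i * c$i) *s cross a b + (\<Sum>i\<in>UNIV. n$i * a$i) *s cross b c +
     (\<Sum>i\<in>UNIV. n$i * b$i) *s cross c a"
  by (simp add: vec3_simps) (simp add: algebra_simps)

lemma det3_cross: "det3 a b c = (\<Sum>i\<in>UNIV. cross a b $ i * c $ i)"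
  by (simp add: vec3_simps algebra_simps)

lemma det3_eq_det: "det3 a b c = det (vector [a, b, c] :: ('k::comm_ring_1)^3^3)"
  by (simp add: det_3 det3_def algebra_simps)

section \<open>Collinearity, lines and their intersections\<close>

lemma plane_line_iff:
  assumes "x \<noteq> 0"
  shows "pt x \<in> plane_line n \<longleftrightarrow> (\<Sum>i\<in>UNIV. n$i * x$i) = 0"
proof
  assume "pt x \<in> plane_line n"
  then show "(\<Sum>i\<in>UNIV. n$i * x$i) = 0"
    using proj_class_self[of x vec_coord] by (simp add: plane_line_def)
next
  assume *: "(\<Sum>i\<in>UNIV. n$i * x$i) = 0"
  have "(\<Sum>i\<in>UNIV. n$i * y$i) = 0" if "y \<in> pt x" for y
  proof -
    obtain c where "y = c *s x" using \<open>y \<in> pt x\<close> pt_iff by blast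
    then have "(\<Sum>i\<in>UNIV. n$i * y$i) = c * (\<Sum>i\<in>UNIV. n$i * x$i)"
      by (simp add: sum_distrib_left algebra_simps)
    then show ?thesis using * by simp
  qed
  then show "pt x \<in> plane_line n" using assms by (auto simp: plane_line_def proj_points_vec)
qed

lemma plane_line_smult:
  fixes n :: "('k::field)^3"
  assumes "c \<noteq> 0"
  shows "plane_line (c *s n) = plane_line n"
proof -
  have "(\<Sum>i\<in>UNIV. (c *s n)$i * x$i) = c * (\<Sum>i\<in>UNIV. n$i * x$i)" for x :: "'k^3"
    by (simp add: sum_distrib_left algebra_simps)
  then show ?thesis using assms by (simp add: plane_line_def)
qed

lemma collinear_iff:
  fixes a b c :: "('k::field)^3"
  assumes "a \<noteq> 0" "b \<noteq> 0" "c \<noteq> 0"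
  shows "collinear_points {pt a, pt b, pt c} \<longleftrightarrow> det3 a b c = 0"
proof
  assume "collinear_points {pt a, pt b, pt c}"
  then obtain n where n: "n \<noteq> 0" "pt a \<in> plane_line n" "pt b \<in> plane_line n" "pt c \<in> plane_line n"
    by (auto simp: collinear_points_def plane_lines_def)
  then have "det3 a b c *s n = 0"
    unfolding cramer_dual using assms by (simp add: plane_line_iff)
  then show "det3 a b c = 0" using n(1) by (simp add: vector_mul_eq_0)
next
  assume "det3 a b c = 0"
  \<comment> \<open>The equation of a common line is a kernel vector of the matrix with rows
    \<open>a\<close>, \<open>b\<close>, \<open>c\<close>.\<close>
  then have "\<not> invertible (vector [a, b, c] :: 'k^3^3)" by (simp add: invertible_det_nz det3_eq_det)
  then obtain n where n: "n \<noteq> 0" "(vector [a, b, c] :: 'k^3^3) *v n = 0"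
    unfolding invertible_left_inverse matrix_left_invertible_ker by blast
  have "(\<Sum>i\<in>UNIV. n$i * x$i) = 0" if "x \<in> {a, b, c}" for x
    using that n(2) by (auto simp: vec3_simps matrix_vector_mult_def mult.commute)
  then have "{pt a, pt b, pt c} \<subseteq> plane_line n" using assms by (simp add: plane_line_iff)
  then show "collinear_points {pt a, pt b, pt c}"
    using n(1) by (auto simp: collinear_points_def plane_lines_def)
qed

text \<open>The vector \<open>r\<close> witnesses the independence of \<open>p\<close> and
  \<open>q\<close>. The equation of a line through both vanishes on them, so
  \<open>cramer_dual\<close> leaves a multiple of \<open>cross p q\<close>.\<close>

lemma line_through_eq:
  fixes p q r :: "('k::field)^3"
  assumes D: "det3 p q r \<noteq> 0"
  shows "line_through (pt p) (pt q) = plane_line (cross p q)"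
  unfolding line_through_def
proof (rule the_equality)
  note nz = det3_nonzero_vectors[OF D]
  have c0: "cross p q \<noteq> 0" using D by (auto simp: det3_cross)
  then show "plane_line (cross p q) \<in> plane_lines \<and> pt p \<in> plane_line (cross p q) \<and> pt q \<in> plane_line (cross p q)"
    using nz by (auto simp: plane_lines_def plane_line_iff vec3_simps algebra_simps)
  fix L assume "L \<in> plane_lines \<and> pt p \<in> L \<and> pt q \<in> L"
  then obtain n where n: "n \<noteq> 0" "L = plane_line n" "pt p \<in> plane_line n" "pt q \<in> plane_line n"
    by (auto simp: plane_lines_def)
  let ?t = "\<Sum>i\<in>UNIV. n$i * r$i"
  have e: "det3 p q r *s n = ?t *s cross p q"
    using n nz unfolding cramer_dual by (simp add: plane_line_iff)
  then have "?t \<noteq> 0" using D n(1) by (auto simp: vector_mul_eq_0)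
  then show "L = plane_line (cross p q)"
    using arg_cong[OF e, of plane_line] D n(2) by (simp add: plane_line_smult)
qed

lemma mem_line_through:
  assumes "det3 p q r \<noteq> 0" "u \<noteq> 0"
  shows "pt u \<in> line_through (pt p) (pt q) \<longleftrightarrow> det3 p q u = 0"
  unfolding line_through_eq[OF assms(1)] plane_line_iff[OF assms(2)]
  by (simp add: vec3_simps algebra_simps)

text \<open>\<open>m\<close> is the combination of \<open>p\<close> and \<open>q\<close> for which
  \<open>det3 m r s\<close> vanishes. The vectors \<open>x\<close> and \<open>y\<close> witness that
  both lines are determined, and \<open>nz\<close> that they differ.\<close>

lemma meet_point_eq:
  fixes p q r s x y :: "('k::field)^3"
  assumes x: "det3 p q x \<noteq> 0" and y: "det3 r s y \<noteq> 0" and nz: "det3 p r s \<noteq> 0 \<or> det3 q r s \<noteq> 0"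
  defines "m \<equiv> det3 q r s *s p - det3 p r s *s q"
  shows "meet_point (line_through (pt r) (pt s)) (line_through (pt p) (pt q)) = pt m"
  unfolding meet_point_def
proof (rule the_equality)
  have "det3 p m x = - det3 p r s * det3 p q x" "det3 m q x = det3 q r s * det3 p q x"
    by (simp_all add: m_def det3_def algebra_simps)
  then have m0: "m \<noteq> 0" using nz x det3_nonzero_vectors(1)[of m q x] det3_nonzero_vectors(2)[of p m x]
    by auto
  have "det3 p q m = 0" "det3 r s m = 0" by (simp_all add: m_def det3_def algebra_simps)
  then show "pt m \<in> line_through (pt r) (pt s) \<and> pt m \<in> line_through (pt p) (pt q)"
    using mem_line_through[OF x m0] mem_line_through[OF y m0] by simp
  fix l assume l: "l \<in> line_through (pt r) (pt s) \<and> l \<in> line_through (pt p) (pt q)"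
  then have "l \<in> P2" unfolding line_through_eq[OF x] by (simp add: plane_line_def)
  then obtain u where u: "u \<noteq> 0" "l = pt u" by (auto simp: proj_points_vec)
  have d: "det3 p q u = 0" "det3 r s u = 0"
    using l u mem_line_through[OF x u(1)] mem_line_through[OF y u(1)] by simp_all
  define \<alpha> \<beta> where "\<alpha> = det3 u q x / det3 p q x" and "\<beta> = det3 p u x / det3 p q x"
  have u': "u = \<alpha> *s p + \<beta> *s q" using cramer_div[OF x, of u] d(1) by (simp add: \<alpha>_def \<beta>_def)
  have "det3 r s u = \<alpha> * det3 p r s + \<beta> * det3 q r s"
    by (simp add: u' det3_def algebra_simps)
  then have ab: "\<alpha> * det3 p r s = - \<beta> * det3 q r s" using d(2) by (simp add: eq_neg_iff_add_eq_0)
  have "\<exists>c. u = c *s m"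
  proof (cases "det3 p r s = 0")
    case True
    then have "\<beta> = 0" "det3 q r s \<noteq> 0" using ab nz by auto
    then have "u = (\<alpha> / det3 q r s) *s m" using True by (simp add: u' m_def vector_smult_assoc)
    then show ?thesis by blast
  next
    case False
    then have \<alpha>: "\<alpha> = - \<beta> * det3 q r s / det3 p r s" using ab by (simp add: field_simps)
    have "u = (- \<beta> / det3 p r s) *s m"
      unfolding u' m_def \<alpha> using False by (simp add: vec_eq_iff field_simps)
    then show ?thesis by blast
  qed
  then obtain c where "u = c *s m" by blast
  moreover from this have "c \<noteq> 0" using u(1) by auto
  ultimately show "l = pt m" using u(2) by (simp add: pt_smult)
qed

section \<open>Cross-ratios and corner invariants as quotients of determinants\<close>

lemma infinite_UNIV_alg_closed: "infinite (UNIV :: 'k::alg_closed_field set)"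
proof
  assume fin: "finite (UNIV :: 'k set)"
  \<comment> \<open>As in Euclid's argument, the product with all field elements as roots, increased
    by \<open>1\<close>, has no root.\<close>
  let ?p = "(\<Prod>a\<in>(UNIV :: 'k set). [:- a, 1:]) + 1"
  have "degree (\<Prod>a\<in>(UNIV :: 'k set). [:- a, 1:]) = card (UNIV :: 'k set)"
    by (subst degree_prod_sum_eq) auto
  moreover have "card (UNIV :: 'k set) > 0" using fin by (simp add: card_gt_0_iff)
  ultimately have "degree ?p > 0" by (subst degree_add_eq_left) auto
  then obtain x where "poly ?p x = 0" using alg_closed_imp_poly_has_root by blast
  moreover have "poly (\<Prod>a\<in>(UNIV :: 'k set). [:- a, 1:]) x = 0"
    using fin by (simp add: poly_prod)
  ultimately show False by simp
qed

text \<open>The definition of \<open>cross_ratio\<close> needs a coordinate in which no point is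
  zero or infinite. It exists because the field is infinite, and its choice is irrelevant because
  each point occurs once in the numerator and once in the denominator.\<close>

lemma cross_ratio_eq:
  fixes A B w :: "('k::alg_closed_field)^3"
  assumes D: "det3 A B w \<noteq> 0"
    and nz: "\<alpha>1 * \<beta>3 - \<alpha>3 * \<beta>1 \<noteq> 0" "\<alpha>2 * \<beta>4 - \<alpha>4 * \<beta>2 \<noteq> 0"
  shows "cross_ratio (pt (\<alpha>1 *s A + \<beta>1 *s B)) (pt (\<alpha>2 *s A + \<beta>2 *s B))
      (pt (\<alpha>3 *s A + \<beta>3 *s B)) (pt (\<alpha>4 *s A + \<beta>4 *s B)) =
    ((\<alpha>1 * \<beta>2 - \<alpha>2 * \<beta>1) * (\<alpha>3 * \<beta>4 - \<alpha>4 * \<beta>3)) /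
    ((\<alpha>1 * \<beta>3 - \<alpha>3 * \<beta>1) * (\<alpha>2 * \<beta>4 - \<alpha>4 * \<beta>2))"
  unfolding cross_ratio_def
proof (rule the_equality)
  let ?c = "((\<alpha>1 * \<beta>2 - \<alpha>2 * \<beta>1) * (\<alpha>3 * \<beta>4 - \<alpha>4 * \<beta>3)) /
    ((\<alpha>1 * \<beta>3 - \<alpha>3 * \<beta>1) * (\<alpha>2 * \<beta>4 - \<alpha>4 * \<beta>2))"
  let ?B = "{\<beta>1 / \<alpha>1, \<beta>2 / \<alpha>2, \<beta>3 / \<alpha>3, \<beta>4 / \<alpha>4}"
  have uniq: "c = ?c" if "\<exists>e f t1 t2 t3 t4.
     e \<noteq> 0 \<and> f \<noteq> 0 \<and> pt e \<noteq> pt f \<and> t1 \<noteq> 0 \<and> t2 \<noteq> 0 \<and> t3 \<noteq> 0 \<and> t4 \<noteq> 0 \<and>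
     pt (\<alpha>1 *s A + \<beta>1 *s B) = pt (t1 *s e + f) \<and> pt (\<alpha>2 *s A + \<beta>2 *s B) = pt (t2 *s e + f) \<and>
     pt (\<alpha>3 *s A + \<beta>3 *s B) = pt (t3 *s e + f) \<and> pt (\<alpha>4 *s A + \<beta>4 *s B) = pt (t4 *s e + f) \<and>
     c = ((t1 - t2) * (t3 - t4)) / ((t1 - t3) * (t2 - t4))" for c
  proof -
    from that obtain e f t1 t2 t3 t4 where
      "pt (\<alpha>1 *s A + \<beta>1 *s B) = pt (t1 *s e + f)" "pt (\<alpha>2 *s A + \<beta>2 *s B) = pt (t2 *s e + f)"
      "pt (\<alpha>3 *s A + \<beta>3 *s B) = pt (t3 *s e + f)" "pt (\<alpha>4 *s A + \<beta>4 *s B) = pt (t4 *s e + f)"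
      and c: "c = ((t1 - t2) * (t3 - t4)) / ((t1 - t3) * (t2 - t4))" by blast
    then obtain s1 s2 s3 s4 where s: "s1 \<noteq> 0" "s2 \<noteq> 0" "s3 \<noteq> 0" "s4 \<noteq> 0"
      and P: "\<alpha>1 *s A + \<beta>1 *s B = s1 *s (t1 *s e + f)" "\<alpha>2 *s A + \<beta>2 *s B = s2 *s (t2 *s e + f)"
        "\<alpha>3 *s A + \<beta>3 *s B = s3 *s (t3 *s e + f)" "\<alpha>4 *s A + \<beta>4 *s B = s4 *s (t4 *s e + f)"
      unfolding pt_eq_iff by blast
    let ?E = "det3 e f w"
    \<comment> \<open>Adjoining the fixed vector \<open>w\<close> turns the minors into
      determinants, which can be computed in both coordinate systems.\<close>
    have d: "det3 (a *s A + b *s B) (a' *s A + b' *s B) w = (a * b' - a' * b) * det3 A B w"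
      "det3 (s *s (t *s e + f)) (s' *s (t' *s e + f)) w = s * s' * (t - t') * ?E" for a b a' b' s s' t t'
      by (simp_all add: det3_def algebra_simps)
    have "(\<alpha>1 * \<beta>2 - \<alpha>2 * \<beta>1) * det3 A B w = s1 * s2 * (t1 - t2) * ?E"
      "(\<alpha>3 * \<beta>4 - \<alpha>4 * \<beta>3) * det3 A B w = s3 * s4 * (t3 - t4) * ?E"
      "(\<alpha>1 * \<beta>3 - \<alpha>3 * \<beta>1) * det3 A B w = s1 * s3 * (t1 - t3) * ?E"
      "(\<alpha>2 * \<beta>4 - \<alpha>4 * \<beta>2) * det3 A B w = s2 * s4 * (t2 - t4) * ?E"
      by (simp_all only: d(1)[symmetric] P, simp_all only: d(2))
    moreover have "x = y * (?E / det3 A B w)" if "x * det3 A B w = y * ?E" for x y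
      using that D by (simp add: field_simps)
    ultimately have k12: "\<alpha>1 * \<beta>2 - \<alpha>2 * \<beta>1 = s1 * s2 * (t1 - t2) * (?E / det3 A B w)"
      "\<alpha>3 * \<beta>4 - \<alpha>4 * \<beta>3 = s3 * s4 * (t3 - t4) * (?E / det3 A B w)"
      and k: "\<alpha>1 * \<beta>3 - \<alpha>3 * \<beta>1 = s1 * s3 * (t1 - t3) * (?E / det3 A B w)"
      "\<alpha>2 * \<beta>4 - \<alpha>4 * \<beta>2 = s2 * s4 * (t2 - t4) * (?E / det3 A B w)"
      by blast+
    have K: "?E / det3 A B w \<noteq> 0" using nz k by auto
    \<comment> \<open>Each scaling \<open>s1\<close>, ..., \<open>s4\<close> occurs once above and
      once below, the factor \<open>K\<close> of the change of basis twice.\<close>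
    have "p * q / (x * y) = (s1 * s2 * p * K * (s3 * s4 * q * K)) / (s1 * s3 * x * K * (s2 * s4 * y * K))"
      if "K \<noteq> 0" for p q x y K
    proof -
      have "(s1 * s2 * p * K * (s3 * s4 * q * K)) / (s1 * s3 * x * K * (s2 * s4 * y * K)) =
          ((s1 * s2 * s3 * s4 * K * K) * (p * q)) / ((s1 * s2 * s3 * s4 * K * K) * (x * y))"
        by (simp only: mult_ac)
      moreover have "s1 * s2 * s3 * s4 * K * K \<noteq> 0" using s that by simp
      ultimately show ?thesis by (metis nonzero_mult_divide_mult_cancel_left)
    qed
    from this[OF K, of "t1 - t2" "t3 - t4" "t1 - t3" "t2 - t4"] show ?thesis
      unfolding c k12 k .
  qed
  \<comment> \<open>\<open>f\<close> becomes the origin and \<open>e\<close> the infinite point, so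
    \<open>r\<close> and \<open>s\<close> must be distinct and avoid the ratios of the four points.
    If some \<alpha> is zero, its ratio is \<open>0\<close> by the convention on division, which
    merely excludes one more value.\<close>
  have "finite ?B" "finite (insert r ?B)" for r by blast+
  then obtain r s where r: "r \<notin> ?B" and s: "s \<notin> insert r ?B"
    using ex_new_if_finite[OF infinite_UNIV_alg_closed] by meson
  define e f where "e = A + s *s B" and "f = A + r *s B"
  have "det3 e f w = (r - s) * det3 A B w" by (simp add: e_def f_def det3_def algebra_simps)
  then have E: "det3 e f w \<noteq> 0" using D s by auto
  have ef: "e \<noteq> 0" "f \<noteq> 0" using det3_nonzero_vectors[OF E] by simp_all
  have "pt e \<noteq> pt f"
  proof
    assume "pt e = pt f"
    then obtain c where "e = c *s f" by (auto simp: pt_eq_iff)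
    then have "det3 e f w = 0" by (simp add: det3_def algebra_simps)
    then show False using E by simp
  qed
  have ex: "\<exists>t. t \<noteq> 0 \<and> pt (\<alpha> *s A + \<beta> *s B) = pt (t *s e + f)"
    if "\<alpha> \<noteq> 0 \<or> \<beta> \<noteq> 0" "r \<noteq> \<beta> / \<alpha>" "s \<noteq> \<beta> / \<alpha>" for \<alpha> \<beta>
  proof -
    have rs: "r - s \<noteq> 0" "s - r \<noteq> 0" using s by auto
    \<comment> \<open>The solution of \<open>u + w = \<alpha>\<close> and
      \<open>u * s + w * r = \<beta>\<close>, that is, the change of basis from \<open>A\<close>,
      \<open>B\<close> to \<open>e\<close>, \<open>f\<close>.\<close>
    define u w where "u = (\<beta> - r * \<alpha>) / (s - r)" and "w = (\<beta> - s * \<alpha>) / (r - s)"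
    have nz: "\<beta> - r * \<alpha> \<noteq> 0" "\<beta> - s * \<alpha> \<noteq> 0" using that by (auto simp: divide_simps split: if_splits)
    then have uw: "u \<noteq> 0" "w \<noteq> 0" using rs by (simp_all add: u_def w_def)
    have w': "w = - (\<beta> - s * \<alpha>) / (s - r)" using rs by (simp add: w_def divide_simps) (simp add: algebra_simps)
    have "u + w = \<alpha>" "u * s + w * r = \<beta>"
      unfolding u_def w' using rs by (simp_all add: divide_simps) (simp_all add: algebra_simps)
    then have "\<alpha> *s A + \<beta> *s B = u *s e + w *s f"
      by (auto simp: e_def f_def vec_eq_iff algebra_simps)
    also have "\<dots> = w *s ((u / w) *s e + f)" using uw by (simp add: vector_add_ldistrib vector_smult_assoc)
    finally have "pt (\<alpha> *s A + \<beta> *s B) = pt ((u / w) *s e + f)" using pt_smult[OF uw(2)] by metis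
    then show ?thesis using uw by (intro exI[of _ "u / w"]) simp
  qed
  have "\<alpha>1 \<noteq> 0 \<or> \<beta>1 \<noteq> 0" "\<alpha>2 \<noteq> 0 \<or> \<beta>2 \<noteq> 0" "\<alpha>3 \<noteq> 0 \<or> \<beta>3 \<noteq> 0" "\<alpha>4 \<noteq> 0 \<or> \<beta>4 \<noteq> 0" using nz by auto
  with ex[of \<alpha>1 \<beta>1] ex[of \<alpha>2 \<beta>2] ex[of \<alpha>3 \<beta>3] ex[of \<alpha>4 \<beta>4] r s obtain t1 t2 t3 t4 where t:
    "t1 \<noteq> 0" "pt (\<alpha>1 *s A + \<beta>1 *s B) = pt (t1 *s e + f)"
    "t2 \<noteq> 0" "pt (\<alpha>2 *s A + \<beta>2 *s B) = pt (t2 *s e + f)"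
    "t3 \<noteq> 0" "pt (\<alpha>3 *s A + \<beta>3 *s B) = pt (t3 *s e + f)"
    "t4 \<noteq> 0" "pt (\<alpha>4 *s A + \<beta>4 *s B) = pt (t4 *s e + f)" by auto
  have ex': "\<exists>c e f t1 t2 t3 t4.
     e \<noteq> 0 \<and> f \<noteq> 0 \<and> pt e \<noteq> pt f \<and> t1 \<noteq> 0 \<and> t2 \<noteq> 0 \<and> t3 \<noteq> 0 \<and> t4 \<noteq> 0 \<and>
     pt (\<alpha>1 *s A + \<beta>1 *s B) = pt (t1 *s e + f) \<and> pt (\<alpha>2 *s A + \<beta>2 *s B) = pt (t2 *s e + f) \<and>
     pt (\<alpha>3 *s A + \<beta>3 *s B) = pt (t3 *s e + f) \<and> pt (\<alpha>4 *s A + \<beta>4 *s B) = pt (t4 *s e + f) \<and>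
     c = ((t1 - t2) * (t3 - t4)) / ((t1 - t3) * (t2 - t4))"
    using ef \<open>pt e \<noteq> pt f\<close> t
    by (intro exI[of _ e] exI[of _ f] exI[of _ t1] exI[of _ t2] exI[of _ t3] exI[of _ t4]
        exI[of _ "((t1 - t2) * (t3 - t4)) / ((t1 - t3) * (t2 - t4))"] conjI refl)
  then obtain c where c: "\<exists>e f t1 t2 t3 t4.
     e \<noteq> 0 \<and> f \<noteq> 0 \<and> pt e \<noteq> pt f \<and> t1 \<noteq> 0 \<and> t2 \<noteq> 0 \<and> t3 \<noteq> 0 \<and> t4 \<noteq> 0 \<and>
     pt (\<alpha>1 *s A + \<beta>1 *s B) = pt (t1 *s e + f) \<and> pt (\<alpha>2 *s A + \<beta>2 *s B) = pt (t2 *s e + f) \<and>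
     pt (\<alpha>3 *s A + \<beta>3 *s B) = pt (t3 *s e + f) \<and> pt (\<alpha>4 *s A + \<beta>4 *s B) = pt (t4 *s e + f) \<and>
     c = ((t1 - t2) * (t3 - t4)) / ((t1 - t3) * (t2 - t4))" ..
  from c uniq[OF c]
  show "\<exists>e f t1 t2 t3 t4.
     e \<noteq> 0 \<and> f \<noteq> 0 \<and> pt e \<noteq> pt f \<and> t1 \<noteq> 0 \<and> t2 \<noteq> 0 \<and> t3 \<noteq> 0 \<and> t4 \<noteq> 0 \<and>
     pt (\<alpha>1 *s A + \<beta>1 *s B) = pt (t1 *s e + f) \<and> pt (\<alpha>2 *s A + \<beta>2 *s B) = pt (t2 *s e + f) \<and>
     pt (\<alpha>3 *s A + \<beta>3 *s B) = pt (t3 *s e + f) \<and> pt (\<alpha>4 *s A + \<beta>4 *s B) = pt (t4 *s e + f) \<and>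
     ?c = ((t1 - t2) * (t3 - t4)) / ((t1 - t3) * (t2 - t4))" by (simp only:)
  show "c = ?c" if "\<exists>e f t1 t2 t3 t4.
     e \<noteq> 0 \<and> f \<noteq> 0 \<and> pt e \<noteq> pt f \<and> t1 \<noteq> 0 \<and> t2 \<noteq> 0 \<and> t3 \<noteq> 0 \<and> t4 \<noteq> 0 \<and>
     pt (\<alpha>1 *s A + \<beta>1 *s B) = pt (t1 *s e + f) \<and> pt (\<alpha>2 *s A + \<beta>2 *s B) = pt (t2 *s e + f) \<and>
     pt (\<alpha>3 *s A + \<beta>3 *s B) = pt (t3 *s e + f) \<and> pt (\<alpha>4 *s A + \<beta>4 *s B) = pt (t4 *s e + f) \<and>
     c = ((t1 - t2) * (t3 - t4)) / ((t1 - t3) * (t2 - t4))" for c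
    using that by (rule uniq)
qed

text \<open>Three-term Pluecker relations turn the numerators into products.\<close>

lemma left_corner_eq:
  fixes a b c d e :: "('k::alg_closed_field)^3"
  assumes "v (i - 2) = pt a" "v (i - 1) = pt b" "v i = pt c" "v (i + 1) = pt d" "v (i + 2) = pt e"
    and abd: "det3 a b d \<noteq> 0" and acd: "det3 a c d \<noteq> 0" and bde: "det3 b d e \<noteq> 0"
  shows "left_corner v i = det3 a b d * det3 c d e / (det3 a c d * det3 b d e)"
proof -
  have cda: "det3 c d a \<noteq> 0" and deb: "det3 d e b \<noteq> 0" using acd bde by (simp_all add: det3_def algebra_simps)
  \<comment> \<open>Coordinates along the line through \<open>a\<close> and \<open>b\<close>, in
    which these points are \<open>(1, 0)\<close> and \<open>(0, 1)\<close>.\<close>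
  have "left_corner v i = cross_ratio (pt (1 *s a + 0 *s b)) (pt (0 *s a + 1 *s b))
    (pt (det3 b c d *s a + (- det3 a c d) *s b)) (pt (det3 b d e *s a + (- det3 a d e) *s b))"
    unfolding left_corner_def assms(1-5) meet_point_eq[OF abd cda disjI1[OF acd]]
      meet_point_eq[OF abd deb disjI2[OF bde]] by simp
  also have "\<dots> = ((1 * 1 - 0 * 0) * (det3 b c d * (- det3 a d e) - det3 b d e * (- det3 a c d))) /
     ((1 * (- det3 a c d) - det3 b c d * 0) * (0 * (- det3 a d e) - det3 b d e * 1))"
    by (rule cross_ratio_eq[OF abd]) (use acd bde in simp_all)
  also have "\<dots> = (det3 b d e * det3 a c d - det3 b c d * det3 a d e) / (det3 a c d * det3 b d e)" by simp
  also have "det3 b d e * det3 a c d - det3 b c d * det3 a d e = det3 a b d * det3 c d e"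
    by (simp add: det3_def algebra_simps)
  finally show ?thesis .
qed

lemma meet_point_commute: "meet_point L L' = meet_point L' L"
  by (simp add: meet_point_def conj_commute)

lemma right_corner_eq:
  fixes a b c d e :: "('k::alg_closed_field)^3"
  assumes "v (i - 2) = pt a" "v (i - 1) = pt b" "v i = pt c" "v (i + 1) = pt d" "v (i + 2) = pt e"
    and abd: "det3 a b d \<noteq> 0" and bce: "det3 b c e \<noteq> 0" and bde: "det3 b d e \<noteq> 0"
  shows "right_corner v i = det3 b d e * det3 a b c / (det3 b c e * det3 a b d)"
proof -
  have deb: "det3 d e b \<noteq> 0" and dab: "det3 d a b \<noteq> 0" and ebc: "det3 e b c \<noteq> 0"
    using abd bce bde by (simp_all add: det3_def algebra_simps)
  \<comment> \<open>Coordinates along the line through \<open>d\<close> and \<open>e\<close>. The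
    first intersection is commuted so that it too is expressed on this line.\<close>
  have "right_corner v i = cross_ratio (pt (det3 e a b *s d + (- det3 d a b) *s e))
    (pt (det3 e b c *s d + (- det3 d b c) *s e)) (pt (1 *s d + 0 *s e)) (pt (0 *s d + 1 *s e))"
    unfolding right_corner_def assms(1-5)
      meet_point_commute[of "line_through (pt d) (pt e)" "line_through (pt a) (pt b)"]
      meet_point_eq[OF deb abd disjI1[OF dab]] meet_point_eq[OF deb bce disjI2[OF ebc]] by simp
  also have "\<dots> = ((det3 e a b * (- det3 d b c) - det3 e b c * (- det3 d a b)) * (1 * 1 - 0 * 0)) /
     ((det3 e a b * 0 - 1 * (- det3 d a b)) * (det3 e b c * 1 - 0 * (- det3 d b c)))"
    by (rule cross_ratio_eq[OF deb]) (use dab ebc in simp_all)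
  also have "\<dots> = (det3 e b c * det3 d a b - det3 e a b * det3 d b c) / (det3 d a b * det3 e b c)" by simp
  also have "det3 e b c * det3 d a b - det3 e a b * det3 d b c = det3 b d e * det3 a b c"
    by (simp add: det3_def algebra_simps)
  also have "det3 d a b * det3 e b c = det3 b c e * det3 a b d" by (simp add: det3_def algebra_simps)
  finally show ?thesis .
qed

section \<open>Normalised lifts of twisted polygons\<close>

text \<open>Negative indices are reached by the inverses of the steps, hence the
  bijectivity.\<close>

lemma two_sided_sequence:
  fixes s :: "int \<Rightarrow> 'a \<Rightarrow> 'a"
  assumes "\<And>i. bij (s i)"
  obtains F where "F 0 = a" "\<And>i. F (i + 1) = s i (F i)"
proof -
  define P where "P = rec_nat a (\<lambda>k. s (int k))"
  define Q where "Q = rec_nat a (\<lambda>k. inv (s (- int k - 1)))"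
  define F where "F i = (if i \<ge> 0 then P (nat i) else Q (nat (- i)))" for i
  have "F 0 = a" by (simp add: F_def P_def)
  moreover have "F (i + 1) = s i (F i)" for i
  proof (cases "i \<ge> 0")
    case True
    then have "nat (i + 1) = Suc (nat i)" by simp
    then show ?thesis using True by (simp add: F_def P_def)
  next
    case False
    define k where "k = nat (- i - 1)"
    have i: "i = - int k - 1" using False by (simp add: k_def)
    have "Q (Suc k) = inv (s i) (Q k)" by (simp add: Q_def i)
    then have "s i (Q (Suc k)) = Q k" using assms[of i] by (simp add: bij_is_surj surj_f_inv_f)
    moreover have "F i = Q (Suc k)" by (simp add: F_def i nat_add_distrib)
    moreover have "F (i + 1) = Q k" by (cases k) (simp_all add: F_def i P_def Q_def nat_add_distrib)
    ultimately show ?thesis by simp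
  qed
  ultimately show thesis by (rule that)
qed

text \<open>Independence is asked for at one place only; it spreads in both directions as long as
  the last coefficient does not vanish.\<close>

definition corner_rec :: "(int \<Rightarrow> 'k::field) \<Rightarrow> (int \<Rightarrow> 'k) \<Rightarrow> (int \<Rightarrow> 'k^3) \<Rightarrow> bool" where
  "corner_rec x y V \<longleftrightarrow> det3 (V 1) (V 2) (V 3) \<noteq> 0 \<and>
     (\<forall>i. V (i + 3) = V (i + 2) - y (i + 1) *s V (i + 1) + (x (i + 1) * y (i + 1) * y i) *s V i)"

lemma corner_recD:
  assumes "corner_rec x y V"
  shows "V (i + 3) = V (i + 2) - y (i + 1) *s V (i + 1) + (x (i + 1) * y (i + 1) * y i) *s V i"
    and "V (i + 4) = V (i + 3) - y (i + 2) *s V (i + 2) + (x (i + 2) * y (i + 2) * y (i + 1)) *s V (i + 1)"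
proof -
  show r: "V (i + 3) = V (i + 2) - y (i + 1) *s V (i + 1) + (x (i + 1) * y (i + 1) * y i) *s V i" for i
    using assms by (simp add: corner_rec_def)
  show "V (i + 4) = V (i + 3) - y (i + 2) *s V (i + 2) + (x (i + 2) * y (i + 2) * y (i + 1)) *s V (i + 1)"
    using r[of "i + 1"] by (simp add: add.assoc)
qed

text \<open>Together with \<open>det3 a b c\<close> these are all triples of five consecutive
  vectors except \<open>a\<close>, \<open>c\<close>, \<open>e\<close>. When
  \<open>h' = x * g' * g\<close>, the factor \<open>g * g' - h'\<close> equals
  \<open>g * g' * (1 - x)\<close>.\<close>

lemma window_dets:
  fixes a b c :: "('k::field)^3"
  assumes "d = c - g *s b + h *s a" "e = d - g' *s c + h' *s b"
  shows "det3 a b d = det3 a b c" "det3 a c d = g * det3 a b c" "det3 b c d = h * det3 a b c"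
    "det3 a b e = (1 - g') * det3 a b c" "det3 a d e = (g * g' - h') * det3 a b c"
    "det3 b c e = h * det3 a b c" "det3 b d e = g' * h * det3 a b c" "det3 c d e = h * h' * det3 a b c"
  unfolding assms by (simp_all add: det3_def algebra_simps)

text \<open>Each step multiplies the determinant by the last coefficient of the recurrence, which is
  nonzero, so the induction runs both ways.\<close>

lemma corner_rec_det:
  assumes V: "corner_rec x y V" and nz: "\<And>i. x i \<noteq> 0" "\<And>i. y i \<noteq> 0"
  shows "det3 (V i) (V (i + 1)) (V (i + 2)) \<noteq> 0"
proof -
  have step: "det3 (V (i + 1)) (V (i + 2)) (V (i + 3)) =
      x (i + 1) * y (i + 1) * y i * det3 (V i) (V (i + 1)) (V (i + 2))" for i
    by (rule window_dets(3)[OF corner_recD[OF V]])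
  show ?thesis
  proof (induction i rule: int_induct[of _ 1])
    case base
    then show ?case using V by (simp add: corner_rec_def)
  next
    case (step1 i)
    then show ?case using step[of i] nz by (simp add: add.assoc)
  next
    case (step2 i)
    have i: "i - 1 + 1 = i" "i - 1 + 2 = i + 1" "i - 1 + 3 = i + 2" by simp_all
    have "x i * y i * y (i - 1) * det3 (V (i - 1)) (V i) (V (i + 1)) \<noteq> 0"
      using step2(2) unfolding step[of "i - 1", unfolded i] .
    then show ?case unfolding i by (metis mult_zero_right)
  qed
qed

text \<open>All determinants in the two formulas are multiples of the one at \<open>i - 2\<close>;
  after cancelling, the coefficients remain.\<close>

lemma corner_rec_corners:
  fixes x y :: "int \<Rightarrow> 'k::alg_closed_field"
  assumes V: "corner_rec x y V" and nz: "\<And>i. x i \<noteq> 0" "\<And>i. y i \<noteq> 0"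
    and v: "\<And>i. v i = pt (V i)"
  shows "left_corner v i = x i" "right_corner v i = y i"
proof -
  let ?a = "V (i - 2)" and ?b = "V (i - 1)" and ?c = "V i" and ?d = "V (i + 1)" and ?e = "V (i + 2)"
  have D: "det3 ?a ?b ?c \<noteq> 0" using corner_rec_det[OF V nz, of "i - 2"] by simp
  have i: "i - 2 + 1 = i - 1" "i - 2 + 2 = i" "i - 2 + 3 = i + 1" "i - 2 + 4 = i + 2" by simp_all
  have d: "?d = ?c - y (i - 1) *s ?b + (x (i - 1) * y (i - 1) * y (i - 2)) *s ?a"
    by (rule corner_recD(1)[OF V, of "i - 2", unfolded i])
  have e: "?e = ?d - y i *s ?c + (x i * y i * y (i - 1)) *s ?b"
    by (rule corner_recD(2)[OF V, of "i - 2", unfolded i])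
  note w = window_dets[OF d e]
  have "left_corner v i = det3 ?a ?b ?d * det3 ?c ?d ?e / (det3 ?a ?c ?d * det3 ?b ?d ?e)"
    by (rule left_corner_eq[OF v v v v v]) (use D nz in \<open>simp_all add: w\<close>)
  then show "left_corner v i = x i" using D nz by (simp add: w divide_simps)
  have "right_corner v i = det3 ?b ?d ?e * det3 ?a ?b ?c / (det3 ?b ?c ?e * det3 ?a ?b ?d)"
    by (rule right_corner_eq[OF v v v v v]) (use D nz in \<open>simp_all add: w\<close>)
  then show "right_corner v i = y i" using D nz by (simp add: w divide_simps)
qed

text \<open>The windows of five vertices move with \<open>i\<close>, so a triple may be anchored at
  its first vertex; five shapes remain.\<close>

lemma twisted_polygon_dets:
  fixes V :: "int \<Rightarrow> ('k::field)^3" and v :: "int \<Rightarrow> 'k plane_point"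
  assumes v: "\<And>i. v i = pt (V i)" and nz: "\<And>i. V i \<noteq> 0"
  shows "(\<forall>i a b c. i \<le> a \<and> a < b \<and> b < c \<and> c \<le> i + 4 \<and> (a, b, c) \<noteq> (i, i + 2, i + 4) \<longrightarrow>
        \<not> collinear_points {v a, v b, v c}) \<longleftrightarrow>
     (\<forall>i. det3 (V i) (V (i+1)) (V (i+2)) \<noteq> 0 \<and> det3 (V i) (V (i+1)) (V (i+3)) \<noteq> 0 \<and>
        det3 (V i) (V (i+1)) (V (i+4)) \<noteq> 0 \<and> det3 (V i) (V (i+2)) (V (i+3)) \<noteq> 0 \<and>
        det3 (V i) (V (i+3)) (V (i+4)) \<noteq> 0)"
    (is "?L \<longleftrightarrow> ?R")
proof
  assume L: ?L
  have col: "det3 (V a) (V b) (V c) \<noteq> 0"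
    if "i \<le> a" "a < b" "b < c" "c \<le> i + 4" "(a, b, c) \<noteq> (i, i + 2, i + 4)" for i a b c
    using L that collinear_iff[OF nz nz nz, of a b c] unfolding v by blast
  show ?R by (intro allI conjI; rule col) auto
next
  assume R: ?R
  show ?L
  proof (intro allI impI)
    fix i a b c :: int
    assume "i \<le> a \<and> a < b \<and> b < c \<and> c \<le> i + 4 \<and> (a, b, c) \<noteq> (i, i + 2, i + 4)"
    then have "b = a + 1 \<and> (c = a + 2 \<or> c = a + 3 \<or> c = a + 4) \<or>
        b = a + 2 \<and> c = a + 3 \<or> b = a + 3 \<and> c = a + 4" by auto
    then have "det3 (V a) (V b) (V c) \<noteq> 0" using spec[OF R, of a] by auto
    then show "\<not> collinear_points {v a, v b, v c}"
      using collinear_iff[OF nz nz nz, of a b c] unfolding v by blast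
  qed
qed

lemma twisted_polygon_iff:
  fixes V :: "int \<Rightarrow> ('k::field)^3" and v :: "int \<Rightarrow> 'k plane_point"
  assumes "\<And>i. v i = pt (V i)" "\<And>i. V i \<noteq> 0"
  shows "twisted_polygon n v \<longleftrightarrow> (\<exists>M. is_monodromy n v M) \<and>
     (\<forall>i. det3 (V i) (V (i+1)) (V (i+2)) \<noteq> 0 \<and> det3 (V i) (V (i+1)) (V (i+3)) \<noteq> 0 \<and>
        det3 (V i) (V (i+1)) (V (i+4)) \<noteq> 0 \<and> det3 (V i) (V (i+2)) (V (i+3)) \<noteq> 0 \<and>
        det3 (V i) (V (i+3)) (V (i+4)) \<noteq> 0)"
proof -
  have "\<forall>i. v i \<in> P2" using assms by (auto simp: proj_points_vec)
  then show ?thesis unfolding twisted_polygon_def twisted_polygon_dets[OF assms] by blast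
qed

lemma polygon_lift:
  assumes "twisted_polygon n v"
  obtains W where "\<And>i. v i = pt (W i)" "\<And>i. W i \<noteq> 0"
proof -
  have "\<forall>i. \<exists>x. x \<noteq> 0 \<and> v i = pt x" using assms by (auto simp: twisted_polygon_def proj_points_vec)
  then obtain W where "\<forall>i. W i \<noteq> 0 \<and> v i = pt (W i)" by metis
  then show thesis by (intro that[of W]) auto
qed

text \<open>\<open>V (i + 3) - V (i + 2)\<close> lies in the span of \<open>V i\<close> and
  \<open>V (i + 1)\<close> exactly when two determinants agree. This condition fixes only the ratio
  of the scalings at \<open>i + 3\<close> and \<open>i + 2\<close>, so the scalings can be chosen
  one after another. The coefficients of the resulting recurrence are then recognised as corner
  invariants.\<close>

lemma normalised_lift:
  fixes v :: "int \<Rightarrow> ('k::alg_closed_field) plane_point"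
  assumes tw: "twisted_polygon n v"
  obtains V where "\<And>i. v i = pt (V i)" "\<And>i. V i \<noteq> 0"
    "corner_rec (left_corner v) (right_corner v) V"
    "\<And>i. left_corner v i \<noteq> 0" "\<And>i. left_corner v i \<noteq> 1"
    "\<And>i. right_corner v i \<noteq> 0" "\<And>i. right_corner v i \<noteq> 1"
proof -
  obtain W where W: "\<And>i. v i = pt (W i)" "\<And>i. W i \<noteq> 0" using polygon_lift[OF tw] by blast
  define r where "r i = det3 (W i) (W (i+1)) (W (i+3)) / det3 (W i) (W (i+1)) (W (i+2))" for i
  have dW: "det3 (W i) (W (i+1)) (W (i+2)) \<noteq> 0" "det3 (W i) (W (i+1)) (W (i+3)) \<noteq> 0" for i
    using tw unfolding twisted_polygon_iff[OF W] by blast+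
  then have r0: "r i \<noteq> 0" for i by (simp add: r_def)
  have "bij (\<lambda>t. t / r (i - 2))" for i
    by (rule o_bij[of "\<lambda>t. t * r (i - 2)"]) (use r0 in auto)
  \<comment> \<open>The index \<open>i - 2\<close> makes \<open>r i\<close> the ratio of
    \<open>l (i + 2)\<close> to \<open>l (i + 3)\<close>, as \<open>norm\<close> requires.\<close>
  then obtain l where l: "l 0 = 1" "\<And>i. l (i + 1) = l i / r (i - 2)"
    using two_sided_sequence[of "\<lambda>i t. t / r (i - 2)" 1] by metis
  have l0: "l i \<noteq> 0" for i
  proof (induction i rule: int_induct[of _ 0])
    case (step2 i)
    then show ?case using l(2)[of "i - 1"] by auto
  qed (use l r0 in auto)
  define V where "V i = l i *s W i" for i
  have V: "v i = pt (V i)" "V i \<noteq> 0" for i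
    using W l0 by (auto simp: V_def pt_smult vector_mul_eq_0)
  have dV: "det3 (V i) (V (i+1)) (V (i+2)) \<noteq> 0" "det3 (V i) (V (i+2)) (V (i+3)) \<noteq> 0"
      "det3 (V i) (V (i+1)) (V (i+4)) \<noteq> 0" "det3 (V i) (V (i+3)) (V (i+4)) \<noteq> 0" for i
    using tw unfolding twisted_polygon_iff[OF V] by blast+
  have norm: "det3 (V i) (V (i+1)) (V (i+3)) = det3 (V i) (V (i+1)) (V (i+2))" for i
  proof -
    have "l (i + 3) = l (i + 2) / r i" using l(2)[of "i + 2"] by (simp add: add.assoc)
    then show ?thesis unfolding V_def det3_smult using r0[of i] dW[of i] by (simp add: r_def)
  qed
  \<comment> \<open>Coefficients by Cramer's rule; that of \<open>V (i + 2)\<close> is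
    \<open>1\<close> by \<open>norm\<close>.\<close>
  define g h where "g i = - det3 (V i) (V (i+3)) (V (i+2)) / det3 (V i) (V (i+1)) (V (i+2))"
    and "h i = det3 (V (i+3)) (V (i+1)) (V (i+2)) / det3 (V i) (V (i+1)) (V (i+2))" for i
  have rec: "V (i + 3) = V (i + 2) - g i *s V (i + 1) + h i *s V i" for i
    using cramer_div[OF dV(1), of "V (i + 3)" i] dV(1)[of i] unfolding norm
    by (simp add: g_def h_def algebra_simps)
  have rec': "V (i + 4) = V (i + 3) - g (i + 1) *s V (i + 2) + h (i + 1) *s V (i + 1)" for i
    using rec[of "i + 1"] by (simp add: add.assoc)
  note w = window_dets[OF rec rec']
  have g0: "g i \<noteq> 0" for i using dV(2)[of i] w(2)[of i] by auto
  have h0: "h i \<noteq> 0" for i using dV(1)[of "i + 1"] w(3)[of i] by (auto simp: add.assoc)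
  have g1: "1 - g (i + 1) \<noteq> 0" for i using dV(3)[of i] w(4)[of i] by auto
  have gh: "g i * g (i + 1) - h (i + 1) \<noteq> 0" for i using dV(4)[of i] w(5)[of i] by auto
  have vV: "v (i + 2 - 2) = pt (V i)" "v (i + 2 - 1) = pt (V (i + 1))" "v (i + 2) = pt (V (i + 2))"
      "v (i + 2 + 1) = pt (V (i + 3))" "v (i + 2 + 2) = pt (V (i + 4))" for i
    using V(1)[of i] V(1)[of "i + 1"] V(1)[of "i + 2"] V(1)[of "i + 3"] V(1)[of "i + 4"]
    by (simp_all add: add.commute add.left_commute)
  have x: "left_corner v (i + 2) = h (i + 1) / (g i * g (i + 1))" for i
  proof -
    have "left_corner v (i + 2) = det3 (V i) (V (i+1)) (V (i+3)) * det3 (V (i+2)) (V (i+3)) (V (i+4)) /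
        (det3 (V i) (V (i+2)) (V (i+3)) * det3 (V (i+1)) (V (i+3)) (V (i+4)))"
      by (rule left_corner_eq[OF vV]) (use dV(1)[of i] g0 h0 in \<open>simp_all add: w\<close>)
    then show ?thesis using dV(1)[of i] g0[of i] g0[of "i + 1"] h0[of i] by (simp add: w divide_simps)
  qed
  have y: "right_corner v (i + 2) = g (i + 1)" for i
  proof -
    have "right_corner v (i + 2) = det3 (V (i+1)) (V (i+3)) (V (i+4)) * det3 (V i) (V (i+1)) (V (i+2)) /
        (det3 (V (i+1)) (V (i+2)) (V (i+4)) * det3 (V i) (V (i+1)) (V (i+3)))"
      by (rule right_corner_eq[OF vV]) (use dV(1)[of i] g0 h0 in \<open>simp_all add: w\<close>)
    then show ?thesis using dV(1)[of i] h0[of i] by (simp add: w divide_simps)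
  qed
  have y': "right_corner v (i + 1) = g i" "right_corner v i = g (i - 1)" for i
    using y[of "i - 1"] y[of "i - 2"] by (simp_all add: algebra_simps)
  have x': "left_corner v (i + 1) = h i / (g (i - 1) * g i)" for i
    using x[of "i - 1"] by (simp add: algebra_simps)
  have "corner_rec (left_corner v) (right_corner v) V"
    unfolding corner_rec_def y' x' using rec dV(1)[of 1] g0 by simp
  moreover have "left_corner v i \<noteq> 0" "left_corner v i \<noteq> 1" for i
    using x[of "i - 2"] g0[of "i - 2"] g0[of "i - 1"] h0[of "i - 1"] gh[of "i - 2"] by simp_all
  moreover have "right_corner v i \<noteq> 0" "right_corner v i \<noteq> 1" for i
    using g0[of "i - 1"] g1[of "i - 2"] by (simp_all add: y')
  ultimately show thesis using V that by blast
qed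

text \<open>The state is a triple of consecutive vectors. Its successor map is invertible since the
  last coefficient can be divided out.\<close>

lemma corner_rec_exists:
  fixes x y :: "int \<Rightarrow> 'k::field"
  assumes nz: "\<And>i. x i \<noteq> 0" "\<And>i. y i \<noteq> 0" and D: "det3 a b c \<noteq> 0"
  obtains V where "corner_rec x y V" "V 1 = a" "V 2 = b" "V 3 = c"
proof -
  \<comment> \<open>\<open>F i\<close> will be the triple starting at \<open>V (i + 1)\<close>, so
    all indices are one higher than in \<open>corner_rec\<close>.\<close>
  define h where "h i = x (i + 2) * y (i + 2) * y (i + 1)" for i
  have h: "h i \<noteq> 0" for i using nz by (simp add: h_def)
  define s where "s i = (\<lambda>(a :: 'k^3, b, c). (b, c, c - y (i + 2) *s b + h i *s a))" for i
  have "bij (s i)" for i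
  proof (rule o_bij)
    let ?t = "\<lambda>(b :: 'k^3, c, d). (inverse (h i) *s (d - c + y (i + 2) *s b), b, c)"
    show "?t \<circ> s i = id" "s i \<circ> ?t = id"
      using h[of i] by (auto simp: s_def fun_eq_iff vector_smult_assoc)
  qed
  then obtain F where F: "F 0 = (a, b, c)" "\<And>i. F (i + 1) = s i (F i)"
    using two_sided_sequence[of s "(a, b, c)"] by blast
  define V where "V i = fst (F (i - 1))" for i
  have F1: "fst (F (i + 1)) = fst (snd (F i))" and F2: "fst (snd (F (i + 1))) = snd (snd (F i))"
    and F3: "snd (snd (F (i + 1))) = snd (snd (F i)) - y (i + 2) *s fst (snd (F i)) +
      (x (i + 2) * y (i + 2) * y (i + 1)) *s fst (F i)" for i
    by (simp_all add: F(2) s_def h_def case_prod_unfold)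
  have V: "V (i + 1) = fst (F i)" "V (i + 2) = fst (snd (F i))" "V (i + 3) = snd (snd (F i))"
      "V (i + 4) = snd (snd (F (i + 1)))" for i
    using F1[of i] F2[of i] F1[of "i + 1"] F1[of "i + 2"] F2[of "i + 1"]
    by (simp_all add: V_def algebra_simps)
  have ini: "V 1 = a" "V 2 = b" "V 3 = c" using V[of 0] by (simp_all add: F(1))
  have "V (i + 3) = V (i + 2) - y (i + 1) *s V (i + 1) + (x (i + 1) * y (i + 1) * y i) *s V i" for i
    using F3[of "i - 1"] V[of "i - 1"] by (simp add: algebra_simps)
  then have "corner_rec x y V" unfolding corner_rec_def ini using D by blast
  then show thesis using ini by (rule that)
qed

section \<open>The action of the projective linear group\<close>

abbreviation mpt :: "('k::field)^3^3 \<Rightarrow> 'k pgl3" where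
  "mpt \<equiv> proj_class mat_coord"

definition mat_smult :: "'k::times \<Rightarrow> 'k^'n^'m \<Rightarrow> 'k^'n^'m" where
  "mat_smult c A = (\<chi> i j. c * A $ i $ j)"

lemma mpt_iff: "B \<in> mpt A \<longleftrightarrow> (\<exists>c. c \<noteq> 0 \<and> B = mat_smult c A)"
  by (auto simp: proj_class_def mat_coord_def mat_smult_def vec_eq_iff)

lemma mpt_smult: "c \<noteq> 0 \<Longrightarrow> mpt (mat_smult c A) = mpt A"
  by (rule proj_class_eqI[of c]) (auto simp: mat_coord_def mat_smult_def)

lemma mat_smult_mult:
  fixes A :: "('k::comm_semiring_1)^'n^'m" and B :: "'k^'p^'n"
  shows "mat_smult c A ** mat_smult d B = mat_smult (c * d) (A ** B)"
  by (simp add: mat_smult_def matrix_matrix_mult_def vec_eq_iff sum_distrib_left mult_ac)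

lemma mat_smult_apply:
  fixes A :: "('k::comm_semiring_1)^'n^'m"
  shows "mat_smult c A *v (d *s u) = (c * d) *s (A *v u)"
  by (simp add: mat_smult_def matrix_vector_mult_def vec_eq_iff sum_distrib_left mult_ac)

lemma mat_smult_one: "mat_smult (1::'k::monoid_mult) A = A"
  by (simp add: mat_smult_def)

text \<open>The operations on classes run over all representatives; the scalars collect into one
  factor, so a single representative suffices.\<close>

lemma pgl_apply_eq: "pgl_apply (mpt A) (pt u) = pt (A *v u)"
proof (intro set_eqI iffI)
  fix w assume "w \<in> pgl_apply (mpt A) (pt u)"
  then obtain c d where "c \<noteq> 0" "d \<noteq> 0" "w = mat_smult c A *v (d *s u)"
    by (auto simp: pgl_apply_def mpt_iff pt_iff)
  then show "w \<in> pt (A *v u)" by (auto simp: mat_smult_apply pt_iff intro!: exI[of _ "c * d"])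
next
  fix w assume "w \<in> pt (A *v u)"
  then obtain c where "c \<noteq> 0" "w = c *s (A *v u)" by (auto simp: pt_iff)
  then have "w = mat_smult c A *v u" "mat_smult c A \<in> mpt A"
    using mat_smult_apply[of c A 1 u] by (auto simp: mpt_iff)
  then show "w \<in> pgl_apply (mpt A) (pt u)" using proj_class_self[of u] by (auto simp: pgl_apply_def)
qed

lemma pgl_mult_eq: "pgl_mult (mpt A) (mpt B) = mpt (A ** B)"
proof (intro set_eqI iffI)
  fix C assume "C \<in> pgl_mult (mpt A) (mpt B)"
  then obtain c d where "c \<noteq> 0" "d \<noteq> 0" "C = mat_smult c A ** mat_smult d B"
    by (auto simp: pgl_mult_def mpt_iff)
  then show "C \<in> mpt (A ** B)" by (auto simp: mat_smult_mult mpt_iff intro!: exI[of _ "c * d"])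
next
  fix C assume "C \<in> mpt (A ** B)"
  then obtain c where "c \<noteq> 0" "C = mat_smult c (A ** B)" by (auto simp: mpt_iff)
  then have "C = mat_smult c A ** B" "mat_smult c A \<in> mpt A"
    using mat_smult_mult[of c A 1 B] by (auto simp: mpt_iff mat_smult_one)
  then show "C \<in> pgl_mult (mpt A) (mpt B)" using proj_class_self[of B] by (auto simp: pgl_mult_def)
qed

lemma matrix_inv_props:
  fixes A :: "('k::field)^3^3"
  assumes "invertible A"
  shows "A ** matrix_inv A = mat 1" "matrix_inv A ** A = mat 1"
  using someI_ex[of "\<lambda>B. A ** B = mat 1 \<and> B ** A = mat 1"] assms
  by (auto simp: matrix_inv_def invertible_def)

lemma pgl_inv_eq:
  assumes "invertible A"
  shows "pgl_inv (mpt A) = mpt (matrix_inv A)"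
proof -
  \<comment> \<open>\<open>matrix_inv\<close> is defined by choice, so its value on a multiple is
    pinned down by cancellation.\<close>
  have inv: "matrix_inv (mat_smult c A) = mat_smult (inverse c) (matrix_inv A)" if "c \<noteq> 0" for c
  proof -
    let ?C = "mat_smult c A" and ?D = "mat_smult (inverse c) (matrix_inv A)"
    have CD: "?C ** ?D = mat 1" "?D ** ?C = mat 1"
      using matrix_inv_props[OF assms] that by (simp_all add: mat_smult_mult mat_smult_one)
    then have "invertible ?C" by (auto simp: invertible_def)
    then have "?D ** ?C ** matrix_inv ?C = ?D" using matrix_inv_props(1)[of ?C]
      by (simp add: matrix_mul_assoc[symmetric])
    then show ?thesis using CD(2) by simp
  qed
  show ?thesis
  proof (intro set_eqI iffI)
    fix B assume "B \<in> pgl_inv (mpt A)"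
    then obtain c where "c \<noteq> 0" "B = mat_smult (inverse c) (matrix_inv A)"
      using inv by (auto simp: pgl_inv_def mpt_iff)
    then show "B \<in> mpt (matrix_inv A)" by (auto simp: mpt_iff intro!: exI[of _ "inverse c"])
  next
    fix B assume "B \<in> mpt (matrix_inv A)"
    then obtain c where c: "c \<noteq> 0" "B = mat_smult c (matrix_inv A)" by (auto simp: mpt_iff)
    then have "B = matrix_inv (mat_smult (inverse c) A)" by (simp add: inv)
    moreover have "mat_smult (inverse c) A \<in> mpt A" using c(1) by (auto simp: mpt_iff intro!: exI[of _ "inverse c"])
    ultimately show "B \<in> pgl_inv (mpt A)" by (simp add: pgl_inv_def)
  qed
qed

lemma PGL3_iff: "M \<in> PGL3 \<longleftrightarrow> (\<exists>A. invertible A \<and> M = mpt A)"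
  by (auto simp: PGL3_def)

section \<open>Frames and linear maps between solutions\<close>

lemma det3_matrix: "det3 (A *v a) (A *v b) (A *v c) = det A * det3 a b c"
  by (simp add: det_3 det3_def matrix_vector_mult_def sum_3 algebra_simps)

definition column_matrix :: "('k::zero)^3 \<Rightarrow> 'k^3 \<Rightarrow> 'k^3 \<Rightarrow> 'k^3^3" where
  "column_matrix a b c = (\<chi> i. vector [a $ i, b $ i, c $ i])"

lemma column_matrix_apply:
  "column_matrix a b c *v u = u $ 1 *s a + u $ 2 *s b + u $ 3 *s (c :: ('k::comm_semiring_1)^3)"
  by (simp add: column_matrix_def matrix_vector_mult_def vec_eq_iff sum_3 vector_3 mult.commute)

lemma matrix_determined:
  fixes A B :: "('k::field)^3^3"
  assumes "det3 a b c \<noteq> 0" "A *v a = B *v a" "A *v b = B *v b" "A *v c = B *v c"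
  shows "A = B"
proof -
  have "A *v u = B *v u" for u
    by (subst (1 2) cramer_div[OF assms(1), of u])
      (simp only: matrix_vector_right_distrib vector_scalar_commute assms)
  then show ?thesis by (simp add: matrix_eq)
qed

lemma frame_matrix:
  fixes a b c :: "('k::field)^3"
  assumes D: "det3 a b c \<noteq> 0" and D': "det3 a' b' c' \<noteq> 0"
  obtains A where "invertible A" "A *v a = a'" "A *v b = b'" "A *v c = c'"
proof -
  have ax: "det3 (axis 1 1) (axis 2 1) (axis 3 1 :: 'k^3) = 1" by (simp add: det3_def axis_def)
  have col: "column_matrix p q r *v axis 1 1 = p" "column_matrix p q r *v axis 2 1 = q"
    "column_matrix p q r *v axis 3 1 = r" for p q r :: "'k^3"
    by (simp_all add: column_matrix_apply axis_def)
  have det: "det (column_matrix p q r) = det3 p q r" for p q r :: "'k^3"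
    using det3_matrix[of "column_matrix p q r" "axis 1 1" "axis 2 1" "axis 3 1"] by (simp only: col ax mult_1_right)
  let ?C = "column_matrix a b c" and ?C' = "column_matrix a' b' c'"
  have inv: "invertible ?C" "invertible ?C'" using D D' by (simp_all add: invertible_det_nz det)
  \<comment> \<open>Back from the first frame to the standard basis, then on to the second.\<close>
  let ?A = "?C' ** matrix_inv ?C"
  have "?A *v (?C *v u) = ?C' *v u" for u
    by (simp add: matrix_vector_mul_assoc matrix_mul_assoc[symmetric] matrix_inv_props[OF inv(1)])
  then have A: "?A *v a = a'" "?A *v b = b'" "?A *v c = c'" by (metis col)+
  have "det ?A * det3 a b c = det3 a' b' c'" using det3_matrix[of ?A a b c] A by simp
  then have "invertible ?A" using D' by (auto simp: invertible_det_nz)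
  then show thesis using A by (rule that)
qed

text \<open>A linear map commutes with the recurrence; going backwards, the nonzero last coefficient
  is cancelled.\<close>

lemma corner_rec_transfer:
  fixes A :: "('k::field)^3^3"
  assumes V: "corner_rec x y V" and U: "corner_rec x y U" and nz: "\<And>i. x i \<noteq> 0" "\<And>i. y i \<noteq> 0"
    and A: "A *v V 1 = U 1" "A *v V 2 = U 2" "A *v V 3 = U 3"
  shows "A *v V i = U i"
proof -
  have rV: "A *v V (i + 3) = A *v V (i + 2) - y (i + 1) *s (A *v V (i + 1)) +
      (x (i + 1) * y (i + 1) * y i) *s (A *v V i)" for i
    unfolding corner_recD(1)[OF V, of i]
    by (simp add: matrix_vector_right_distrib matrix_vector_mult_diff_distrib vector_scalar_commute)
  have "A *v V i = U i \<and> A *v V (i + 1) = U (i + 1) \<and> A *v V (i + 2) = U (i + 2)"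
  proof (induction i rule: int_induct[of _ 1])
    case base
    then show ?case using A by simp
  next
    case (step1 i)
    then show ?case using rV[of i] corner_recD(1)[OF U, of i] by (simp add: add.assoc)
  next
    case (step2 i)
    have i: "i - 1 + 1 = i" "i - 1 + 2 = i + 1" "i - 1 + 3 = i + 2" by simp_all
    have "(x i * y i * y (i - 1)) *s (A *v V (i - 1)) = (x i * y i * y (i - 1)) *s U (i - 1)"
      using rV[of "i - 1"] corner_recD(1)[OF U, of "i - 1"] step2 unfolding i by auto
    then have "A *v V (i - 1) = U (i - 1)" using nz by (simp add: vector_mul_lcancel)
    then show ?case unfolding i using step2 by simp
  qed
  then show ?thesis by simp
qed

section \<open>Polygons and their monodromy\<close>

text \<open>By periodicity the shifted sequence solves the same recurrence, so the map between the
  two initial bases shifts the whole sequence.\<close>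

lemma monodromy_exists:
  assumes V: "corner_rec x y V" and nz: "\<And>i. x i \<noteq> 0" "\<And>i. y i \<noteq> 0"
    and per: "\<And>i. x (i + n) = x i" "\<And>i. y (i + n) = y i"
  obtains A where "invertible A" "\<And>i. A *v V i = V (i + n)"
proof -
  note D = corner_rec_det[OF V nz]
  have D1: "det3 (V 1) (V 2) (V 3) \<noteq> 0" and D2: "det3 (V (1 + n)) (V (2 + n)) (V (3 + n)) \<noteq> 0"
    using D[of 1] D[of "1 + n"] by (simp_all add: algebra_simps)
  obtain A where A: "invertible A" "A *v V 1 = V (1 + n)" "A *v V 2 = V (2 + n)" "A *v V 3 = V (3 + n)"
    by (rule frame_matrix[OF D1 D2])
  have "V (i + 3 + n) = V (i + 2 + n) - y (i + 1) *s V (i + 1 + n) + (x (i + 1) * y (i + 1) * y i) *s V (i + n)" for i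
    using corner_recD(1)[OF V, of "i + n"] per(1)[of "i + 1"] per(2)[of "i + 1"] per(2)[of i]
    by (simp add: add_ac)
  then have U: "corner_rec x y (\<lambda>i. V (i + n))"
    unfolding corner_rec_def using D2 by blast
  have "A *v V i = V (i + n)" for i
    by (rule corner_rec_transfer[OF V U nz A(2-4)])
  with A(1) show thesis by (rule that)
qed

text \<open>A projective map is determined by four points in general position, here
  \<open>v 1\<close> to \<open>v 4\<close>: the coefficients of \<open>V 4\<close> in the basis
  \<open>V 1\<close>, \<open>V 2\<close>, \<open>V 3\<close> are all nonzero, which forces the
  scaling factors \<open>k\<close> to agree.\<close>

lemma monodromy_unique:
  fixes v :: "int \<Rightarrow> ('k::alg_closed_field) plane_point"
  assumes tw: "twisted_polygon n v" and M: "is_monodromy n v M" and N: "is_monodromy n v N"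
  shows "M = N"
proof -
  obtain V where V: "\<And>i. v i = pt (V i)" "corner_rec (left_corner v) (right_corner v) V"
    "\<And>i. left_corner v i \<noteq> 0" "\<And>i. right_corner v i \<noteq> 0"
    using normalised_lift[OF tw] by metis
  obtain A B where A: "invertible A" "M = mpt A" and B: "invertible B" "N = mpt B"
    using M N by (auto simp: is_monodromy_def PGL3_iff)
  have "pt (A *v V i) = pt (B *v V i)" for i
    using M N unfolding is_monodromy_def A(2) B(2) V(1) pgl_apply_eq by simp
  then obtain k where k: "\<And>i. k i \<noteq> 0 \<and> A *v V i = k i *s (B *v V i)"
    unfolding pt_eq_iff by metis
  define g h where "g = right_corner v 2" and "h = left_corner v 2 * right_corner v 2 * right_corner v 1"
  have gh: "g \<noteq> 0" "h \<noteq> 0" using V by (simp_all add: g_def h_def)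
  have V4: "V 4 = V 3 - g *s V 2 + h *s V 1"
    using corner_recD(1)[OF V(2), of 1] by (simp add: g_def h_def)
  have D: "det3 (V 1) (V 2) (V 3) \<noteq> 0" using V(2) by (simp add: corner_rec_def)
  then have DB: "det3 (B *v V 1) (B *v V 2) (B *v V 3) \<noteq> 0"
    using B(1) by (simp add: det3_matrix invertible_det_nz)
  have "A *v V 4 = k 3 *s (B *v V 3) - (g * k 2) *s (B *v V 2) + (h * k 1) *s (B *v V 1)"
    unfolding V4 using k by (simp add: matrix_vector_right_distrib matrix_vector_mult_diff_distrib
        vector_scalar_commute vector_smult_assoc)
  moreover have "A *v V 4 = k 4 *s (B *v V 3) - (g * k 4) *s (B *v V 2) + (h * k 4) *s (B *v V 1)"
    using k[of 4] unfolding V4 by (simp add: matrix_vector_right_distrib matrix_vector_mult_diff_distrib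
        vector_scalar_commute vector_smult_assoc vector_add_ldistrib vector_ssub_ldistrib mult.commute)
  ultimately have e: "k 3 *s (B *v V 3) - (g * k 2) *s (B *v V 2) + (h * k 1) *s (B *v V 1) =
      k 4 *s (B *v V 3) - (g * k 4) *s (B *v V 2) + (h * k 4) *s (B *v V 1)" by simp
  \<comment> \<open>Determinants with two of the basis vectors extract the coefficient of the
    third.\<close>
  have coef: "det3 (q *s c - r *s b + s *s a) b c = s * det3 a b c" "det3 a (q *s c - r *s b + s *s a) c = - r * det3 a b c"
    "det3 a b (q *s c - r *s b + s *s a) = q * det3 a b c" for a b c :: "'k^3" and q r s
    by (simp_all add: det3_def algebra_simps)
  have "h * k 1 = h * k 4" "g * k 2 = g * k 4" "k 3 = k 4"
    using arg_cong[OF e, of "\<lambda>u. det3 u (B *v V 2) (B *v V 3)"]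
      arg_cong[OF e, of "\<lambda>u. det3 (B *v V 1) u (B *v V 3)"]
      arg_cong[OF e, of "\<lambda>u. det3 (B *v V 1) (B *v V 2) u"] DB
    unfolding coef by simp_all
  then have kk: "k 1 = k 4" "k 2 = k 4" "k 3 = k 4" using gh by simp_all
  have "mat_smult (k 4) B *v u = k 4 *s (B *v u)" for u using mat_smult_apply[of "k 4" B 1 u] by simp
  then have "A = mat_smult (k 4) B"
    using k[of 1] k[of 2] k[of 3] by (intro matrix_determined[OF D]) (simp_all add: kk)
  then show ?thesis using k[of 4] unfolding A(2) B(2) by (simp add: mpt_smult)
qed

lemma monodromy_eq:
  fixes v :: "int \<Rightarrow> ('k::alg_closed_field) plane_point"
  assumes "twisted_polygon n v" "is_monodromy n v M"
  shows "monodromy n v = M"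
  unfolding monodromy_def using assms(2) by (rule the_equality) (rule monodromy_unique[OF assms(1) _ assms(2)])

lemma is_monodromy_monodromy:
  fixes v :: "int \<Rightarrow> ('k::alg_closed_field) plane_point"
  assumes "twisted_polygon n v"
  shows "is_monodromy n v (monodromy n v)"
  using assms monodromy_eq[OF assms] by (auto simp: twisted_polygon_def)

text \<open>The vectors \<open>A *v V i\<close> solve the recurrence of \<open>v\<close>, so the
  corners are unchanged without computing any cross-ratio; the monodromy is conjugated.\<close>

lemma transform_polygon:
  fixes v :: "int \<Rightarrow> ('k::alg_closed_field) plane_point"
  assumes tw: "twisted_polygon n v" and A: "invertible A"
  defines "w \<equiv> \<lambda>i. pgl_apply (mpt A) (v i)"
  shows "twisted_polygon n w" "polygon_point n w = pgl_action n (mpt A) (polygon_point n v)"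
    "left_corner w i = left_corner v i" "right_corner w i = right_corner v i"
proof -
  obtain V where V: "\<And>i. v i = pt (V i)" "\<And>i. V i \<noteq> 0" "corner_rec (left_corner v) (right_corner v) V"
    "\<And>i. left_corner v i \<noteq> 0" "\<And>i. right_corner v i \<noteq> 0"
    using normalised_lift[OF tw] by metis
  have w: "w i = pt (A *v V i)" for i by (simp add: w_def V(1) pgl_apply_eq)
  have detA: "det A \<noteq> 0" using A by (simp add: invertible_det_nz)
  have AV0: "A *v V i \<noteq> 0" for i
  proof
    assume "A *v V i = 0"
    then have "matrix_inv A *v (A *v V i) = 0" by simp
    then show False using V(2) by (simp add: matrix_vector_mul_assoc matrix_inv_props[OF A])
  qed
  obtain B where B: "invertible B" "monodromy n v = mpt B" "\<And>i. pgl_apply (mpt B) (v i) = v (i + int n)"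
    using is_monodromy_monodromy[OF tw] by (auto simp: is_monodromy_def PGL3_iff)
  let ?C = "A ** B ** matrix_inv A"
  have "invertible (matrix_inv A)" using matrix_inv_props[OF A] by (auto simp: invertible_def)
  then have "invertible ?C" using A B(1) by (simp add: invertible_mult)
  moreover have "pgl_apply (mpt ?C) (w i) = w (i + int n)" for i
  proof -
    have "?C *v (A *v V i) = A *v (B *v V i)"
      by (simp add: matrix_vector_mul_assoc matrix_mul_assoc[symmetric] matrix_inv_props[OF A])
    moreover have "v (i + int n) = pt (B *v V i)"
      using B(3)[of i] unfolding V(1)[of i] pgl_apply_eq by simp
    then have "w (i + int n) = pt (A *v (B *v V i))" by (simp add: w_def pgl_apply_eq)
    ultimately show ?thesis unfolding w pgl_apply_eq by simp
  qed
  ultimately have mon: "is_monodromy n w (mpt ?C)" by (auto simp: is_monodromy_def PGL3_iff)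
  show twW: "twisted_polygon n w"
    unfolding twisted_polygon_iff[OF w AV0] det3_matrix
    using tw[unfolded twisted_polygon_iff[OF V(1,2)]] mon detA by auto
  show "polygon_point n w = pgl_action n (mpt A) (polygon_point n v)"
    unfolding polygon_point_def pgl_action_def monodromy_eq[OF twW mon] B(2) fst_conv snd_conv
      pgl_mult_eq pgl_inv_eq[OF A] by (auto simp: w_def restrict_def fun_eq_iff)
  have "corner_rec (left_corner v) (right_corner v) (\<lambda>i. A *v V i)"
    unfolding corner_rec_def det3_matrix
  proof (intro conjI allI)
    show "det A * det3 (V 1) (V 2) (V 3) \<noteq> 0" using V(3) detA by (simp add: corner_rec_def)
    fix i
    show "A *v V (i + 3) = A *v V (i + 2) - right_corner v (i + 1) *s (A *v V (i + 1)) +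
        (left_corner v (i + 1) * right_corner v (i + 1) * right_corner v i) *s (A *v V i)"
      unfolding corner_recD(1)[OF V(3), of i]
      by (simp add: matrix_vector_right_distrib matrix_vector_mult_diff_distrib vector_scalar_commute)
  qed
  from corner_rec_corners[OF this V(4,5) w]
  show "left_corner w i = left_corner v i" "right_corner w i = right_corner v i" by blast+
qed

text \<open>Shifting by \<open>n\<close> is the action of the monodromy, so invariance gives
  periodicity.\<close>

lemma corners_periodic:
  fixes v :: "int \<Rightarrow> ('k::alg_closed_field) plane_point"
  assumes tw: "twisted_polygon n v"
  shows "left_corner v (i + int n) = left_corner v i" "right_corner v (i + int n) = right_corner v i"
proof -
  obtain A where A: "invertible A" "\<And>i. pgl_apply (mpt A) (v i) = v (i + int n)"
    using is_monodromy_monodromy[OF tw] by (auto simp: is_monodromy_def PGL3_iff)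
  have "left_corner v (i + int n) = left_corner (\<lambda>i. v (i + int n)) i"
    "right_corner v (i + int n) = right_corner (\<lambda>i. v (i + int n)) i"
    by (simp_all add: left_corner_def right_corner_def algebra_simps)
  then show "left_corner v (i + int n) = left_corner v i" "right_corner v (i + int n) = right_corner v i"
    using transform_polygon(3,4)[OF tw A(1), of i] unfolding A(2) by simp_all
qed

text \<open>The converse of \<open>normalised_lift\<close>: the factors in
  \<open>window_dets\<close> are nonzero because \<open>x\<close> and \<open>y\<close> avoid
  \<open>0\<close> and \<open>1\<close>.\<close>

lemma corner_rec_polygon:
  fixes x y :: "int \<Rightarrow> 'k::alg_closed_field"
  assumes V: "corner_rec x y V"
    and x: "\<And>i. x i \<noteq> 0" "\<And>i. x i \<noteq> 1" and y: "\<And>i. y i \<noteq> 0" "\<And>i. y i \<noteq> 1"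
    and per: "\<And>i. x (i + int n) = x i" "\<And>i. y (i + int n) = y i"
    and A: "invertible A" "\<And>i. A *v V i = V (i + int n)"
  shows "twisted_polygon n (\<lambda>i. pt (V i))" "monodromy n (\<lambda>i. pt (V i)) = mpt A"
proof -
  note D = corner_rec_det[OF V x(1) y(1)]
  have V0: "V i \<noteq> 0" for i using det3_nonzero_vectors[OF D] by simp
  have mon: "is_monodromy n (\<lambda>i. pt (V i)) (mpt A)"
    using A by (auto simp: is_monodromy_def PGL3_iff pgl_apply_eq)
  have "det3 (V i) (V (i+1)) (V (i+3)) \<noteq> 0 \<and>
        det3 (V i) (V (i+1)) (V (i+4)) \<noteq> 0 \<and> det3 (V i) (V (i+2)) (V (i+3)) \<noteq> 0 \<and>
        det3 (V i) (V (i+3)) (V (i+4)) \<noteq> 0" for i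
  proof -
    have "y (i + 1) * y (i + 2) - x (i + 2) * y (i + 2) * y (i + 1) = y (i + 1) * y (i + 2) * (1 - x (i + 2))"
      by (simp add: algebra_simps)
    moreover have "1 - x (i + 2) \<noteq> 0" "1 - y (i + 2) \<noteq> 0" using x(2)[of "i + 2"] y(2)[of "i + 2"] by simp_all
    ultimately show ?thesis
      unfolding window_dets[OF corner_recD[OF V, of i]] using D[of i] y(1) by simp
  qed
  then show tw: "twisted_polygon n (\<lambda>i. pt (V i))"
    unfolding twisted_polygon_iff[of "\<lambda>i. pt (V i)" V, OF refl V0] using mon D by blast
  show "monodromy n (\<lambda>i. pt (V i)) = mpt A" by (rule monodromy_eq[OF tw mon])
qed

text \<open>Normalised lifts of both polygons solve one recurrence, so the map between their initial
  bases carries one polygon to the other.\<close>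

lemma same_corners:
  fixes v w :: "int \<Rightarrow> ('k::alg_closed_field) plane_point"
  assumes tw: "twisted_polygon n v" "twisted_polygon n w"
    and eq: "\<And>i. left_corner w i = left_corner v i" "\<And>i. right_corner w i = right_corner v i"
  obtains A where "invertible A" "w = (\<lambda>i. pgl_apply (mpt A) (v i))"
proof -
  obtain V where V: "\<And>i. v i = pt (V i)" "corner_rec (left_corner v) (right_corner v) V"
    "\<And>i. left_corner v i \<noteq> 0" "\<And>i. right_corner v i \<noteq> 0"
    using normalised_lift[OF tw(1)] by metis
  have "left_corner w = left_corner v" "right_corner w = right_corner v" using eq by auto
  then obtain W where W: "\<And>i. w i = pt (W i)" "corner_rec (left_corner v) (right_corner v) W"
    using normalised_lift[OF tw(2)] by metis
  obtain A where A: "invertible A" "A *v V 1 = W 1" "A *v V 2 = W 2" "A *v V 3 = W 3"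
    using frame_matrix V(2) W(2) unfolding corner_rec_def by metis
  have "A *v V i = W i" for i by (rule corner_rec_transfer[OF V(2) W(2) V(3,4) A(2-4)])
  then have "w = (\<lambda>i. pgl_apply (mpt A) (v i))" by (simp add: fun_eq_iff V(1) W(1) pgl_apply_eq)
  with A(1) show thesis by (rule that)
qed

text \<open>Only agreement has to pass between \<open>i\<close> and \<open>i + n\<close>; this
  covers periodic functions as well as sequences moved by an injective map.\<close>

lemma periodic_step_eq:
  fixes f g :: "int \<Rightarrow> 'a"
  assumes n: "n > 0" and step: "\<And>i. f i = g i \<longleftrightarrow> f (i + int n) = g (i + int n)"
    and eq: "\<And>j. j \<in> {1..n} \<Longrightarrow> f (int j) = g (int j)"
  shows "f i = g i"
proof -
  have shift: "f i = g i \<longleftrightarrow> f (i + q * int n) = g (i + q * int n)" for i q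
  proof (induction q rule: int_induct[of _ 0])
    case (step1 q)
    then show ?case using step[of "i + q * int n"] by (simp add: algebra_simps)
  next
    case (step2 q)
    then show ?case using step[of "i + (q - 1) * int n"] by (simp add: algebra_simps)
  qed simp
  \<comment> \<open>The residue of \<open>i\<close> in \<open>{1..n}\<close>; the shift by one
    around the remainder avoids \<open>0\<close>.\<close>
  define j where "j = nat ((i - 1) mod int n) + 1"
  have "j \<in> {1..n}" using n by (simp add: j_def nat_less_iff Suc_le_eq)
  moreover have "i = int j + ((i - 1) div int n) * int n"
    using n by (simp add: j_def)
  ultimately show ?thesis using eq[of j] shift[of "int j" "(i - 1) div int n"] by simp
qed

text \<open>The monodromy carries agreement forwards, and its injectivity on points carries it
  backwards.\<close>

lemma polygon_point_inj:
  fixes v w :: "int \<Rightarrow> ('k::alg_closed_field) plane_point"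
  assumes tw: "twisted_polygon n v" "twisted_polygon n w" and n: "n > 0"
    and eq: "polygon_point n v = polygon_point n w"
  shows "v = w"
proof
  fix i
  obtain A where A: "invertible A" "monodromy n v = mpt A" "\<And>i. pgl_apply (mpt A) (v i) = v (i + int n)"
    using is_monodromy_monodromy[OF tw(1)] by (auto simp: is_monodromy_def PGL3_iff)
  have "monodromy n w = mpt A" using eq A(2) by (simp add: polygon_point_def)
  then have Aw: "pgl_apply (mpt A) (w i) = w (i + int n)" for i
    using is_monodromy_monodromy[OF tw(2)] by (simp add: is_monodromy_def)
  have inj: "p = q" if pq: "p \<in> P2" "q \<in> P2" "pgl_apply (mpt A) p = pgl_apply (mpt A) q" for p q
  proof -
    obtain a b where ab: "p = pt a" "q = pt b" using pq(1,2) by (auto simp: proj_points_vec)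
    then obtain c where c: "c \<noteq> 0" "A *v a = c *s (A *v b)"
      using pq(3) by (auto simp: pgl_apply_eq pt_eq_iff)
    then have "A *v a = A *v (c *s b)" by (simp add: vector_scalar_commute)
    then have "a = c *s b" using inj_matrix_vector_mult[OF A(1)] by (simp add: inj_eq)
    then show ?thesis using c(1) ab by (simp add: pt_smult)
  qed
  show "v i = w i"
  proof (rule periodic_step_eq[OF n])
    show "v i = w i \<longleftrightarrow> v (i + int n) = w (i + int n)" for i
      using inj[of "v i" "w i"] tw unfolding A(3)[symmetric] Aw[symmetric]
      by (auto simp: twisted_polygon_def)
    show "v (int j) = w (int j)" if "j \<in> {1..n}" for j
      using that eq by (auto simp: polygon_point_def fun_eq_iff restrict_def split: if_splits)
  qed
qed

section \<open>An affine model of the corner space\<close>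

text \<open>The coordinate \<open>2n + j\<close> is the inverse of \<open>z\<^sub>j (z\<^sub>j - 1)\<close>, which makes the set closed.\<close>

definition corner_set :: "nat \<Rightarrow> (nat \<Rightarrow> 'k::field) set" where
  "corner_set n = {z \<in> affine_points (4 * n). \<forall>j<2*n. z j * (z j - 1) * z (2 * n + j) = 1}"

text \<open>Values of \<open>r\<close> from \<open>2 * n\<close> on are ignored: the last
  \<open>2 * n\<close> coordinates are forced by the equations of \<open>corner_set\<close>.\<close>

definition corner_embed :: "nat \<Rightarrow> (nat \<Rightarrow> 'k::field) \<Rightarrow> nat \<Rightarrow> 'k" where
  "corner_embed n r = (\<lambda>j\<in>{..<4*n}. if j < 2*n then r j else inverse (r (j - 2*n) * (r (j - 2*n) - 1)))"

lemma corner_set_nonzero: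
  assumes "z \<in> corner_set n" "j < 2*n"
  shows "z j \<noteq> 0" "z j \<noteq> 1"
  using assms by (auto simp: corner_set_def)

lemma corner_embed_in:
  assumes "\<And>j. j < 2*n \<Longrightarrow> r j \<noteq> 0 \<and> r j \<noteq> 1"
  shows "corner_embed n r \<in> corner_set n"
proof -
  have "r j * (r j - 1) * inverse (r j * (r j - 1)) = 1" if "j < 2*n" for j
    using assms[OF that] by (intro right_inverse) simp
  then show ?thesis by (simp add: corner_embed_def corner_set_def affine_points_def del: inverse_mult_distrib)
qed

lemma corner_embed_eq:
  assumes z: "z \<in> corner_set n" and r: "\<And>j. j < 2*n \<Longrightarrow> r j = z j"
  shows "corner_embed n r = z"
proof
  fix j
  consider "j < 2*n" | k where "j = 2*n + k" "k < 2*n" | "j \<ge> 4*n"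
    by (metis add_diff_inverse_nat less_diff_conv2 mult_2 mult_2_right not_less numeral_Bit0 distrib_right)
  then show "corner_embed n r j = z j"
  proof cases
    case 1
    then show ?thesis using r by (simp add: corner_embed_def)
  next
    case 2
    then have "z k * (z k - 1) * z j = 1" using z by (simp add: corner_set_def)
    then have "inverse (z k * (z k - 1)) = z j" by (rule inverse_unique)
    then show ?thesis using 2 r by (simp add: corner_embed_def)
  next
    case 3
    then show ?thesis using z by (auto simp: corner_embed_def corner_set_def affine_points_def PiE_def extensional_def)
  qed
qed

lemma closedin_corner_set:
  "closedin (zariski (affine_sub (4*n) (affine_points (4*n)))) (corner_set n :: (nat \<Rightarrow> 'k::field) set)"
proof -
  let ?P = "affine_points (4*n) :: (nat \<Rightarrow> 'k) set"
  let ?A = "affine_sub (4*n) ?P"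
  note L = locally_ringed_affine[of "4*n" ?P] and o = openin_affine[of "4*n" ?P]
  note sh = locally_ringedD(1)[OF L]
  have "openin (zariski ?A) {z \<in> ?P. z j * (z j - 1) * z (2 * n + j) - 1 \<noteq> 0}" if "j < 2*n" for j
  proof (rule locally_ringedD(2)[OF L o])
    have "(\<lambda>z. z j) \<in> regular_on ?A ?P" "(\<lambda>z. z (2 * n + j)) \<in> regular_on ?A ?P"
      using that by (auto intro: regular_on_affine)
    then show "(\<lambda>z. z j * (z j - 1) * z (2 * n + j) - 1) \<in> regular_on ?A ?P"
      by (intro regular_on_diff[OF sh o] function_sheafD(3)[OF sh o] function_sheafD(1)[OF sh o])
  qed
  then have "openin (zariski ?A) (\<Union>j\<in>{..<2*n}. {z \<in> ?P. z j * (z j - 1) * z (2 * n + j) - 1 \<noteq> 0})"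
    by blast
  moreover have "(\<Union>j\<in>{..<2*n}. {z \<in> ?P. z j * (z j - 1) * z (2 * n + j) - 1 \<noteq> 0}) = ?P - corner_set n"
    by (auto simp: corner_set_def)
  moreover have "topspace (zariski ?A) = ?P" using points_affine_sub[of "4*n" ?P] by (simp add: points_def)
  ultimately show ?thesis unfolding closedin_def by (auto simp: corner_set_def)
qed

lemma morphism_into_corner_set:
  assumes X: "locally_ringed X" and r: "\<And>j. j < 2*n \<Longrightarrow> (\<lambda>p. r p j) \<in> regular_on X (points X)"
    and nz: "\<And>p j. p \<in> points X \<Longrightarrow> j < 2*n \<Longrightarrow> r p j \<noteq> 0 \<and> r p j \<noteq> 1"
  shows "morphism X (affine_sub (4*n) (corner_set n)) (\<lambda>p. corner_embed n (r p))"
proof (rule morphism_into_affine[OF X])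
  note sh = locally_ringedD(1)[OF X]
  have o: "openin (zariski X) (points X)" by (simp add: points_def)
  show "corner_embed n (r p) \<in> corner_set n" if "p \<in> points X" for p
    by (rule corner_embed_in) (use nz that in blast)
  fix j assume j: "j < 4*n"
  show "(\<lambda>p. corner_embed n (r p) j) \<in> regular_on X (points X)"
  proof (cases "j < 2*n")
    case True
    then show ?thesis using r[OF True] j by (simp add: corner_embed_def)
  next
    case False
    then have k: "j - 2*n < 2*n" using j by simp
    have "(\<lambda>p. inverse (r p (j - 2*n) * (r p (j - 2*n) - 1))) \<in> regular_on X (points X)"
      using nz[OF _ k] r[OF k]
      by (intro regular_on_inverse[OF X o] regular_on_diff[OF sh o] function_sheafD(3)[OF sh o]
          function_sheafD(1)[OF sh o]) auto
    then show ?thesis using False j by (simp add: corner_embed_def)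
  qed
qed

lemma P1_point_eq_iff:
  "P1_point a 1 = P1_point b 1 \<longleftrightarrow> a = b" "P1_point a 1 \<noteq> P1_point 1 0"
  by (auto simp: P1_point_def pt_eq_iff vec_eq_iff forall_2 vector_2)

lemma P1_point_vec: "vector [a, 1] \<noteq> (0 :: ('k::field)^2)"
  by (simp add: vec_eq_iff forall_2 vector_2)

lemma coord_ratio_P1: "coord_ratio vec_coord 1 2 (P1_point a 1) = (a :: 'k::field)"
proof -
  have "P1_point a 1 \<in> proj_points vec_coord"
    unfolding P1_point_def proj_points_vec using P1_point_vec by blast
  from coord_ratio_eq[OF proj_class_self[of "vector [a, 1]" vec_coord] this[unfolded P1_point_def]]
  show ?thesis unfolding P1_point_def by (simp add: vec_coord_def vector_2)
qed

lemma P1_complement: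
  "q \<in> proj_points vec_coord - {P1_point 0 1, P1_point 1 1, P1_point 1 0} \<longleftrightarrow>
   (\<exists>a. a \<noteq> 0 \<and> a \<noteq> 1 \<and> q = P1_point (a :: 'k::field) 1)"
proof
  assume q: "q \<in> proj_points vec_coord - {P1_point 0 1, P1_point 1 1, P1_point 1 0 :: ('k^2) set}"
  then obtain u where u: "u \<noteq> 0" "q = pt u" by (auto simp: proj_points_vec)
  show "\<exists>a. a \<noteq> 0 \<and> a \<noteq> 1 \<and> q = P1_point a 1"
  proof (cases "u $ 2 = 0")
    case True
    then have "u = u $ 1 *s vector [1, 0]" "u $ 1 \<noteq> 0"
      using u(1) by (auto simp: vec_eq_iff forall_2 vector_2)
    then have "q = P1_point 1 0" unfolding P1_point_def u(2) pt_eq_iff by blast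
    then show ?thesis using q by simp
  next
    case False
    then have "u = u $ 2 *s vector [u $ 1 / u $ 2, 1]" by (simp add: vec_eq_iff forall_2 vector_2)
    then have "q = P1_point (u $ 1 / u $ 2) 1" unfolding P1_point_def u(2) pt_eq_iff using False by blast
    then show ?thesis using q by (intro exI[of _ "u $ 1 / u $ 2"]) auto
  qed
next
  assume "\<exists>a. a \<noteq> 0 \<and> a \<noteq> 1 \<and> q = P1_point a 1"
  then show "q \<in> proj_points vec_coord - {P1_point 0 1, P1_point 1 1, P1_point 1 0}"
    using P1_point_vec by (auto simp: P1_point_eq_iff) (auto simp: P1_point_def proj_points_vec)
qed

lemma points_corner_space:
  "points (corner_space n) = {1..2*n} \<rightarrow>\<^sub>E {P1_point a 1 | a. a \<noteq> 0 \<and> a \<noteq> (1 :: 'k::field)}"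
proof -
  have "proj_points vec_coord - {P1_point 0 1, P1_point 1 1, P1_point 1 0} = {P1_point a 1 | a. a \<noteq> 0 \<and> a \<noteq> (1::'k)}"
    (is "?S = ?R")
    unfolding set_eq_iff P1_complement by blast
  moreover have "proj_points vec_coord \<inter> ?S = ?S" by (rule Int_absorb1) (rule Diff_subset)
  ultimately show ?thesis
    unfolding corner_space_def points_power_fspace points_open_sub points_proj_fspace by (simp only:)
qed

text \<open>The inverse reads off the ratio of the two homogeneous coordinates in each factor, which
  is regular because \<open>[1 : 0]\<close> has been removed.\<close>

lemma corner_set_iso:
  "isomorphism (affine_sub (4*n) (corner_set n)) (corner_space n)
    (\<lambda>z. \<lambda>j\<in>{1..2*n}. P1_point (z (j - 1)) (1 :: 'k::field))"
  (is "isomorphism ?T _ ?\<Phi>")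
proof -
  let ?S = "proj_points vec_coord - {P1_point 0 1, P1_point 1 1, P1_point 1 0 :: ('k^2) set}"
  let ?Y = "open_sub (proj_fspace vec_coord) ?S"
  have LT: "locally_ringed ?T" by (rule locally_ringed_affine)
  have oT: "openin (zariski ?T) (corner_set n)" by (rule openin_affine)
  have chart: "morphism ?T ?Y (\<lambda>z. P1_point (z (j - 1)) 1)" if j: "j \<in> {1..2*n}" for j
  proof -
    have reg: "(\<lambda>z. z (j - 1)) \<in> regular_on ?T (corner_set n)"
      by (rule regular_on_affine) (use j in auto)
    have "morphism ?T ?Y (\<lambda>z. pt (vector [z (j - 1), 1]))"
    proof (rule morphism_into_proj[OF LT])
      show "(\<lambda>z. vec_coord i (vector [z (j - 1), 1])) \<in> regular_on ?T (points ?T)" for i :: 2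
        using exhaust_2[of i] reg function_sheafD(1)[OF locally_ringedD(1)[OF LT] oT, of 1]
        by (auto simp: vec_coord_def vector_2 points_affine_sub)
      show "\<exists>i::2. vec_coord i (vector [z (j - 1), 1]) \<noteq> (0::'k)" for z
        by (rule exI[of _ 2]) (simp add: vec_coord_def vector_2)
      show "pt (vector [z (j - 1), 1]) \<in> ?S" if z: "z \<in> points ?T" for z
      proof -
        have "j - 1 < 2*n" using j by auto
        then have "z (j - 1) \<noteq> 0" "z (j - 1) \<noteq> 1"
          using corner_set_nonzero[of z n "j - 1"] z by (simp_all add: points_affine_sub)
        then show ?thesis
          unfolding P1_complement by (intro exI[of _ "z (j - 1)"]) (simp add: P1_point_def)
      qed
    qed
    then show ?thesis by (simp only: P1_point_def)
  qed
  have \<Phi>: "morphism ?T (corner_space n) ?\<Phi>"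
    unfolding corner_space_def by (rule morphism_into_power[OF LT chart])
  \<comment> \<open>Coordinates of \<open>corner_set\<close> are counted from \<open>0\<close>,
    factors of \<open>corner_space\<close> from \<open>1\<close>.\<close>
  let ?\<Psi> = "\<lambda>p :: nat \<Rightarrow> ('k^2) set. corner_embed n (\<lambda>j. coord_ratio vec_coord 1 2 (p (j + 1)))"
  have LC: "locally_ringed (corner_space n)" unfolding corner_space_def by (rule locally_ringed_power)
  have pj: "\<exists>a. a \<noteq> 0 \<and> a \<noteq> 1 \<and> p (j + 1) = P1_point a 1"
    if "p \<in> points (corner_space n)" "j < 2*n" for p :: "nat \<Rightarrow> ('k^2) set" and j
  proof -
    have "p (j + 1) \<in> {P1_point a 1 | a. a \<noteq> 0 \<and> a \<noteq> (1 :: 'k)}"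
      by (rule PiE_mem[OF that(1)[unfolded points_corner_space]]) (use that(2) in simp)
    then obtain a where "p (j + 1) = P1_point a 1 \<and> a \<noteq> 0 \<and> a \<noteq> (1 :: 'k)" unfolding mem_Collect_eq ..
    then show ?thesis by (intro exI[of _ a]) simp
  qed
  have \<Psi>: "morphism (corner_space n) ?T ?\<Psi>"
  proof (rule morphism_into_corner_set[OF LC])
    fix j assume j: "j < 2*n"
    show "coord_ratio vec_coord 1 2 (p (j + 1)) \<noteq> 0 \<and> coord_ratio vec_coord 1 2 (p (j + 1)) \<noteq> 1"
      if "p \<in> points (corner_space n)" for p :: "nat \<Rightarrow> ('k^2) set"
      using pj[OF that j] by (auto simp: coord_ratio_P1)
    let ?U = "{q \<in> proj_points vec_coord. \<forall>x\<in>q. vec_coord 2 x \<noteq> 0} \<inter> ?S"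
    have "P1_point a 1 \<in> ?U" if "a \<noteq> 0" "a \<noteq> 1" for a
    proof -
      have "P1_point a 1 \<in> ?S" using that P1_complement by blast
      moreover have "\<forall>x\<in>P1_point a 1. vec_coord 2 x \<noteq> 0"
        by (auto simp: P1_point_def pt_iff vec_coord_def vector_2)
      ultimately show ?thesis by blast
    qed
    then have U: "p (j + 1) \<in> ?U" if "p \<in> points (corner_space n)" for p :: "nat \<Rightarrow> ('k^2) set"
      using pj[OF that j] by (elim exE conjE) (simp only:)
    have pC: "points (corner_space n) = {1..2*n} \<rightarrow>\<^sub>E points ?Y"
      unfolding corner_space_def points_power_fspace ..
    \<comment> \<open>The second coordinate vanishes nowhere on the punctured line, so a single
      chart covers everything.\<close>
    have eq: "{p \<in> {1..2*n} \<rightarrow>\<^sub>E points ?Y. p (j + 1) \<in> ?U} = points (corner_space n)"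
      unfolding pC[symmetric] using U by (intro set_eqI iffI) (simp_all only: mem_Collect_eq)
    have "j + 1 \<in> {1..2*n}" using j by simp
    note reg = regular_on_power[OF this regular_on_proj(1)[of vec_coord ?S 2] regular_on_proj(2)[of vec_coord 1 2 ?S]]
    show "(\<lambda>p :: nat \<Rightarrow> ('k^2) set. coord_ratio vec_coord 1 2 (p (j + 1))) \<in> regular_on (corner_space n) (points (corner_space n))"
      by (rule conjunct2[OF reg, folded corner_space_def, unfolded eq])
  qed
  have \<Psi>\<Phi>: "\<forall>z\<in>points ?T. ?\<Psi> (?\<Phi> z) = z"
    by (auto simp: points_affine_sub coord_ratio_P1 intro!: corner_embed_eq)
  have \<Phi>\<Psi>: "\<forall>p\<in>points (corner_space n). ?\<Phi> (?\<Psi> p) = p"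
  proof (intro ballI ext)
    fix p :: "nat \<Rightarrow> ('k^2) set" and j assume p: "p \<in> points (corner_space n)"
    show "?\<Phi> (?\<Psi> p) j = p j"
    proof (cases "j \<in> {1..2*n}")
      case True
      then have j: "j - 1 < 2*n" "j - 1 + 1 = j" "j - 1 < 4*n" by auto
      obtain a where a: "a \<noteq> 0 \<and> a \<noteq> 1 \<and> p (j - 1 + 1) = P1_point a 1" using pj[OF p j(1)] ..
      have "?\<Psi> p (j - 1) = a"
        using a j by (simp only: corner_embed_def restrict_apply lessThan_iff if_True coord_ratio_P1)
      then show ?thesis using True a unfolding j(2) by (simp only: restrict_apply if_True)
    next
      case False
      then show ?thesis
        using PiE_arb[OF p[unfolded points_corner_space] False] by (simp only: restrict_apply if_False)
    qed
  qed
  show ?thesis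
    unfolding isomorphism_def using \<Phi> \<Psi> \<Psi>\<Phi> \<Phi>\<Psi> by (intro conjI exI[of _ ?\<Psi>])
qed

section \<open>Regularity of the corner invariants\<close>

lemma regular_on_det3:
  assumes sh: "function_sheaf X" and o: "openin (zariski X) U"
    and "\<And>i. (\<lambda>p. a p $ i) \<in> regular_on X U" "\<And>i. (\<lambda>p. b p $ i) \<in> regular_on X U"
      "\<And>i. (\<lambda>p. c p $ i) \<in> regular_on X U"
  shows "(\<lambda>p. det3 (a p) (b p) (c p)) \<in> regular_on X U"
  unfolding det3_def
  by (intro regular_on_diff[OF sh o] function_sheafD(2)[OF sh o] function_sheafD(3)[OF sh o] assms)

lemma regular_on_matrix_vector:
  fixes A :: "'p \<Rightarrow> ('k::field)^3^3"
  assumes sh: "function_sheaf X" and o: "openin (zariski X) U"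
    and "\<And>i j. (\<lambda>p. A p $ i $ j) \<in> regular_on X U" "\<And>i. (\<lambda>p. a p $ i) \<in> regular_on X U"
  shows "(\<lambda>p. (A p *v a p) $ i) \<in> regular_on X U"
  unfolding matrix_vector_mult_def vec_lambda_beta sum_3
  by (intro function_sheafD(2)[OF sh o] function_sheafD(3)[OF sh o] assms)

lemma twisted_det3:
  assumes tw: "twisted_polygon n v" and ord: "i \<le> a" "a < b" "b < c" "c \<le> i + 4" "(a, b, c) \<noteq> (i, i + 2, i + 4)"
    and v: "v a = pt A" "v b = pt B" "v c = pt C" and nz: "A \<noteq> 0" "B \<noteq> 0" "C \<noteq> 0"
  shows "det3 A B C \<noteq> 0"
proof -
  have "\<not> collinear_points {v a, v b, v c}" using tw ord unfolding twisted_polygon_def by blast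
  then show ?thesis using collinear_iff[OF nz] unfolding v by blast
qed

lemma polygon_point_in:
  fixes v :: "int \<Rightarrow> ('k::alg_closed_field) plane_point"
  assumes tw: "twisted_polygon n v"
  shows "polygon_point n v \<in> ({1..n} \<rightarrow>\<^sub>E P2) \<times> (proj_points mat_coord \<inter> PGL3)"
proof -
  obtain A where A: "invertible A" "monodromy n v = mpt A"
    using is_monodromy_monodromy[OF tw] by (auto simp: is_monodromy_def PGL3_iff)
  have "\<exists>ij. mat_coord ij A \<noteq> 0"
  proof (rule ccontr)
    assume "\<not> ?thesis"
    then have "A = 0" by (auto simp: mat_coord_def vec_eq_iff)
    then have "A *v axis 1 1 = 0" by simp
    moreover have "inj ((*v) A)" by (rule inj_matrix_vector_mult[OF A(1)])
    ultimately have "axis 1 1 = (0 :: 'k^3)" by (metis injD matrix_vector_mult_0_right)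
    then have "(axis 1 1 :: 'k^3) $ 1 = 0" by simp
    then show False by (simp add: axis_def)
  qed
  then have "mpt A \<in> proj_points mat_coord" by (auto simp: proj_points_def)
  moreover have "mpt A \<in> PGL3" using A(1) by (auto simp: PGL3_iff)
  moreover have "\<forall>i. v i \<in> P2" using tw by (simp add: twisted_polygon_def)
  ultimately show ?thesis unfolding polygon_point_def A(2) by auto
qed

lemma points_polygon_variety:
  "points (polygon_variety n) = polygon_point n ` {v :: int \<Rightarrow> ('k::alg_closed_field) plane_point. twisted_polygon n v}"
  unfolding polygon_variety_def points_open_sub points_prod_fspace points_power_fspace points_proj_fspace
  using polygon_point_in by blast

lemma locally_ringed_polygon_variety: "locally_ringed (polygon_variety n)"
  unfolding polygon_variety_def by (rule locally_ringed_open_sub_prod)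

text \<open>Regularity is inherited from the ambient product: the ratio is pulled back from the
  plane to the power, and from there to the product with \<open>PGL3\<close>.\<close>

lemma vertex_chart:
  fixes n k :: nat and j :: 3
  assumes k: "k \<in> {1..n}"
  defines "U \<equiv> {P \<in> points (polygon_variety n). \<forall>x\<in>fst P k. x $ j \<noteq> (0 :: 'k::alg_closed_field)}"
  shows "openin (zariski (polygon_variety n)) U"
    "(\<lambda>P. coord_ratio vec_coord i j (fst P k)) \<in> regular_on (polygon_variety n) U"
proof -
  let ?Pj = "proj_fspace vec_coord :: ('k plane_point, 'k) fspace"
  let ?S = "polygon_point n ` {v :: int \<Rightarrow> 'k plane_point. twisted_polygon n v}"
  let ?Q = "open_sub (proj_fspace mat_coord) PGL3 :: ('k pgl3, 'k) fspace"
  have split: "fst P \<in> A \<and> snd P \<in> B \<and> P \<in> S" if "P \<in> A \<times> B \<inter> S" for P A B S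
    using that by auto
  define W where "W = {p \<in> P2. \<forall>x\<in>p. x $ j \<noteq> (0::'k)}"
  note pr = regular_on_proj(1)[where co = vec_coord and S = "points ?Pj" and j = j]
    regular_on_proj(2)[where co = vec_coord and S = "points ?Pj" and j = j and i = i]
  note pr = this[unfolded open_sub_points, unfolded points_proj_fspace vec_coord_def[of j]]
  have W: "{p \<in> P2. \<forall>x\<in>p. x $ j \<noteq> (0::'k)} \<inter> P2 = W" unfolding W_def by blast
  have "openin (zariski ?Pj) W" "coord_ratio vec_coord i j \<in> regular_on ?Pj W"
    using pr unfolding W by blast+
  from conjunct1[OF regular_on_power[OF k this]] conjunct2[OF regular_on_power[OF k this]]
  have "openin (zariski (polygon_variety n)) ({p \<in> {1..n} \<rightarrow>\<^sub>E points ?Pj. p k \<in> W} \<times> points ?Q \<inter> ?S) \<and>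
    (\<lambda>P. coord_ratio vec_coord i j (fst P k)) \<in> regular_on (polygon_variety n)
      ({p \<in> {1..n} \<rightarrow>\<^sub>E points ?Pj. p k \<in> W} \<times> points ?Q \<inter> ?S)"
    unfolding polygon_variety_def by (rule regular_on_prod(1))
  moreover have "{p \<in> {1..n} \<rightarrow>\<^sub>E points ?Pj. p k \<in> W} \<times> points ?Q \<inter> ?S = U"
  proof (intro set_eqI iffI)
    fix P assume P: "P \<in> {p \<in> {1..n} \<rightarrow>\<^sub>E points ?Pj. p k \<in> W} \<times> points ?Q \<inter> ?S"
    then have "fst P k \<in> W" "P \<in> ?S" using split[OF P] by blast+
    then show "P \<in> U" unfolding U_def W_def points_polygon_variety by blast
  next
    fix P assume "P \<in> U"
    then have P: "P \<in> ?S" "\<forall>x\<in>fst P k. x $ j \<noteq> 0" unfolding U_def points_polygon_variety by auto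
    then have Q: "fst P \<in> {1..n} \<rightarrow>\<^sub>E P2" "snd P \<in> proj_points mat_coord \<inter> PGL3"
      using polygon_point_in by fastforce+
    have "fst P k \<in> P2" by (rule PiE_mem[OF Q(1) k])
    then show "P \<in> {p \<in> {1..n} \<rightarrow>\<^sub>E points ?Pj. p k \<in> W} \<times> points ?Q \<inter> ?S"
      unfolding W_def points_open_sub points_proj_fspace using P Q by (cases P) simp
  qed
  ultimately show "openin (zariski (polygon_variety n)) U"
    "(\<lambda>P. coord_ratio vec_coord i j (fst P k)) \<in> regular_on (polygon_variety n) U" by simp_all
qed

lemma monodromy_chart:
  fixes n :: nat and j :: "3 \<times> 3"
  defines "U \<equiv> {P \<in> points (polygon_variety n). \<forall>A\<in>snd P. mat_coord j A \<noteq> (0 :: 'k::alg_closed_field)}"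
  shows "openin (zariski (polygon_variety n)) U"
    "(\<lambda>P. coord_ratio mat_coord i j (snd P)) \<in> regular_on (polygon_variety n) U"
proof -
  let ?X = "power_fspace {1..n} (proj_fspace vec_coord) :: (nat \<Rightarrow> 'k plane_point, 'k) fspace"
  let ?S = "polygon_point n ` {v :: int \<Rightarrow> 'k plane_point. twisted_polygon n v}"
  let ?W = "{p \<in> proj_points mat_coord. \<forall>A\<in>p. mat_coord j A \<noteq> (0 :: 'k)} \<inter> PGL3"
  have split: "fst P \<in> A \<and> snd P \<in> B \<and> P \<in> S" if "P \<in> A \<times> B \<inter> S" for P A B S
    using that by auto
  from regular_on_proj(1)[where co = mat_coord and S = PGL3 and j = j]
    regular_on_proj(2)[where co = mat_coord and S = PGL3 and j = j and i = i]
  have "openin (zariski (polygon_variety n)) (points ?X \<times> ?W \<inter> ?S) \<and>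
    (\<lambda>P. coord_ratio mat_coord i j (snd P)) \<in> regular_on (polygon_variety n) (points ?X \<times> ?W \<inter> ?S)"
    unfolding polygon_variety_def by (rule regular_on_prod(2))
  moreover have "points ?X \<times> ?W \<inter> ?S = U"
  proof (intro set_eqI iffI)
    fix P assume P: "P \<in> points ?X \<times> ?W \<inter> ?S"
    then have "snd P \<in> ?W" "P \<in> ?S" using split[OF P] by blast+
    then show "P \<in> U" unfolding U_def points_polygon_variety by blast
  next
    fix P assume "P \<in> U"
    then have P: "P \<in> ?S" "\<forall>A\<in>snd P. mat_coord j A \<noteq> 0" unfolding U_def points_polygon_variety by auto
    then have "fst P \<in> {1..n} \<rightarrow>\<^sub>E P2" "snd P \<in> proj_points mat_coord \<inter> PGL3"
      using polygon_point_in by fastforce+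
    then show "P \<in> points ?X \<times> ?W \<inter> ?S"
      unfolding points_power_fspace points_proj_fspace using P by (cases P) simp
  qed
  ultimately show "openin (zariski (polygon_variety n)) U"
    "(\<lambda>P. coord_ratio mat_coord i j (snd P)) \<in> regular_on (polygon_variety n) U" by simp_all
qed

text \<open>Recovers the infinite sequence from the finite data of a point; by
  \<open>polygon_point_inj\<close> there is only one. Corners near the ends involve vertices outside
  \<open>{1..n}\<close> and are expressed through it.\<close>

definition polygon_of :: "nat \<Rightarrow> (nat \<Rightarrow> ('k::field) plane_point) \<times> 'k pgl3 \<Rightarrow> int \<Rightarrow> 'k plane_point" where
  "polygon_of n P = (SOME v. twisted_polygon n v \<and> polygon_point n v = P)"

lemma polygon_of_point:
  fixes v :: "int \<Rightarrow> ('k::alg_closed_field) plane_point"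
  assumes "twisted_polygon n v" "n > 0"
  shows "polygon_of n (polygon_point n v) = v"
proof -
  have w: "twisted_polygon n (polygon_of n (polygon_point n v)) \<and>
      polygon_point n (polygon_of n (polygon_point n v)) = polygon_point n v"
    unfolding polygon_of_def
    by (rule someI[of "\<lambda>w. twisted_polygon n w \<and> polygon_point n w = polygon_point n v" v])
      (simp add: assms(1))
  show ?thesis by (rule polygon_point_inj[OF conjunct1[OF w] assms conjunct2[OF w]])
qed

text \<open>Going up to \<open>v (2 n)\<close> covers the five vertices around \<open>v m\<close> for \<open>3 \<le> m \<le> n + 2\<close>, a full period, so that
  the inverse of the monodromy is never needed.\<close>

lemma local_lifts:
  fixes P0 :: "(nat \<Rightarrow> ('k::alg_closed_field) plane_point) \<times> 'k pgl3"
  assumes n: "n > 0" and P0: "P0 \<in> points (polygon_variety n)"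
  obtains W L where "openin (zariski (polygon_variety n)) W" "P0 \<in> W"
    "\<And>k i. k \<in> {1..2*n} \<Longrightarrow> (\<lambda>P. L P k $ i) \<in> regular_on (polygon_variety n) W"
    "\<And>P k. P \<in> W \<Longrightarrow> k \<in> {1..2*n} \<Longrightarrow> L P k \<noteq> 0 \<and> polygon_of n P (int k) = pt (L P k)"
proof -
  let ?U = "polygon_variety n :: ((nat \<Rightarrow> 'k plane_point) \<times> 'k pgl3, 'k) fspace"
  note LU = locally_ringed_polygon_variety[of n]
  note sh = locally_ringedD(1)[OF LU]
  have in_pts: "fst P \<in> {1..n} \<rightarrow>\<^sub>E P2" "snd P \<in> proj_points mat_coord" if "P \<in> points ?U" for P
    using that polygon_point_in unfolding points_polygon_variety by fastforce+
  have "\<exists>j. \<forall>x\<in>fst P0 k. x $ j \<noteq> 0" if k: "k \<in> {1..n}" for k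
  proof -
    have "fst P0 k \<in> P2" using PiE_mem[OF in_pts(1)[OF P0] k] .
    then obtain x where x: "x \<noteq> 0" "fst P0 k = pt x" by (auto simp: proj_points_vec)
    then obtain j where "x $ j \<noteq> 0" by (auto simp: vec_eq_iff)
    then show ?thesis unfolding x(2) by (intro exI[of _ j]) (auto simp: pt_iff)
  qed
  \<comment> \<open>\<open>\<kappa> k\<close> and \<open>\<mu>\<close> name coordinates that do not
    vanish at \<open>P0\<close>. Where they stay nonzero, dividing by them gives representatives
    with regular entries.\<close>
  then obtain \<kappa> where \<kappa>: "\<And>k. k \<in> {1..n} \<Longrightarrow> \<forall>x\<in>fst P0 k. x $ \<kappa> k \<noteq> 0" by metis
  obtain A0 \<mu> where A0: "snd P0 = mpt A0" "mat_coord \<mu> A0 \<noteq> 0"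
    using in_pts(2)[OF P0] by (auto simp: proj_points_def)
  define U1 where "U1 k = {P \<in> points ?U. \<forall>x\<in>fst P k. x $ \<kappa> k \<noteq> 0}" for k
  define U2 where "U2 = {P \<in> points ?U. \<forall>A\<in>snd P. mat_coord \<mu> A \<noteq> 0}"
  define W where "W = (\<Inter>k\<in>{1..n}. U1 k) \<inter> U2"
  have o1: "openin (zariski ?U) (U1 k)"
    "(\<lambda>P. coord_ratio vec_coord i (\<kappa> k) (fst P k)) \<in> regular_on ?U (U1 k)" if "k \<in> {1..n}" for k i
    unfolding U1_def by (rule vertex_chart[OF that])+
  have o2: "openin (zariski ?U) U2" "(\<lambda>P. coord_ratio mat_coord i \<mu> (snd P)) \<in> regular_on ?U U2" for i
    unfolding U2_def by (rule monodromy_chart)+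
  have "openin (zariski ?U) (\<Inter>k\<in>{1..n}. U1 k)" using o1(1) n by (intro openin_INT2) auto
  then have oW: "openin (zariski ?U) W" unfolding W_def using o2(1) by (rule openin_Int)
  have "\<forall>A\<in>snd P0. mat_coord \<mu> A \<noteq> 0"
    unfolding A0(1) using A0(2) by (auto simp: mpt_iff mat_coord_def mat_smult_def)
  then have "P0 \<in> U2" unfolding U2_def using P0 by blast
  then have P0W: "P0 \<in> W" unfolding W_def U1_def using P0 \<kappa> by blast
  have WU: "W \<subseteq> U1 k" "W \<subseteq> U2" if "k \<in> {1..n}" for k using that by (auto simp: W_def)
  define l where "l P k = (\<chi> i. coord_ratio vec_coord i (\<kappa> k) (fst P k))" for P :: "(nat \<Rightarrow> 'k plane_point) \<times> 'k pgl3" and k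
  define N where "N P = (\<chi> i j. coord_ratio mat_coord (i, j) \<mu> (snd P))" for P :: "(nat \<Rightarrow> 'k plane_point) \<times> 'k pgl3"
  define L where "L P k = (if k \<le> n then l P k else N P *v l P (k - n))" for P k
  have rl: "(\<lambda>P. l P k $ i) \<in> regular_on ?U W" if k: "k \<in> {1..n}" for k i
    unfolding l_def vec_lambda_beta by (rule function_sheafD(5)[OF sh o1(1)[OF k] o1(2)[OF k] oW WU(1)[OF k]])
  have rN: "(\<lambda>P. N P $ i $ j) \<in> regular_on ?U W" for i j
    unfolding N_def vec_lambda_beta
    by (rule function_sheafD(5)[OF sh o2(1) o2(2) oW]) (auto simp: W_def)
  have reg: "(\<lambda>P. L P k $ i) \<in> regular_on ?U W" if k: "k \<in> {1..2*n}" for k i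
  proof (cases "k \<le> n")
    case True
    then show ?thesis using rl[of k i] k by (simp add: L_def)
  next
    case False
    then have "k - n \<in> {1..n}" using k by auto
    then show ?thesis
      using regular_on_matrix_vector[OF sh oW rN rl, of "k - n" i] False by (simp add: L_def)
  qed
  have lift: "L P k \<noteq> 0 \<and> polygon_of n P (int k) = pt (L P k)" if P: "P \<in> W" and k: "k \<in> {1..2*n}" for P k
  proof -
    have "P \<in> points ?U" using P by (auto simp: W_def U2_def)
    then obtain v where v: "twisted_polygon n v" "P = polygon_point n v" unfolding points_polygon_variety by blast
    have poly: "polygon_of n P = v" unfolding v(2) by (rule polygon_of_point[OF v(1) n])
    have vert: "v (int m) = pt (l P m)" if m: "m \<in> {1..n}" for m
    proof -
      have fm: "fst P m = v (int m)" using m by (simp add: v(2) polygon_point_def)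
      have vm: "v (int m) \<in> P2" using v(1) by (simp add: twisted_polygon_def)
      then obtain x where x: "x \<noteq> 0" "v (int m) = pt x" by (auto simp: proj_points_vec)
      have "x \<in> fst P m" unfolding fm x(2) by (rule proj_class_self)
      then have "x $ \<kappa> m \<noteq> 0" using P m by (auto simp: W_def U1_def)
      moreover have "coord_ratio vec_coord i (\<kappa> m) (fst P m) = x $ i / x $ \<kappa> m" for i
        using coord_ratio_eq[of x "v (int m)" vec_coord i "\<kappa> m"] vm x(2) proj_class_self[of x vec_coord]
        by (simp add: fm vec_coord_def)
      ultimately have "x = x $ \<kappa> m *s l P m" by (simp add: l_def vec_eq_iff)
      then show ?thesis using \<open>x $ \<kappa> m \<noteq> 0\<close> unfolding x(2) pt_eq_iff by blast
    qed
    have mon: "monodromy n v = mpt (N P)"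
    proof -
      have sm: "snd P = monodromy n v" by (simp add: v(2) polygon_point_def)
      have pp: "snd P \<in> proj_points mat_coord" by (rule in_pts(2)[OF \<open>P \<in> points ?U\<close>])
      then obtain B where B: "snd P = mpt B" by (auto simp: proj_points_def)
      have "B \<in> snd P" unfolding B by (rule proj_class_self)
      then have b: "mat_coord \<mu> B \<noteq> 0" using P by (auto simp: W_def U2_def)
      have "coord_ratio mat_coord i \<mu> (snd P) = mat_coord i B / mat_coord \<mu> B" for i
        by (rule coord_ratio_eq[OF \<open>B \<in> snd P\<close> pp])
      then have "B = mat_smult (mat_coord \<mu> B) (N P)"
        using b by (simp add: N_def mat_smult_def vec_eq_iff) (simp add: mat_coord_def)
      then have "mpt B = mpt (N P)" using mpt_smult[OF b, of "N P"] by simp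
      then show ?thesis using B sm by simp
    qed
    have all: "v (int k) = pt (L P k)"
    proof (cases "k \<le> n")
      case True
      then show ?thesis using vert k by (simp add: L_def)
    next
      case False
      then have m: "k - n \<in> {1..n}" and e: "int (k - n) + int n = int k" using k by auto
      have "pgl_apply (monodromy n v) (v (int (k - n))) = v (int (k - n) + int n)"
        using is_monodromy_monodromy[OF v(1)] unfolding is_monodromy_def by blast
      then have "v (int k) = pgl_apply (monodromy n v) (v (int (k - n)))" unfolding e by (rule sym)
      then show ?thesis unfolding mon vert[OF m] pgl_apply_eq using False by (simp add: L_def)
    qed
    moreover have "L P k \<noteq> 0"
    proof -
      have "v (int k) \<in> P2" using v(1) by (simp add: twisted_polygon_def)
      then obtain x where "x \<noteq> 0" "v (int k) = pt x" by (auto simp: proj_points_vec)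
      then show ?thesis unfolding all pt_eq_iff by (auto simp: vector_mul_eq_0)
    qed
    ultimately show ?thesis unfolding poly by blast
  qed
  show thesis by (rule that[OF oW P0W reg lift])
qed

text \<open>Regularity is a local matter, and near each point the corners are quotients of
  determinants of regular lifts, with denominators nonzero by general position.\<close>

lemma corners_regular:
  fixes n m :: nat
  assumes n: "n \<ge> 4"
  defines "U \<equiv> polygon_variety n :: ((nat \<Rightarrow> ('k::alg_closed_field) plane_point) \<times> 'k pgl3, 'k) fspace"
  assumes m: "3 \<le> m" "m \<le> n + 2"
  shows "(\<lambda>P. left_corner (polygon_of n P) (int m)) \<in> regular_on U (points U)"
    and "(\<lambda>P. right_corner (polygon_of n P) (int m)) \<in> regular_on U (points U)"
proof -
  note LU = locally_ringed_polygon_variety[of n, where ?'a = 'k, folded U_def]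
  note sh = locally_ringedD(1)[OF LU]
  have o: "openin (zariski U) (points U)" by (simp add: points_def)
  have loc: "\<exists>W. openin (zariski U) W \<and> P0 \<in> W \<and> W \<subseteq> points U \<and>
      (\<lambda>P. left_corner (polygon_of n P) (int m)) \<in> regular_on U W \<and>
      (\<lambda>P. right_corner (polygon_of n P) (int m)) \<in> regular_on U W" if P0: "P0 \<in> points U" for P0
  proof -
    have "n > 0" using n by simp
    from local_lifts[OF this P0[unfolded U_def], folded U_def]
    obtain W L where W: "openin (zariski U) W" "P0 \<in> W"
      and reg: "\<And>k i. k \<in> {1..2*n} \<Longrightarrow> (\<lambda>P. L P k $ i) \<in> regular_on U W"
      and L: "\<And>P k. P \<in> W \<Longrightarrow> k \<in> {1..2*n} \<Longrightarrow> L P k \<noteq> 0 \<and> polygon_of n P (int k) = pt (L P k)" by blast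
    have sub: "W \<subseteq> points U" using openin_subset[OF W(1)] by (simp add: points_def)
    define D where "D a b c P = det3 (L P (m - 2 + a)) (L P (m - 2 + b)) (L P (m - 2 + c))" for a b c P
    \<comment> \<open>This is where \<open>n \<ge> 4\<close> enters: the window ends at
      \<open>m + 2 \<le> n + 4 \<le> 2 * n\<close>, and it starts at
      \<open>m - 2 \<ge> 1\<close>.\<close>
    have ix: "m - 2 + a \<in> {1..2*n}" if "a \<le> 4" for a using that m n by auto
    have rD: "(\<lambda>P. D a b c P) \<in> regular_on U W" if "a \<le> 4" "b \<le> 4" "c \<le> 4" for a b c
      unfolding D_def using that by (intro regular_on_det3[OF sh W(1)] reg ix)
    have tw: "twisted_polygon n (polygon_of n P)" if P: "P \<in> W" for P
    proof -
      obtain v where "twisted_polygon n v" "P = polygon_point n v"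
        using P sub unfolding U_def points_polygon_variety by blast
      then show ?thesis using polygon_of_point[of n v] n by simp
    qed
    have D0: "D a b c P \<noteq> 0" if "P \<in> W" "a < b" "b < c" "c \<le> 4" "(a, b, c) \<noteq> (0, 2, 4)" for a b c P
      unfolding D_def
      by (rule twisted_det3[OF tw[OF that(1)], of "int (m - 2)" "int (m - 2 + a)" "int (m - 2 + b)" "int (m - 2 + c)"])
        (use that L[OF that(1) ix] in auto)
    have v: "polygon_of n P (int m - 2) = pt (L P (m - 2 + 0))" "polygon_of n P (int m - 1) = pt (L P (m - 2 + 1))"
      "polygon_of n P (int m) = pt (L P (m - 2 + 2))" "polygon_of n P (int m + 1) = pt (L P (m - 2 + 3))"
      "polygon_of n P (int m + 2) = pt (L P (m - 2 + 4))" if "P \<in> W" for P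
    proof -
      have e: "int m - 2 = int (m - 2 + 0)" "int m - 1 = int (m - 2 + 1)" "int m = int (m - 2 + 2)"
        "int m + 1 = int (m - 2 + 3)" "int m + 2 = int (m - 2 + 4)" using m by auto
      have g: "polygon_of n P (int (m - 2 + a)) = pt (L P (m - 2 + a))" if "a \<le> 4" for a
        using L[OF \<open>P \<in> W\<close> ix[OF that]] by (rule conjunct2)
      show "polygon_of n P (int m - 2) = pt (L P (m - 2 + 0))" by (rule g[of 0, folded e(1)]) simp
      show "polygon_of n P (int m - 1) = pt (L P (m - 2 + 1))" by (rule g[of 1, folded e(2)]) simp
      show "polygon_of n P (int m) = pt (L P (m - 2 + 2))" by (rule g[of 2, folded e(3)]) simp
      show "polygon_of n P (int m + 1) = pt (L P (m - 2 + 3))" by (rule g[of 3, folded e(4)]) simp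
      show "polygon_of n P (int m + 2) = pt (L P (m - 2 + 4))" by (rule g[of 4, folded e(5)]) simp
    qed
    have l: "left_corner (polygon_of n P) (int m) = D 0 1 3 P * D 2 3 4 P / (D 0 2 3 P * D 1 3 4 P)"
      "right_corner (polygon_of n P) (int m) = D 1 3 4 P * D 0 1 2 P / (D 1 2 4 P * D 0 1 3 P)" if P: "P \<in> W" for P
    proof -
      have d: "D 0 1 3 P \<noteq> 0" "D 0 2 3 P \<noteq> 0" "D 1 3 4 P \<noteq> 0" "D 1 2 4 P \<noteq> 0"
        by (rule D0[OF P]; simp)+
      note d = d[unfolded D_def]
      show "left_corner (polygon_of n P) (int m) = D 0 1 3 P * D 2 3 4 P / (D 0 2 3 P * D 1 3 4 P)"
        unfolding D_def by (rule left_corner_eq[OF v[OF P] d(1,2,3)])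
      show "right_corner (polygon_of n P) (int m) = D 1 3 4 P * D 0 1 2 P / (D 1 2 4 P * D 0 1 3 P)"
        unfolding D_def by (rule right_corner_eq[OF v[OF P] d(1,4,3)])
    qed
    have rl: "(\<lambda>P. D 0 1 3 P * D 2 3 4 P / (D 0 2 3 P * D 1 3 4 P)) \<in> regular_on U W"
      by (intro regular_on_divide[OF LU W(1)] function_sheafD(3)[OF sh W(1)] rD) (simp_all add: D0)
    have rr: "(\<lambda>P. D 1 3 4 P * D 0 1 2 P / (D 1 2 4 P * D 0 1 3 P)) \<in> regular_on U W"
      by (intro regular_on_divide[OF LU W(1)] function_sheafD(3)[OF sh W(1)] rD) (simp_all add: D0)
    have "(\<lambda>P. left_corner (polygon_of n P) (int m)) \<in> regular_on U W"
      "(\<lambda>P. right_corner (polygon_of n P) (int m)) \<in> regular_on U W"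
      by (rule function_sheafD(4)[OF sh W(1) rl], erule l(1))
        (rule function_sheafD(4)[OF sh W(1) rr], erule l(2))
    then show ?thesis using W sub by blast
  qed
  show "(\<lambda>P. left_corner (polygon_of n P) (int m)) \<in> regular_on U (points U)"
    by (rule function_sheafD(6)[OF sh o]) (use loc in blast)
  show "(\<lambda>P. right_corner (polygon_of n P) (int m)) \<in> regular_on U (points U)"
    by (rule function_sheafD(6)[OF sh o]) (use loc in blast)
qed

section \<open>The quotient map and its section\<close>

definition corner_values :: "nat \<Rightarrow> (int \<Rightarrow> ('k::field) plane_point) \<Rightarrow> nat \<Rightarrow> 'k" where
  "corner_values n v j = (if j < n then left_corner v (int j + 1) else right_corner v (int (j - n) + 1))"

definition corner_map ::
    "nat \<Rightarrow> (nat \<Rightarrow> ('k::field) plane_point) \<times> 'k pgl3 \<Rightarrow> nat \<Rightarrow> 'k" where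
  "corner_map n P = corner_embed n (corner_values n (polygon_of n P))"

text \<open>The corner with index \<open>i\<close> in \<open>{1..n}\<close> is stored at position
  \<open>i - 1\<close>; the remainder continues it periodically.\<close>

definition left_seq :: "nat \<Rightarrow> (nat \<Rightarrow> 'k) \<Rightarrow> int \<Rightarrow> 'k" where
  "left_seq n z i = z (nat ((i - 1) mod int n))"

definition right_seq :: "nat \<Rightarrow> (nat \<Rightarrow> 'k) \<Rightarrow> int \<Rightarrow> 'k" where
  "right_seq n z i = z (n + nat ((i - 1) mod int n))"

definition section_lift :: "nat \<Rightarrow> (nat \<Rightarrow> 'k::field) \<Rightarrow> int \<Rightarrow> 'k^3" where
  "section_lift n z = (SOME V. corner_rec (left_seq n z) (right_seq n z) V \<and>
     V 1 = axis 1 1 \<and> V 2 = axis 2 1 \<and> V 3 = axis 3 1)"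

text \<open>Since \<open>V 1\<close>, \<open>V 2\<close>, \<open>V 3\<close> is the standard basis,
  the matrix taking it to \<open>V (n + 1)\<close>, \<open>V (n + 2)\<close>,
  \<open>V (n + 3)\<close> has these vectors as columns.\<close>

definition corner_section ::
    "nat \<Rightarrow> (nat \<Rightarrow> 'k::field) \<Rightarrow> (nat \<Rightarrow> 'k plane_point) \<times> 'k pgl3" where
  "corner_section n z = (\<lambda>i\<in>{1..n}. pt (section_lift n z (int i)),
     mpt (column_matrix (section_lift n z (int n + 1)) (section_lift n z (int n + 2)) (section_lift n z (int n + 3))))"

lemma corner_values_nonzero:
  fixes v :: "int \<Rightarrow> ('k::alg_closed_field) plane_point"
  assumes "twisted_polygon n v"
  shows "corner_values n v j \<noteq> 0 \<and> corner_values n v j \<noteq> 1"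
  using normalised_lift[OF assms] unfolding corner_values_def by metis

lemma corner_map_point:
  fixes v :: "int \<Rightarrow> ('k::alg_closed_field) plane_point"
  assumes "twisted_polygon n v" "n > 0"
  shows "corner_map n (polygon_point n v) = corner_embed n (corner_values n v)"
  by (simp add: corner_map_def polygon_of_point[OF assms])

lemma morphism_corner_map:
  fixes n :: nat
  assumes n: "n \<ge> 4"
  shows "morphism (polygon_variety n) (affine_sub (4*n) (corner_set n))
    (corner_map n :: (nat \<Rightarrow> ('k::alg_closed_field) plane_point) \<times> 'k pgl3 \<Rightarrow> nat \<Rightarrow> 'k)"
proof -
  let ?U = "polygon_variety n :: ((nat \<Rightarrow> 'k plane_point) \<times> 'k pgl3, 'k) fspace"
  note LU = locally_ringed_polygon_variety[of n, where ?'a = 'k]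
  note sh = locally_ringedD(1)[OF LU]
  have o: "openin (zariski ?U) (points ?U)" by (simp add: points_def)
  have tw: "twisted_polygon n (polygon_of n P)" if P: "P \<in> points ?U" for P
  proof -
    obtain v where v: "twisted_polygon n v" "P = polygon_point n v"
      using P unfolding points_polygon_variety by blast
    show ?thesis using v polygon_of_point[OF v(1)] n by simp
  qed
  \<comment> \<open>\<open>corners_regular\<close> covers the indices \<open>3\<close> to
    \<open>n + 2\<close>; the first two corners are moved there by one period.\<close>
  define m where "m j = (if j \<ge> 2 then j + 1 else j + 1 + n)" for j
  have m: "3 \<le> m j" "m j \<le> n + 2" if "j < n" for j using that n by (auto simp: m_def)
  have mv: "left_corner v (int j + 1) = left_corner v (int (m j))"
    "right_corner v (int j + 1) = right_corner v (int (m j))" if "twisted_polygon n v" for v :: "int \<Rightarrow> 'k plane_point" and j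
    using corners_periodic[OF that, of "int j + 1"] by (auto simp: m_def add_ac)
  have regl: "(\<lambda>P. left_corner (polygon_of n P) (int j + 1)) \<in> regular_on ?U (points ?U)" if "j < n" for j
    by (rule function_sheafD(4)[OF sh o corners_regular(1)[OF n m[OF that]]]) (erule mv(1)[OF tw])
  have regr: "(\<lambda>P. right_corner (polygon_of n P) (int j + 1)) \<in> regular_on ?U (points ?U)" if "j < n" for j
    by (rule function_sheafD(4)[OF sh o corners_regular(2)[OF n m[OF that]]]) (erule mv(2)[OF tw])
  have reg: "(\<lambda>P. corner_values n (polygon_of n P) j) \<in> regular_on ?U (points ?U)" if "j < 2*n" for j
    using that regl[of j] regr[of "j - n"] by (cases "j < n") (simp_all add: corner_values_def)
  have "morphism ?U (affine_sub (4*n) (corner_set n)) (\<lambda>P. corner_embed n (corner_values n (polygon_of n P)))"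
    by (rule morphism_into_corner_set[OF LU reg]) (auto simp: corner_values_nonzero[OF tw])
  then show ?thesis by (simp add: corner_map_def[abs_def])
qed

section \<open>The section: polygons with prescribed corner invariants\<close>

lemma seq_nonzero:
  assumes "z \<in> corner_set n" "n > 0"
  shows "left_seq n z i \<noteq> 0" "left_seq n z i \<noteq> 1" "right_seq n z i \<noteq> 0" "right_seq n z i \<noteq> 1"
proof -
  have "nat ((i - 1) mod int n) < n" using assms(2) by (simp add: nat_less_iff)
  then have "nat ((i - 1) mod int n) < 2*n" "n + nat ((i - 1) mod int n) < 2*n" by simp_all
  then show "left_seq n z i \<noteq> 0" "left_seq n z i \<noteq> 1" "right_seq n z i \<noteq> 0" "right_seq n z i \<noteq> 1"
    unfolding left_seq_def right_seq_def using corner_set_nonzero[OF assms(1)] by blast+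
qed

lemma seq_periodic:
  "left_seq n z (i + int n) = left_seq n z i" "right_seq n z (i + int n) = right_seq n z i"
proof -
  have "(i + int n - 1) mod int n = (i - 1) mod int n"
    using mod_add_self2[of "i - 1" "int n"] by (simp add: algebra_simps)
  then show "left_seq n z (i + int n) = left_seq n z i" "right_seq n z (i + int n) = right_seq n z i"
    by (simp_all add: left_seq_def right_seq_def)
qed

lemma section_lift_props:
  assumes "z \<in> corner_set n" "n > 0"
  shows "corner_rec (left_seq n z) (right_seq n z) (section_lift n z)"
    "section_lift n z 1 = axis 1 1" "section_lift n z 2 = axis 2 1" "section_lift n z 3 = axis 3 1"
proof -
  have "det3 (axis 1 1) (axis 2 1) (axis 3 1 :: 'a^3) \<noteq> 0" by (simp add: det3_def axis_def)
  then obtain V where "corner_rec (left_seq n z) (right_seq n z) V" "V 1 = axis 1 1" "V 2 = axis 2 1" "V 3 = axis 3 1"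
    by (rule corner_rec_exists[OF seq_nonzero(1,3)[OF assms]])
  then have "\<exists>V. corner_rec (left_seq n z) (right_seq n z) V \<and> V 1 = axis 1 1 \<and> V 2 = axis 2 1 \<and> V 3 = axis 3 1"
    by blast
  from someI_ex[OF this, folded section_lift_def]
  have "corner_rec (left_seq n z) (right_seq n z) (section_lift n z) \<and>
     section_lift n z 1 = axis 1 1 \<and> section_lift n z 2 = axis 2 1 \<and> section_lift n z 3 = axis 3 1" .
  then show "corner_rec (left_seq n z) (right_seq n z) (section_lift n z)"
    "section_lift n z 1 = axis 1 1" "section_lift n z 2 = axis 2 1" "section_lift n z 3 = axis 3 1" by simp_all
qed

lemma corner_section_polygon:
  fixes z :: "nat \<Rightarrow> 'k::alg_closed_field"
  assumes z: "z \<in> corner_set n" and n: "n > 0"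
  defines "v \<equiv> \<lambda>i. pt (section_lift n z i)"
  shows "twisted_polygon n v" "corner_section n z = polygon_point n v"
    "left_corner v i = left_seq n z i" "right_corner v i = right_seq n z i"
    "invertible (column_matrix (section_lift n z (int n + 1)) (section_lift n z (int n + 2)) (section_lift n z (int n + 3)))"
proof -
  let ?V = "section_lift n z"
  let ?C = "column_matrix (?V (int n + 1)) (?V (int n + 2)) (?V (int n + 3))"
  note V = section_lift_props[OF z n] and nz = seq_nonzero[OF z n]
  obtain A where A: "invertible A" "\<And>i. A *v ?V i = ?V (i + int n)"
    using monodromy_exists[OF V(1) nz(1,3) seq_periodic] by blast
  have D: "det3 (?V 1) (?V 2) (?V 3) \<noteq> 0" using V(1) by (simp add: corner_rec_def)
  \<comment> \<open>The monodromy matrix \<open>A\<close> and the column matrix agree on the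
    standard basis, hence are equal.\<close>
  have "?C *v ?V 1 = ?V (int n + 1)" "?C *v ?V 2 = ?V (int n + 2)" "?C *v ?V 3 = ?V (int n + 3)"
    unfolding V(2-4) column_matrix_apply by (simp_all add: axis_def)
  moreover have "A *v ?V 1 = ?V (int n + 1)" "A *v ?V 2 = ?V (int n + 2)" "A *v ?V 3 = ?V (int n + 3)"
    unfolding A(2) by (simp_all only: add.commute)
  ultimately have "A *v ?V 1 = ?C *v ?V 1" "A *v ?V 2 = ?C *v ?V 2" "A *v ?V 3 = ?C *v ?V 3"
    by (metis (no_types))+
  then have "A = ?C" by (rule matrix_determined[OF D])
  then show "invertible ?C" using A(1) by simp
  note P = corner_rec_polygon[where V = ?V and n = n and A = A, OF V(1) nz seq_periodic[of n z] A]
  show tw: "twisted_polygon n v" unfolding v_def by (rule P(1))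
  have "monodromy n v = mpt ?C"
    unfolding v_def using P(2) unfolding \<open>A = ?C\<close> .
  then show "corner_section n z = polygon_point n v"
    by (simp add: corner_section_def polygon_point_def v_def)
  show "left_corner v i = left_seq n z i" "right_corner v i = right_seq n z i"
    by (rule corner_rec_corners[OF V(1) nz(1,3)]; simp add: v_def)+
qed

text \<open>Run forwards, the recurrence only adds and multiplies, so from constant initial vectors
  all coordinates at positive indices are polynomial in \<open>z\<close>. Three consecutive indices
  carry the induction.\<close>

lemma section_lift_regular:
  fixes n m :: nat
  assumes n: "n > 0"
  defines "T \<equiv> affine_sub (4*n) (corner_set n) :: (nat \<Rightarrow> 'k::alg_closed_field, 'k) fspace"
  shows "(\<lambda>z. section_lift n z (int m + 1) $ c) \<in> regular_on T (points T) \<and>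
    (\<lambda>z. section_lift n z (int m + 2) $ c) \<in> regular_on T (points T) \<and>
    (\<lambda>z. section_lift n z (int m + 3) $ c) \<in> regular_on T (points T)"
proof -
  have pT: "points T = corner_set n" by (simp add: T_def points_affine_sub)
  have LT: "locally_ringed T" unfolding T_def by (rule locally_ringed_affine)
  note sh = locally_ringedD(1)[OF LT]
  have o: "openin (zariski T) (corner_set n)" unfolding T_def by (rule openin_affine)
  have ini: "(\<lambda>z. section_lift n z i $ c) \<in> regular_on T (corner_set n)"
    if "\<And>z :: nat \<Rightarrow> 'k. z \<in> corner_set n \<Longrightarrow> section_lift n z i = a" for i a
    by (rule function_sheafD(4)[OF sh o function_sheafD(1)[OF sh o, of "a $ c"]]) (simp add: that)
  have idx: "nat ((i - 1) mod int n) < n" for i using n by (simp add: nat_less_iff)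
  have seq: "(\<lambda>z. left_seq n z i) \<in> regular_on T (corner_set n)"
      "(\<lambda>z. right_seq n z i) \<in> regular_on T (corner_set n)" for i
    unfolding left_seq_def right_seq_def T_def using idx[of i]
    by (intro regular_on_affine; simp)+
  show ?thesis
    unfolding pT
  proof (induction m)
    case 0
    show ?case
      using ini[OF section_lift_props(2)[OF _ n]] ini[OF section_lift_props(3)[OF _ n]]
        ini[OF section_lift_props(4)[OF _ n]] by simp
  next
    case (Suc m)
    let ?i = "int m + 1"
    have e: "?i + 1 = int m + 2" "?i + 2 = int m + 3" by simp_all
    have "(\<lambda>z. section_lift n z (?i + 2) $ c - right_seq n z (?i + 1) * section_lift n z (?i + 1) $ c +
        left_seq n z (?i + 1) * right_seq n z (?i + 1) * right_seq n z ?i * section_lift n z ?i $ c)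
        \<in> regular_on T (corner_set n)"
      using Suc unfolding e
      by (intro function_sheafD(2)[OF sh o] function_sheafD(3)[OF sh o] regular_on_diff[OF sh o] seq) simp_all
    then have "(\<lambda>z. section_lift n z (?i + 3) $ c) \<in> regular_on T (corner_set n)"
    proof (rule function_sheafD(4)[OF sh o])
      fix z :: "nat \<Rightarrow> 'k" assume z: "z \<in> corner_set n"
      show "section_lift n z (?i + 3) $ c = section_lift n z (?i + 2) $ c -
        right_seq n z (?i + 1) * section_lift n z (?i + 1) $ c +
        left_seq n z (?i + 1) * right_seq n z (?i + 1) * right_seq n z ?i * section_lift n z ?i $ c"
        unfolding corner_recD(1)[OF section_lift_props(1)[OF z n], of ?i] by simp
    qed
    moreover have "?i + 3 = int (Suc m) + 3" "int m + 2 = int (Suc m) + 1" "int m + 3 = int (Suc m) + 2" by simp_all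
    ultimately show ?case using Suc by (simp only:)
  qed
qed

lemma morphism_corner_section:
  fixes n :: nat
  assumes n: "n > 0"
  shows "morphism (affine_sub (4*n) (corner_set n)) (polygon_variety n)
    (corner_section n :: (nat \<Rightarrow> 'k::alg_closed_field) \<Rightarrow> (nat \<Rightarrow> 'k plane_point) \<times> 'k pgl3)"
proof -
  let ?T = "affine_sub (4*n) (corner_set n) :: (nat \<Rightarrow> 'k, 'k) fspace"
  have LT: "locally_ringed ?T" by (rule locally_ringed_affine)
  have pT: "points ?T = corner_set n" by (rule points_affine_sub)
  have reg: "(\<lambda>z. section_lift n z i $ c) \<in> regular_on ?T (points ?T)" if i: "i \<ge> 1" for i c
  proof -
    have "int (nat (i - 1)) + 1 = i" using i by simp
    then show ?thesis using conjunct1[OF section_lift_regular[OF n, of "nat (i - 1)" c]] by (simp only:)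
  qed
  have nz: "section_lift n z i \<noteq> 0" if "z \<in> corner_set n" for z :: "nat \<Rightarrow> 'k" and i
    using det3_nonzero_vectors(1)[OF corner_rec_det[OF section_lift_props(1)[OF that n] seq_nonzero(1,3)[OF that n]]] .
  have "morphism ?T (open_sub (proj_fspace vec_coord) (points (proj_fspace vec_coord))) (\<lambda>z. pt (section_lift n z (int i)))"
    if i: "i \<in> {1..n}" for i
  proof (rule morphism_into_proj[OF LT])
    show "(\<lambda>z. vec_coord c (section_lift n z (int i))) \<in> regular_on ?T (points ?T)" for c
      using reg[of "int i" c] i by (simp add: vec_coord_def)
    fix z assume "z \<in> points ?T"
    then have z: "section_lift n z (int i) \<noteq> 0" using nz by (simp add: pT)
    then show "\<exists>c. vec_coord c (section_lift n z (int i)) \<noteq> 0" by (auto simp: vec_coord_def vec_eq_iff)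
    show "pt (section_lift n z (int i)) \<in> points (proj_fspace vec_coord)"
      unfolding points_proj_fspace proj_points_vec using z by blast
  qed
  then have 1: "morphism ?T (power_fspace {1..n} (proj_fspace vec_coord)) (\<lambda>z. \<lambda>i\<in>{1..n}. pt (section_lift n z (int i)))"
    unfolding open_sub_points by (rule morphism_into_power[OF LT])
  let ?C = "\<lambda>z :: nat \<Rightarrow> 'k. column_matrix (section_lift n z (int n + 1)) (section_lift n z (int n + 2)) (section_lift n z (int n + 3))"
  have 2: "morphism ?T (open_sub (proj_fspace mat_coord) PGL3) (\<lambda>z. mpt (?C z))"
  proof (rule morphism_into_proj[OF LT])
    show "(\<lambda>z. mat_coord ij (?C z)) \<in> regular_on ?T (points ?T)" for ij
      using exhaust_3[of "snd ij"] reg[of "int n + 1" "fst ij"] reg[of "int n + 2" "fst ij"] reg[of "int n + 3" "fst ij"]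
      by (auto simp: mat_coord_def column_matrix_def vector_3)
    fix z assume "z \<in> points ?T"
    then have z: "z \<in> corner_set n" by (simp add: pT)
    show "mpt (?C z) \<in> PGL3" using corner_section_polygon(5)[OF z n] by (auto simp: PGL3_iff)
    have "section_lift n z (int n + 1) \<noteq> 0" by (rule nz[OF z])
    then obtain c where "section_lift n z (int n + 1) $ c \<noteq> 0" by (auto simp: vec_eq_iff)
    then show "\<exists>ij. mat_coord ij (?C z) \<noteq> 0"
      by (intro exI[of _ "(c, 1)"]) (simp add: mat_coord_def column_matrix_def vector_3)
  qed
  have "morphism ?T (polygon_variety n) (\<lambda>z. (\<lambda>i\<in>{1..n}. pt (section_lift n z (int i)), mpt (?C z)))"
    unfolding polygon_variety_def
  proof (rule morphism_into_prod[OF LT 1 2])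
    fix z assume "z \<in> points ?T"
    then have z: "z \<in> corner_set n" by (simp add: pT)
    show "(\<lambda>i\<in>{1..n}. pt (section_lift n z (int i)), mpt (?C z)) \<in> polygon_point n ` {v. twisted_polygon n v}"
      using corner_section_polygon(1,2)[OF z n] unfolding corner_section_def by blast
  qed
  then show ?thesis by (simp add: corner_section_def[abs_def])
qed

lemma corner_map_section:
  fixes z :: "nat \<Rightarrow> 'k::alg_closed_field"
  assumes z: "z \<in> corner_set n" and n: "n > 0"
  shows "corner_map n (corner_section n z) = z"
proof -
  note q = corner_section_polygon[OF z n]
  have "corner_values n (\<lambda>i. pt (section_lift n z i)) j = z j" if "j < 2*n" for j
  proof (cases "j < n")
    case True
    then have "nat ((int j + 1 - 1) mod int n) = j" by simp
    then show ?thesis using True unfolding corner_values_def q(3) left_seq_def by simp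
  next
    case False
    then have "j - n < n" using that by simp
    then have "nat ((int (j - n) + 1 - 1) mod int n) = j - n" by (simp del: of_nat_diff)
    then show ?thesis using False unfolding corner_values_def q(4) right_seq_def by simp
  qed
  then show ?thesis
    unfolding q(2) corner_map_point[OF q(1) n] by (rule corner_embed_eq[OF z])
qed

section \<open>Fibres, orbits and the universal property\<close>

lemma corner_map_in:
  fixes v :: "int \<Rightarrow> ('k::alg_closed_field) plane_point"
  assumes "twisted_polygon n v" "n > 0"
  shows "corner_map n (polygon_point n v) \<in> corner_set n"
  unfolding corner_map_point[OF assms] by (rule corner_embed_in) (rule corner_values_nonzero[OF assms(1)])

text \<open>Both sides are periodic and agree on one period by the layout of
  \<open>corner_values\<close>.\<close>

lemma corner_map_seq:
  fixes v :: "int \<Rightarrow> ('k::alg_closed_field) plane_point"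
  assumes tw: "twisted_polygon n v" and n: "n > 0"
  shows "left_seq n (corner_map n (polygon_point n v)) i = left_corner v i"
    "right_seq n (corner_map n (polygon_point n v)) i = right_corner v i"
proof -
  let ?z = "corner_map n (polygon_point n v)"
  have z: "?z j = corner_values n v j" if "j < 2*n" for j
    using that by (simp add: corner_map_point[OF assms] corner_embed_def)
  show "left_seq n ?z i = left_corner v i"
  proof (rule periodic_step_eq[OF n])
    show "left_seq n ?z i = left_corner v i \<longleftrightarrow> left_seq n ?z (i + int n) = left_corner v (i + int n)" for i
      by (simp add: seq_periodic corners_periodic[OF tw])
    show "left_seq n ?z (int j) = left_corner v (int j)" if j: "j \<in> {1..n}" for j
    proof -
      have e: "nat ((int j - 1) mod int n) = j - 1" using j by auto
      show ?thesis using z[of "j - 1"] j unfolding left_seq_def e by (auto simp: corner_values_def of_nat_diff)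
    qed
  qed
  show "right_seq n ?z i = right_corner v i"
  proof (rule periodic_step_eq[OF n])
    show "right_seq n ?z i = right_corner v i \<longleftrightarrow> right_seq n ?z (i + int n) = right_corner v (i + int n)" for i
      by (simp add: seq_periodic corners_periodic[OF tw])
    show "right_seq n ?z (int j) = right_corner v (int j)" if j: "j \<in> {1..n}" for j
    proof -
      have e: "nat ((int j - 1) mod int n) = j - 1" using j by auto
      show ?thesis using z[of "n + (j - 1)"] j unfolding right_seq_def e by (auto simp: corner_values_def of_nat_diff)
    qed
  qed
qed

lemma corner_map_fibres:
  fixes v w :: "int \<Rightarrow> ('k::alg_closed_field) plane_point"
  assumes tw: "twisted_polygon n v" "twisted_polygon n w" and n: "n > 0"
    and eq: "corner_map n (polygon_point n v) = corner_map n (polygon_point n w)"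
  shows "\<exists>g\<in>PGL3. polygon_point n w = pgl_action n g (polygon_point n v)"
proof -
  have c: "left_corner w i = left_corner v i" "right_corner w i = right_corner v i" for i
    using corner_map_seq[OF tw(1) n, of i] corner_map_seq[OF tw(2) n, of i] unfolding eq by simp_all
  obtain A where A: "invertible A" "w = (\<lambda>i. pgl_apply (mpt A) (v i))" by (rule same_corners[OF tw c])
  have "polygon_point n w = pgl_action n (mpt A) (polygon_point n v)"
    unfolding A(2) by (rule transform_polygon(2)[OF tw(1) A(1)])
  moreover have "mpt A \<in> PGL3" using A(1) by (auto simp: PGL3_iff)
  ultimately show ?thesis by blast
qed

text \<open>\<open>f \<circ> corner_section n\<close> factors \<open>f\<close>, because
  \<open>corner_section n (corner_map n x)\<close> has the same image as \<open>x\<close> and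
  therefore lies in its orbit. It is the only factorisation, because \<open>corner_map n\<close> is
  left inverse to the section.\<close>

lemma geometric_quotient_corner_map:
  fixes n :: nat
  assumes n: "n \<ge> 4"
  shows "geometric_quotient PGL3 (pgl_action n)
    (polygon_variety n :: ((nat \<Rightarrow> ('k::alg_closed_field) plane_point) \<times> 'k pgl3, 'k) fspace)
    (affine_sub (4*n) (corner_set n)) (corner_map n)"
  unfolding geometric_quotient_def categorical_quotient_def
proof (intro conjI allI impI ballI)
  let ?U = "polygon_variety n :: ((nat \<Rightarrow> 'k plane_point) \<times> 'k pgl3, 'k) fspace"
  let ?T = "affine_sub (4*n) (corner_set n) :: (nat \<Rightarrow> 'k, 'k) fspace"
  have n0: "n > 0" using n by simp
  have pT: "points ?T = corner_set n" by (rule points_affine_sub)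
  show "variety ?T" by (rule variety_affine[OF closedin_corner_set])
  show "morphism ?U ?T (corner_map n)" by (rule morphism_corner_map[OF n])
  show "invariant PGL3 (pgl_action n) ?U (corner_map n)"
    unfolding invariant_def points_polygon_variety
  proof (intro ballI)
    fix g :: "'k pgl3" and P assume "g \<in> PGL3" "P \<in> polygon_point n ` {v :: int \<Rightarrow> 'k plane_point. twisted_polygon n v}"
    then obtain A v where A: "invertible A" "g = mpt A" and v: "twisted_polygon n v" "P = polygon_point n v"
      by (auto simp: PGL3_iff)
    note t = transform_polygon[OF v(1) A(1)]
    have "corner_values n (\<lambda>i. pgl_apply (mpt A) (v i)) = corner_values n v"
      by (rule ext) (simp add: corner_values_def t(3,4))
    then show "corner_map n (pgl_action n g P) = corner_map n P"
      unfolding A(2) v(2) t(2)[symmetric] corner_map_point[OF t(1) n0] corner_map_point[OF v(1) n0]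
      by simp
  qed
  show "\<exists>g\<in>PGL3. y = pgl_action n g x"
    if "x \<in> points ?U" "y \<in> points ?U" "corner_map n x = corner_map n y" for x y
    using that corner_map_fibres[OF _ _ n0] unfolding points_polygon_variety by blast
  fix W :: "(nat \<Rightarrow> 'k, 'k) fspace" and f
  assume f: "variety W \<and> morphism ?U W f \<and> invariant PGL3 (pgl_action n) ?U f"
  have sec: "corner_section n z \<in> points ?U" if "z \<in> corner_set n" for z :: "nat \<Rightarrow> 'k"
    using corner_section_polygon(1,2)[OF that n0] unfolding points_polygon_variety by blast
  show "\<exists>h. morphism ?T W h \<and> (\<forall>x\<in>points ?U. h (corner_map n x) = f x) \<and>
      (\<forall>h'. morphism ?T W h' \<and> (\<forall>x\<in>points ?U. h' (corner_map n x) = f x) \<longrightarrow> (\<forall>y\<in>points ?T. h' y = h y))"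
  proof (intro exI[of _ "f \<circ> corner_section n"] conjI allI impI ballI)
    show "morphism ?T W (f \<circ> corner_section n)"
      using f by (intro morphism_comp[OF morphism_corner_section[OF n0]]) simp
    show "(f \<circ> corner_section n) (corner_map n x) = f x" if x: "x \<in> points ?U" for x
    proof -
      obtain v where v: "twisted_polygon n v" "x = polygon_point n v" using x unfolding points_polygon_variety by blast
      have z: "corner_map n x \<in> corner_set n" unfolding v(2) by (rule corner_map_in[OF v(1) n0])
      note q = corner_section_polygon(1,2)[OF z n0]
      let ?w = "\<lambda>i. pt (section_lift n (corner_map n x) i)"
      have "corner_map n (polygon_point n v) = corner_map n (polygon_point n ?w)"
        unfolding q(2)[symmetric] v(2)[symmetric] corner_map_section[OF z n0] ..
      from corner_map_fibres[OF v(1) q(1) n0 this]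
      obtain g where "g \<in> PGL3" "corner_section n (corner_map n x) = pgl_action n g x"
        unfolding q(2)[symmetric] v(2)[symmetric] by blast
      then show ?thesis using f x by (auto simp: invariant_def)
    qed
    show "h' y = (f \<circ> corner_section n) y"
      if "morphism ?T W h' \<and> (\<forall>x\<in>points ?U. h' (corner_map n x) = f x)" "y \<in> points ?T" for h' y
      using that sec[of y] corner_map_section[of y n] n0 by (simp add: pT) metis
  qed
qed

theorem theorem3p6:
  fixes n :: nat
  assumes "n \<ge> 4"
  shows "\<exists>(T :: (nat \<Rightarrow> 'k::alg_closed_field, 'k) fspace) \<pi> \<Phi>.
           geometric_quotient PGL3 (pgl_action n) (polygon_variety n) T \<pi> \<and>
           isomorphism T (corner_space n) \<Phi> \<and>
           (\<forall>v. twisted_polygon n v \<longrightarrow> \<Phi> (\<pi> (polygon_point n v)) = corner_invariants n v)"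
proof (intro exI conjI allI impI)
  show "geometric_quotient PGL3 (pgl_action n) (polygon_variety n)
      (affine_sub (4*n) (corner_set n) :: (nat \<Rightarrow> 'k, 'k) fspace) (corner_map n)"
    by (rule geometric_quotient_corner_map[OF assms])
  show "isomorphism (affine_sub (4*n) (corner_set n)) (corner_space n)
      (\<lambda>z. \<lambda>j\<in>{1..2*n}. P1_point (z (j - 1)) (1 :: 'k))"
    by (rule corner_set_iso)
  fix v :: "int \<Rightarrow> 'k plane_point" assume v: "twisted_polygon n v"
  have n0: "n > 0" using assms by simp
  show "(\<lambda>j\<in>{1..2*n}. P1_point (corner_map n (polygon_point n v) (j - 1)) 1) = corner_invariants n v"
    unfolding corner_invariants_def corner_map_point[OF v n0]
  proof (rule restrict_ext)
    fix j :: nat assume j: "j \<in> {1..2*n}"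
    \<comment> \<open>As \<open>j - 1 < 2 * n\<close>, the auxiliary inverse coordinates are not
      met.\<close>
    have "corner_embed n (corner_values n v) (j - 1) = corner_values n v (j - 1)"
      using j by (auto simp: corner_embed_def)
    also have "\<dots> = (if j \<le> n then left_corner v (int j) else right_corner v (int (j - n)))"
    proof -
      have "int (j - 1) + 1 = int j" "j - 1 < n \<longleftrightarrow> j \<le> n" using j by auto
      moreover have "int (j - 1 - n) + 1 = int (j - n)" if "\<not> j \<le> n" using that by auto
      ultimately show ?thesis unfolding corner_values_def by simp
    qed
    finally show "P1_point (corner_embed n (corner_values n v) (j - 1)) 1 =
      P1_point (if j \<le> n then left_corner v (int j) else right_corner v (int (j - n))) 1" by simp
  qed
qed

end
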